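(* Let $c(n,k)$ be a proper $q$-hypergeometric term, let $(\hat J(n))_{n\ge0}$ be a $q$-holonomic sequence, and let $$J(n)=\sum_{k=0}^n c(n,k)\,\hat J(k).$$ Then $(J(n))$ is $q$-holonomic. Moreover, a linear $q$-difference equation for $(J(n))$ can be constructed (algorithmically) from a linear $q$-difference equation for $(\hat J(n))$ and from $c(n,k)$.
   Context: Sequences take values in $\mathbb{Q}(q)$. A sequence is $q$-holonomic if it satisfies a nontrivial linear $q$-difference equation $\sum_{i=0}^{d}a_i(q^n,q)J(n+i)=0$ with coefficients $a_i\in\mathbb{Q}(q,q^n)$, not all zero. A term $F(n,k)$ is $q$-hypergeometric if $F(n+1,k)/F(n,k)$ and $F(n,k+1)/F(n,k)$ both lie in $\mathbb{Q}(q,q^n,q^k)$. A $q$-hypergeometric term is proper if it is a ratio of products of quantum factorials $(q;q)_{an+bk+c}$ of integer linear forms in $n,k$, times $q$ raised to a quadratic function of $n$ and $k$. Here $(x;q)_0=1$, $(x;q)_m=(1-x)(1-xq)\cdots(1-xq^{m-1})$ for $m>0$, and $(x;q)_{m}=\frac{1}{(1-xq^{-1})\cdots(1-xq^{m})}$ for $m<0$. *)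

theory Defs
  imports
    Complex_Main
    "HOL-Library.Nat_Bijection"
    "HOL-Computational_Algebra.Polynomial"
    "HOL-Computational_Algebra.Fraction_Field"
begin

section \<open>The fields \<open>\<rat>(q)\<close> and \<open>\<rat>(q)(x)\<close>\<close>

type_synonym ratq = "rat poly fract"
type_synonym ratqx = "rat poly fract poly fract"

definition ratq_of_poly :: "rat poly \<Rightarrow> ratq" where
  "ratq_of_poly p = Fraction_Field.Fract p 1"

definition qvar :: ratq where
  "qvar = ratq_of_poly [:0, 1:]"

text \<open>\<open>has_value f x v\<close>: the rational function \<open>f\<close> is regular at \<open>x\<close> and takes the value \<open>v\<close> there.\<close>

definition has_value :: "'a::field poly fract \<Rightarrow> 'a \<Rightarrow> 'a \<Rightarrow> bool" where
  "has_value f x v \<longleftrightarrow>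
     (\<exists>p r. f = Fraction_Field.Fract p r \<and> poly r x \<noteq> 0 \<and> v = poly p x / poly r x)"

section \<open>Linear \<open>q\<close>-difference equations\<close>

text \<open>
  The list \<open>[a\<^sub>0, \<dots>, a\<^sub>d]\<close> stands for the equation
  \<open>a\<^sub>0(q\<^sup>n) J(n) + \<dots> + a\<^sub>d(q\<^sup>n) J(n+d) = 0\<close>, the variable of \<open>a\<^sub>i\<close> being \<open>q\<^sup>n\<close>.
  It is imposed at every \<open>n\<close> for which no coefficient has a pole at \<open>q\<^sup>n\<close>; this leaves out
  only finitely many \<open>n\<close>.
\<close>

definition satisfies_qdiff :: "ratqx list \<Rightarrow> (nat \<Rightarrow> ratq) \<Rightarrow> bool" where
  "satisfies_qdiff as J \<longleftrightarrow>
     (\<forall>n vs. list_all2 (\<lambda>a v. has_value a (qvar ^ n) v) as vs \<longrightarrow>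
             (\<Sum>i<length vs. vs ! i * J (n + i)) = 0)"

definition nontrivial_qdiff :: "ratqx list \<Rightarrow> bool" where
  "nontrivial_qdiff as \<longleftrightarrow> (\<exists>a\<in>set as. a \<noteq> 0)"

definition q_holonomic :: "(nat \<Rightarrow> ratq) \<Rightarrow> bool" where
  "q_holonomic J \<longleftrightarrow> (\<exists>as. nontrivial_qdiff as \<and> satisfies_qdiff as J)"

section \<open>Proper \<open>q\<close>-hypergeometric terms\<close>

text \<open>
  A rational function of \<open>q\<^sup>n\<close> and \<open>q\<^sup>k\<close> is a quotient of two nonzero polynomials in two
  variables over \<open>\<rat>(q)\<close>. The conditions on the two shift quotients are stated with denominators
  cleared, since a term may vanish, and the rational function may have poles, at some \<open>(n, k)\<close>.
\<close>

definition poly2 :: "'a::comm_ring_1 poly poly \<Rightarrow> 'a \<Rightarrow> 'a \<Rightarrow> 'a" where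
  "poly2 P x y = poly (poly P [:y:]) x"

definition q_hypergeometric :: "(nat \<Rightarrow> nat \<Rightarrow> ratq) \<Rightarrow> bool" where
  "q_hypergeometric F \<longleftrightarrow>
     (\<exists>P R. P \<noteq> 0 \<and> R \<noteq> 0 \<and>
        (\<forall>n k. poly2 R (qvar ^ n) (qvar ^ k) * F (Suc n) k = poly2 P (qvar ^ n) (qvar ^ k) * F n k)) \<and>
     (\<exists>P R. P \<noteq> 0 \<and> R \<noteq> 0 \<and>
        (\<forall>n k. poly2 R (qvar ^ n) (qvar ^ k) * F n (Suc k) = poly2 P (qvar ^ n) (qvar ^ k) * F n k))"

definition qpoch :: "'a::field \<Rightarrow> 'a \<Rightarrow> int \<Rightarrow> 'a" where
  "qpoch x q m =
     (if m \<ge> 0 then (\<Prod>i<nat m. 1 - x * q ^ i)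
      else 1 / (\<Prod>i\<in>{1..nat (- m)}. 1 - x * q powi (- int i)))"

text \<open>
  For \<open>m < 0\<close> the product defining \<open>(q;q)\<^sub>m\<close> contains the factor \<open>1 - q q\<^sup>-\<^sup>1 = 0\<close>. By \<open>1 / 0 = 0\<close>,
  such a factor in the denominator of a term makes the term \<open>0\<close>, which is the usual convention
  \<open>1/(q;q)\<^sub>m = 0\<close>. In the numerator the factor is mathematically undefined; here the term is
  then \<open>0\<close> as well.
\<close>

definition qfac :: "int \<Rightarrow> ratq" where
  "qfac m = qpoch qvar qvar m"

text \<open>
  A triple \<open>(a, b, c)\<close> stands for the linear form \<open>a n + b k + c\<close>; a sextuple of rationals for a
  quadratic function of \<open>n\<close> and \<open>k\<close>. Rational coefficients are admitted, so as to include
  exponents such as \<open>n(n-1)/2\<close>, but the values are required to be integers.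
\<close>

type_synonym linform = "int \<times> int \<times> int"
type_synonym quadform = "rat \<times> rat \<times> rat \<times> rat \<times> rat \<times> rat"

fun lin_eval :: "linform \<Rightarrow> nat \<Rightarrow> nat \<Rightarrow> int" where
  "lin_eval (a, b, c) n k = a * int n + b * int k + c"

fun quad_eval :: "quadform \<Rightarrow> nat \<Rightarrow> nat \<Rightarrow> rat" where
  "quad_eval (a, b, c, d, e, f) n k =
     a * of_nat n ^ 2 + b * of_nat n * of_nat k + c * of_nat k ^ 2
       + d * of_nat n + e * of_nat k + f"

datatype proper_data =
  Proper_Data (numer: "linform list") (denom: "linform list") (qexp: quadform)

definition valid_proper_data :: "proper_data \<Rightarrow> bool" where
  "valid_proper_data T \<longleftrightarrow> (\<forall>n k. quad_eval (qexp T) n k \<in> \<int>)"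

definition proper_term :: "proper_data \<Rightarrow> nat \<Rightarrow> nat \<Rightarrow> ratq" where
  "proper_term T n k =
     (\<Prod>l\<leftarrow>numer T. qfac (lin_eval l n k)) / (\<Prod>l\<leftarrow>denom T. qfac (lin_eval l n k))
       * qvar powi \<lfloor>quad_eval (qexp T) n k\<rfloor>"

definition proper_q_hypergeometric :: "(nat \<Rightarrow> nat \<Rightarrow> ratq) \<Rightarrow> bool" where
  "proper_q_hypergeometric F \<longleftrightarrow>
     q_hypergeometric F \<and>
     (\<exists>T. valid_proper_data T \<and> (\<forall>n k. F n k = proper_term T n k))"

section \<open>Computable functions\<close>

text \<open>
  Kleene's general recursive functions: the closure of the basic functions under composition,
  primitive recursion and minimization of regular functions. In \<open>recursive k f\<close> only the values
  of \<open>f\<close> on lists of length \<open>k\<close> are meaningful.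
\<close>

inductive recursive :: "nat \<Rightarrow> (nat list \<Rightarrow> nat) \<Rightarrow> bool" where
  zero: "recursive k (\<lambda>xs. 0)"
| succ: "recursive 1 (\<lambda>xs. Suc (xs ! 0))"
| proj: "i < k \<Longrightarrow> recursive k (\<lambda>xs. xs ! i)"
| comp: "recursive (length gs) f \<Longrightarrow> \<forall>g\<in>set gs. recursive k g \<Longrightarrow>
         recursive k (\<lambda>xs. f (map (\<lambda>g. g xs) gs))"
| prim: "recursive k f \<Longrightarrow> recursive (k + 2) g \<Longrightarrow>
         recursive (k + 1) (\<lambda>xs. rec_nat (f (tl xs)) (\<lambda>n r. g (n # r # tl xs)) (hd xs))"
| mini: "recursive (k + 1) f \<Longrightarrow> \<forall>xs. length xs = k \<longrightarrow> (\<exists>n. f (n # xs) = 0) \<Longrightarrow>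
         recursive k (\<lambda>xs. LEAST n. f (n # xs) = 0)"

section \<open>Finite presentations and their codes\<close>

text \<open>
  A finitely presented equation lists its coefficients as pairs \<open>(P, R)\<close>, meaning \<open>P / R\<close>, of
  polynomials in \<open>x = q\<^sup>n\<close> over \<open>\<rat>[q]\<close>. Every element of \<open>\<rat>(q)(x)\<close> is of this form.
\<close>

type_synonym qdiff_pres = "(rat poly poly \<times> rat poly poly) list"

fun ratqx_of_pair :: "rat poly poly \<times> rat poly poly \<Rightarrow> ratqx" where
  "ratqx_of_pair (P, R) =
     Fraction_Field.Fract (map_poly ratq_of_poly P) (map_poly ratq_of_poly R)"

definition qdiff_of :: "qdiff_pres \<Rightarrow> ratqx list" where
  "qdiff_of E = map ratqx_of_pair E"

definition valid_pres :: "qdiff_pres \<Rightarrow> bool" where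
  "valid_pres E \<longleftrightarrow> (\<forall>(P, R)\<in>set E. R \<noteq> 0)"

definition code_rat :: "rat \<Rightarrow> nat" where
  "code_rat r = prod_encode (int_encode (fst (quotient_of r)), int_encode (snd (quotient_of r)))"

definition code_poly :: "rat poly \<Rightarrow> nat" where
  "code_poly p = list_encode (map code_rat (coeffs p))"

definition code_poly2 :: "rat poly poly \<Rightarrow> nat" where
  "code_poly2 P = list_encode (map code_poly (coeffs P))"

definition code_qdiff :: "qdiff_pres \<Rightarrow> nat" where
  "code_qdiff E = list_encode (map (\<lambda>(P, R). prod_encode (code_poly2 P, code_poly2 R)) E)"

fun code_lin :: "linform \<Rightarrow> nat" where
  "code_lin (a, b, c) = list_encode [int_encode a, int_encode b, int_encode c]"

fun code_quad :: "quadform \<Rightarrow> nat" where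
  "code_quad (a, b, c, d, e, f) = list_encode (map code_rat [a, b, c, d, e, f])"

definition code_proper :: "proper_data \<Rightarrow> nat" where
  "code_proper T =
     list_encode [list_encode (map code_lin (numer T)), list_encode (map code_lin (denom T)),
                  code_quad (qexp T)]"

end

(*
The term c(n,k) is extended by zero outside 0 <= k <= n, to a function on N x Z. Counting unknowns
and linear conditions over Q yields, for F(n,k) = c(n,k) Jhat(k), an annihilating operator A(q^n, N, K)
with coefficients free of q^k that does not depend on Jhat: the shifts of F are Laurent polynomial
multiples of a common function, except near the lines where a numerator factorial changes between
zero and nonzero, and there is room to treat these lines separately. Since F has finite support in k,
powers of K - 1 can be cancelled on the left of A, and A(q^n, N, 1) then annihilates J.

The same count applied to P F, for an operator P(q^n, N), shows that P J satisfies a recurrence whose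
order and whose degree in q are bounded explicitly; as its leading coefficient cannot vanish at q^n
for n beyond the degree in q, P annihilates J as soon as (P J)(n) = 0 up to an explicit bound. Each of
these finitely many equations says that a linear functional of Jhat vanishes on all solutions of the
given equation, that is, that it is a linear combination of instances of that equation. The algorithm
searches for P together with these linear combinations.
*)

theory Submission
  imports Defs
begin

section \<open>Recursive functions on coded types\<close>

text \<open>Equations are found by enumerating pairs of an operator and a certificate, so no
  elimination has to be carried out on codes; what has to be shown is that a finite check implies
  validity and that some pair passes it. The count therefore serves twice: for the operator P = 1 it
  gives existence, for arbitrary P it makes the check sound. It is a count over the rationals, with
  q a third variable beside q^n and q^k; this bounds the degree in q, and so the n at which a
  leading coefficient can vanish. The obstacle lies in the numerator factorials. The reciprocal
  1/(q;q)_m continues to negative m by a product formula, because the product contains a zero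
  factor; (q;q)_m itself jumps from 0 to 1 at m = 0, and near the line where its argument is small
  the shifts have no common multiple of the generic form. The number of such lines grows with the
  order of the operator. On a line a n + b k = t, however, dividing the exponent of q^k by b with
  remainder brings the degree in q^k below the absolute value of b, so that a line costs few
  conditions, and a large order J in k outweighs them all.\<close>

text \<open>\<open>recursive\<close> speaks about a function on all lists, while only its values on
  lists of length \<open>k\<close> matter. Closing it under agreement on those lists makes
  equational rewriting of computable functions possible.\<close>

definition crec :: "nat \<Rightarrow> (nat list \<Rightarrow> nat) \<Rightarrow> bool" where
  "crec k f \<longleftrightarrow> (\<exists>g. recursive k g \<and> (\<forall>xs. length xs = k \<longrightarrow> g xs = f xs))"

lemma crecI: "recursive k f \<Longrightarrow> crec k f"
  unfolding crec_def by blast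

lemma crec_cong: "crec k f \<Longrightarrow> (\<And>xs. length xs = k \<Longrightarrow> f xs = f' xs) \<Longrightarrow> crec k f'"
  unfolding crec_def by force

lemma crec_comp:
  assumes f: "crec (length gs) f" and gs: "\<And>g. g \<in> set gs \<Longrightarrow> crec k g"
  shows "crec k (\<lambda>xs. f (map (\<lambda>g. g xs) gs))"
proof -
  obtain f' where f': "recursive (length gs) f'" "\<And>xs. length xs = length gs \<Longrightarrow> f' xs = f xs"
    using f unfolding crec_def by blast
  define r where "r g = (SOME h. recursive k h \<and> (\<forall>xs. length xs = k \<longrightarrow> h xs = g xs))" for g
  have r: "recursive k (r g) \<and> (\<forall>xs. length xs = k \<longrightarrow> r g xs = g xs)" if "g \<in> set gs" for g
    using gs[OF that] unfolding r_def crec_def by (rule someI_ex)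
  have "recursive k (\<lambda>xs. f' (map (\<lambda>g. g xs) (map r gs)))"
    by (rule recursive.comp) (use f' r in auto)
  moreover have "f' (map (\<lambda>g. g xs) (map r gs)) = f (map (\<lambda>g. g xs) gs)" if "length xs = k" for xs
  proof -
    have "map (\<lambda>g. g xs) (map r gs) = map (\<lambda>g. g xs) gs"
      using r that by auto
    thus ?thesis using f'(2)[of "map (\<lambda>g. g xs) gs"] by (simp only: length_map)
  qed
  ultimately show ?thesis unfolding crec_def by blast
qed

lemma crec_proj: "i < k \<Longrightarrow> crec k (\<lambda>xs. xs ! i)"
  by (rule crecI, rule recursive.proj)

lemma crec_prim:
  assumes f: "crec k f" and g: "crec (k + 2) g"
  shows "crec (k + 1) (\<lambda>xs. rec_nat (f (tl xs)) (\<lambda>n r. g (n # r # tl xs)) (hd xs))"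
proof -
  obtain f' where f': "recursive k f'" "\<And>xs. length xs = k \<Longrightarrow> f' xs = f xs"
    using f unfolding crec_def by blast
  obtain g' where g': "recursive (k + 2) g'" "\<And>xs. length xs = k + 2 \<Longrightarrow> g' xs = g xs"
    using g unfolding crec_def by blast
  show ?thesis
    by (rule crec_cong[OF crecI[OF recursive.prim[OF f'(1) g'(1)]]]) (auto simp: f'(2) g'(2))
qed

lemma crec_mini:
  assumes f: "crec (k + 1) f" and ex: "\<And>xs. length xs = k \<Longrightarrow> \<exists>n. f (n # xs) = 0"
  shows "crec k (\<lambda>xs. LEAST n. f (n # xs) = 0)"
proof -
  obtain f' where f': "recursive (k + 1) f'" "\<And>xs. length xs = k + 1 \<Longrightarrow> f' xs = f xs"
    using f unfolding crec_def by blast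
  have "recursive k (\<lambda>xs. LEAST n. f' (n # xs) = 0)"
    by (rule recursive.mini[OF f'(1)]) (use ex f'(2) in auto)
  thus ?thesis
    by (rule crec_cong[OF crecI]) (auto simp: f'(2))
qed

definition rec1 :: "(nat \<Rightarrow> nat) \<Rightarrow> bool" where
  "rec1 f \<longleftrightarrow> crec 1 (\<lambda>xs. f (xs ! 0))"

definition rec2 :: "(nat \<Rightarrow> nat \<Rightarrow> nat) \<Rightarrow> bool" where
  "rec2 f \<longleftrightarrow> crec 2 (\<lambda>xs. f (xs ! 0) (xs ! 1))"

lemma crec_rec1: "rec1 f \<Longrightarrow> crec k g \<Longrightarrow> crec k (\<lambda>xs. f (g xs))"
  using crec_comp[of "[g]" "\<lambda>xs. f (xs ! 0)" k] by (simp add: rec1_def)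

lemma crec_rec2:
  assumes "rec2 f" "crec k g" "crec k h"
  shows "crec k (\<lambda>xs. f (g xs) (h xs))"
proof -
  have "crec (length [g, h]) (\<lambda>xs. f (xs ! 0) (xs ! 1))"
    using assms(1) by (simp add: rec2_def numeral_2_eq_2)
  from crec_comp[OF this, of k] show ?thesis using assms(2,3) by auto
qed

lemma rec1_Suc: "rec1 Suc"
  unfolding rec1_def by (rule crecI, rule recursive.succ)

lemma crec_const: "crec k (\<lambda>xs. c)"
proof (induction c)
  case 0 show ?case by (rule crecI, rule recursive.zero)
next
  case (Suc c) show ?case by (rule crec_rec1[OF rec1_Suc Suc])
qed

lemma rec2_prim:
  assumes "rec1 f" and "crec 3 (\<lambda>xs. g (xs ! 0) (xs ! 1) (xs ! 2))"
  shows "rec2 (\<lambda>n a. rec_nat (f a) (\<lambda>m r. g m r a) n)"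
proof -
  have g: "crec (1 + 2) (\<lambda>xs. g (xs ! 0) (xs ! 1) (xs ! 2))"
    using assms(2) by (simp add: numeral_3_eq_3)
  from crec_prim[OF assms(1)[unfolded rec1_def] g]
  have "crec 2 (\<lambda>xs. rec_nat (f (tl xs ! 0)) (\<lambda>n r. g ((n # r # tl xs) ! 0) ((n # r # tl xs) ! 1) ((n # r # tl xs) ! 2)) (hd xs))"
    unfolding one_add_one .
  thus ?thesis unfolding rec2_def
  proof (rule crec_cong)
    fix xs :: "nat list" assume "length xs = 2"
    then obtain a b where "xs = [a, b]" by (auto simp: length_Suc_conv numeral_2_eq_2)
    thus "rec_nat (f (tl xs ! 0)) (\<lambda>n r. g ((n # r # tl xs) ! 0) ((n # r # tl xs) ! 1) ((n # r # tl xs) ! 2)) (hd xs)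
      = rec_nat (f (xs ! 1)) (\<lambda>m r. g m r (xs ! 1)) (xs ! 0)" by simp
  qed
qed

lemma rec1_comp: "rec1 f \<Longrightarrow> rec1 g \<Longrightarrow> rec1 (\<lambda>x. f (g x))"
  unfolding rec1_def[of g] rec1_def[of "\<lambda>x. f (g x)"] by (rule crec_rec1)

lemma rec1_comp2: "rec2 f \<Longrightarrow> rec1 g \<Longrightarrow> rec1 h \<Longrightarrow> rec1 (\<lambda>x. f (g x) (h x))"
  unfolding rec1_def by (rule crec_rec2)

lemma rec1_id: "rec1 (\<lambda>x. x)"
  unfolding rec1_def by (rule crec_proj) simp

lemma rec1_const: "rec1 (\<lambda>x. c)"
  unfolding rec1_def by (rule crec_const)

section \<open>Arithmetic and the Cantor pairing as recursive functions\<close>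

lemma rec2_add: "rec2 (+)"
proof -
  have "rec2 (\<lambda>n a. rec_nat a (\<lambda>m r. Suc r) n)"
    by (rule rec2_prim[OF rec1_id]) (intro crec_rec1[OF rec1_Suc] crec_proj, simp)
  moreover have "rec_nat a (\<lambda>m r. Suc r) n = n + a" for n a by (induction n) auto
  ultimately show ?thesis by simp
qed

lemma rec2_mult: "rec2 (*)"
proof -
  have "rec2 (\<lambda>n a. rec_nat 0 (\<lambda>m r. r + a) n)"
    by (rule rec2_prim[OF rec1_const]) (intro crec_rec2[OF rec2_add] crec_proj; simp)
  moreover have "rec_nat 0 (\<lambda>m r. r + a) n = n * a" for n a :: nat by (induction n) auto
  ultimately show ?thesis by simp
qed

lemma rec1_prim: "rec2 g \<Longrightarrow> rec1 (rec_nat c g)"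
proof -
  assume g: "rec2 g"
  have "rec2 (\<lambda>n a. rec_nat c (\<lambda>m r. g m r) n)"
    by (rule rec2_prim[OF rec1_const]) (intro crec_rec2[OF g] crec_proj; simp)
  from rec1_comp2[OF this rec1_id rec1_const] show ?thesis by simp
qed

lemma rec1_pred: "rec1 (\<lambda>n. n - 1)"
proof -
  have "rec1 (rec_nat 0 (\<lambda>m r. m))"
    by (rule rec1_prim) (simp add: rec2_def crec_proj)
  moreover have "rec_nat 0 (\<lambda>m r. m) n = n - 1" for n by (cases n) auto
  ultimately show ?thesis by (simp add: rec1_def)
qed

lemma rec2_swap: "rec2 f \<Longrightarrow> rec2 (\<lambda>x y. f y x)"
  unfolding rec2_def[of "\<lambda>x y. f y x"] by (erule crec_rec2) (auto intro: crec_proj)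

lemma rec2_diff: "rec2 (-)"
proof -
  have "rec2 (\<lambda>n a. rec_nat a (\<lambda>m r. r - 1) n)"
    by (rule rec2_prim[OF rec1_id]) (intro crec_rec1[OF rec1_pred] crec_proj, simp)
  moreover have "rec_nat a (\<lambda>m r. r - 1) n = a - n" for n a :: nat by (induction n) auto
  ultimately have "rec2 (\<lambda>n a. a - n)" by simp
  thus ?thesis by (rule rec2_swap)
qed

lemma rec1_triangle: "rec1 triangle"
proof -
  have "rec1 (rec_nat 0 (\<lambda>m r. r + Suc m))"
    by (rule rec1_prim) (unfold rec2_def, intro crec_rec2[OF rec2_add] crec_rec1[OF rec1_Suc] crec_proj; simp)
  moreover have "rec_nat 0 (\<lambda>m r. r + Suc m) n = triangle n" for n by (induction n) auto
  ultimately show ?thesis by (simp add: rec1_def)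
qed

lemma crec_prod_encode: "crec k f \<Longrightarrow> crec k g \<Longrightarrow> crec k (\<lambda>x. prod_encode (f x, g x))"
  unfolding prod_encode_def split
  by (intro crec_rec2[OF rec2_add] crec_rec1[OF rec1_triangle])

lemma rec1_prod_encode: "rec1 f \<Longrightarrow> rec1 g \<Longrightarrow> rec1 (\<lambda>x. prod_encode (f x, g x))"
  unfolding prod_encode_def split
  by (intro rec1_comp2[OF rec2_add] rec1_comp[OF rec1_triangle])

lemma triangle_mono: "m \<le> n \<Longrightarrow> triangle m \<le> triangle n"
  by (induction n) (auto simp: le_Suc_eq)

text \<open>The diagonal on which \<open>z\<close> lies: if \<open>z = triangle (m + n) + m\<close>,
  this is \<open>m + n\<close>. With truncated subtraction the test says
  \<open>z < triangle (Suc r)\<close>, so that minimization finds it.\<close>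

definition triangle_root :: "nat \<Rightarrow> nat" where
  "triangle_root z = (LEAST r. Suc z - triangle (Suc r) = 0)"

lemma triangle_root_eq: "triangle_root (triangle (m + n) + m) = m + n"
  unfolding triangle_root_def
proof (rule Least_equality)
  show "m + n \<le> r" if "Suc (triangle (m + n) + m) - triangle (Suc r) = 0" for r
  proof (rule ccontr)
    assume "\<not> m + n \<le> r"
    hence "triangle (Suc r) \<le> triangle (m + n)" by (intro triangle_mono) auto
    with that show False by auto
  qed
qed auto

lemma rec1_triangle_root: "rec1 triangle_root"
proof -
  have "crec 1 (\<lambda>xs. LEAST r. (\<lambda>xs. Suc (xs ! 1) - triangle (Suc (xs ! 0))) (r # xs) = 0)"
  proof (rule crec_mini)
    show "crec (1 + 1) (\<lambda>xs. Suc (xs ! 1) - triangle (Suc (xs ! 0)))"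
      by (intro crec_rec2[OF rec2_diff] crec_rec1[OF rec1_Suc] crec_rec1[OF rec1_triangle] crec_proj) auto
    \<comment> \<open>\<open>triangle (Suc z)\<close> is at least \<open>Suc z\<close>, so
      \<open>r = z\<close> always ends the search.\<close>
    show "\<exists>n. Suc ((n # xs) ! 1) - triangle (Suc ((n # xs) ! 0)) = 0" for xs :: "nat list"
      by (rule exI[of _ "xs ! 0"]) auto
  qed
  thus ?thesis by (simp add: rec1_def triangle_root_def[abs_def])
qed

lemma prod_decode_root:
  "prod_decode z = (z - triangle (triangle_root z), triangle_root z - (z - triangle (triangle_root z)))"
proof -
  obtain m n where "prod_decode z = (m, n)" by force
  hence z: "z = triangle (m + n) + m"
    using prod_decode_inverse[of z] by (simp add: prod_encode_def)
  show ?thesis unfolding \<open>prod_decode z = (m, n)\<close> using triangle_root_eq[of m n] z by simp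
qed

lemma rec1_fst_decode: "rec1 (\<lambda>z. fst (prod_decode z))"
  unfolding prod_decode_root fst_conv
  by (intro rec1_comp2[OF rec2_diff] rec1_comp[OF rec1_triangle] rec1_triangle_root rec1_id)

lemma rec1_snd_decode: "rec1 (\<lambda>z. snd (prod_decode z))"
  unfolding prod_decode_root snd_conv
  by (intro rec1_comp2[OF rec2_diff] rec1_comp[OF rec1_triangle] rec1_triangle_root rec1_id)

text \<open>A bijection rather than an injection: every natural number is a code, so decoding is
  total and no function on codes has to recognize invalid input.\<close>

class coded =
  fixes enc :: "'a \<Rightarrow> nat" and dec :: "nat \<Rightarrow> 'a"
  assumes dec_enc [simp]: "dec (enc x) = x" and enc_dec [simp]: "enc (dec n) = n"

lemma enc_eq_iff: "enc x = enc y \<longleftrightarrow> x = (y :: 'a :: coded)"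
  by (metis dec_enc)

instantiation nat :: coded begin
definition enc_nat :: "nat \<Rightarrow> nat" where [simp]: "enc_nat n = n"
definition dec_nat :: "nat \<Rightarrow> nat" where [simp]: "dec_nat n = n"
instance by standard auto
end

instantiation int :: coded begin
definition enc_int :: "int \<Rightarrow> nat" where "enc_int = int_encode"
definition dec_int :: "nat \<Rightarrow> int" where "dec_int = int_decode"
instance by standard (auto simp: enc_int_def dec_int_def)
end

instantiation prod :: (coded, coded) coded begin
definition enc_prod :: "'a \<times> 'b \<Rightarrow> nat" where "enc_prod p = prod_encode (enc (fst p), enc (snd p))"
definition dec_prod :: "nat \<Rightarrow> 'a \<times> 'b" where "dec_prod n = (dec (fst (prod_decode n)), dec (snd (prod_decode n)))"
instance by standard (auto simp: enc_prod_def dec_prod_def)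
end

instantiation list :: (coded) coded begin
definition enc_list :: "'a list \<Rightarrow> nat" where "enc_list xs = list_encode (map enc xs)"
definition dec_list :: "nat \<Rightarrow> 'a list" where "dec_list n = map dec (list_decode n)"
instance by standard (auto simp: enc_list_def dec_list_def o_def)
end

lemma enc_Pair [simp]: "enc (x, y) = prod_encode (enc x, enc y)"
  by (simp add: enc_prod_def)
lemma enc_Nil [simp]: "enc [] = 0"
  by (simp add: enc_list_def)
lemma enc_Cons [simp]: "enc (x # xs) = Suc (prod_encode (enc x, enc xs))"
  by (simp add: enc_list_def)

text \<open>Computability transported along the codes. Its closure rules are collected in
  \<open>cmp_intros\<close>, which makes computability proofs follow the syntax of the
  function.\<close>

definition cmp :: "('a::coded \<Rightarrow> 'b::coded) \<Rightarrow> bool" where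
  "cmp f \<longleftrightarrow> rec1 (\<lambda>n. enc (f (dec n)))"

named_theorems cmp_intros

lemma cmp_id [cmp_intros]: "cmp (\<lambda>x. x)"
  by (simp add: cmp_def rec1_id)

lemma cmp_const [cmp_intros]: "cmp (\<lambda>x. c)"
  by (simp add: cmp_def rec1_const)

lemma cmp_comp: "cmp g \<Longrightarrow> cmp f \<Longrightarrow> cmp (\<lambda>x. g (f x))"
  unfolding cmp_def using rec1_comp[of "\<lambda>n. enc (g (dec n))" "\<lambda>n. enc (f (dec n))"] by simp

lemma cmp_Pair [cmp_intros]: "cmp f \<Longrightarrow> cmp g \<Longrightarrow> cmp (\<lambda>x. (f x, g x))"
  unfolding cmp_def enc_Pair by (rule rec1_prod_encode)

lemma cmp_fst [cmp_intros]: "cmp f \<Longrightarrow> cmp (\<lambda>x. fst (f x))"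
  by (rule cmp_comp) (simp_all add: cmp_def dec_prod_def rec1_fst_decode)

lemma cmp_snd [cmp_intros]: "cmp f \<Longrightarrow> cmp (\<lambda>x. snd (f x))"
  by (rule cmp_comp) (simp_all add: cmp_def dec_prod_def rec1_snd_decode)

lemma cmp_enc [cmp_intros]: "cmp f \<Longrightarrow> cmp (\<lambda>x. enc (f x))"
  by (simp add: cmp_def)

lemma cmp_dec [cmp_intros]: "cmp f \<Longrightarrow> cmp (\<lambda>x. dec (f x))"
  by (simp add: cmp_def)

lemma cmp_rec2: "rec2 g \<Longrightarrow> cmp f \<Longrightarrow> cmp h \<Longrightarrow> cmp (\<lambda>x. g (f x) (h x) :: nat)"
  unfolding cmp_def enc_nat_def by (rule rec1_comp2)

lemmas cmp_add_nat [cmp_intros] = cmp_rec2[OF rec2_add]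
lemmas cmp_mult_nat [cmp_intros] = cmp_rec2[OF rec2_mult]
lemmas cmp_diff_nat [cmp_intros] = cmp_rec2[OF rec2_diff]

lemma cmp_Suc [cmp_intros]: "cmp f \<Longrightarrow> cmp (\<lambda>x. Suc (f x))"
  using cmp_add_nat[of "\<lambda>_. 1" f] by (simp add: cmp_const)

text \<open>The recursion is run on codes with \<open>x\<close> as a parameter. As
  \<open>cmp\<close> is unary, computability of \<open>g\<close> jointly in all arguments is
  expressed on nested pairs, here and in the rules for lists.\<close>

lemma cmp_rec_nat [cmp_intros]:
  assumes f: "cmp f" and g: "cmp (\<lambda>p. g (fst p) (fst (snd p)) (snd (snd p)))" and n: "cmp n"
  shows "cmp (\<lambda>x. rec_nat (f x) (\<lambda>m r. g x m r) (n x))"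
proof -
  have 1: "rec1 (\<lambda>a. enc (f (dec a)))" using f by (simp add: cmp_def)
  have "rec1 (\<lambda>z. enc (g (dec (fst (prod_decode z))) (fst (prod_decode (snd (prod_decode z))))
         (dec (snd (prod_decode (snd (prod_decode z)))))))"
    using g by (simp add: cmp_def dec_prod_def)
  from crec_rec1[OF this, of 3 "\<lambda>xs. prod_encode (xs ! 2, prod_encode (xs ! 0, xs ! 1))"]
  have 2: "crec 3 (\<lambda>xs. enc (g (dec (xs ! 2)) (xs ! 0) (dec (xs ! 1))))"
    by (simp add: crec_prod_encode crec_proj)
  have 3: "rec2 (\<lambda>n a. rec_nat (enc (f (dec a))) (\<lambda>m r. enc (g (dec a) m (dec r))) n)"
    by (rule rec2_prim[OF 1]) (rule 2)
  have 4: "rec_nat (enc (f x)) (\<lambda>m r. enc (g x m (dec r))) k = enc (rec_nat (f x) (g x) k)" for x k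
    by (induction k) auto
  show ?thesis
    using rec1_comp2[OF 3, of "\<lambda>a. enc (n (dec a))" "\<lambda>a. a"] n
    by (simp add: cmp_def rec1_id 4)
qed

text \<open>Unbounded search. Minimization demands a zero for every \<open>x\<close>, including
  inputs that code nothing meaningful.\<close>

lemma cmp_Least:
  fixes f :: "'a::coded \<Rightarrow> nat \<Rightarrow> nat"
  assumes f: "cmp (\<lambda>p. f (fst p) (snd p))" and ex: "\<And>x. \<exists>n. f x n = 0"
  shows "cmp (\<lambda>x. LEAST n. f x n = (0::nat))"
proof -
  have 1: "rec1 (\<lambda>z. f (dec (fst (prod_decode z))) (snd (prod_decode z)))"
    using f by (simp add: cmp_def dec_prod_def)
  have "crec 1 (\<lambda>xs. LEAST n. (\<lambda>xs. f (dec (xs ! 1)) (xs ! 0)) (n # xs) = 0)"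
  proof (rule crec_mini)
    have "crec (1 + 1) (\<lambda>xs. prod_encode (xs ! 1, xs ! 0))"
      by (intro crec_prod_encode crec_proj) auto
    from crec_rec1[OF 1 this] show "crec (1 + 1) (\<lambda>xs. f (dec (xs ! 1)) (xs ! 0))" by simp
  qed (use ex in auto)
  thus ?thesis by (simp add: cmp_def rec1_def)
qed

lemma cmp_recursive2:
  assumes "cmp (f :: nat \<times> nat \<Rightarrow> nat)"
  shows "\<exists>A. recursive 2 A \<and> (\<forall>x y. A [x, y] = f (x, y))"
proof -
  have "rec1 (\<lambda>z. f (fst (prod_decode z), snd (prod_decode z)))"
    using assms by (simp add: cmp_def dec_prod_def)
  from crec_rec1[OF this, of 2 "\<lambda>xs. prod_encode (xs ! 0, xs ! 1)"]
  have "crec 2 (\<lambda>xs. f (xs ! 0, xs ! 1))"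
    by (simp add: crec_prod_encode crec_proj)
  then obtain g where "recursive 2 g" "\<forall>xs. length xs = 2 \<longrightarrow> g xs = f (xs ! 0, xs ! 1)"
    unfolding crec_def by blast
  thus ?thesis by (intro exI[of _ g]) auto
qed

section \<open>Computable operations on lists and integers\<close>

definition cmpP :: "('a::coded \<Rightarrow> bool) \<Rightarrow> bool" where
  "cmpP P \<longleftrightarrow> cmp (\<lambda>x. if P x then 1 else 0 :: nat)"

lemma cmp_comp_fst: "cmp f \<Longrightarrow> cmp (\<lambda>p. f (fst p))"
  by (rule cmp_comp[OF _ cmp_fst[OF cmp_id]])

lemma cmp_if [cmp_intros]:
  assumes "cmpP P" "cmp f" "cmp g"
  shows "cmp (\<lambda>x. if P x then f x else g x)"
proof -
  have "cmp (\<lambda>x. rec_nat (g x) (\<lambda>_ _. f x) (if P x then 1 else 0))"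
    by (intro cmp_rec_nat cmp_comp_fst) (use assms in \<open>simp_all add: cmpP_def\<close>)
  moreover have "rec_nat (g x) (\<lambda>_ _. f x) (if P x then 1 else 0) = (if P x then f x else g x)" for x
    by simp
  ultimately show ?thesis by simp
qed

lemma cmpP_zero: "cmp f \<Longrightarrow> cmpP (\<lambda>x. f x = (0::nat))"
proof -
  assume f: "cmp f"
  have "cmp (\<lambda>x. rec_nat (1::nat) (\<lambda>_ _. 0) (f x))"
    by (intro cmp_rec_nat cmp_const f)
  moreover have "rec_nat (1::nat) (\<lambda>_ _. 0) m = (if m = 0 then 1 else 0)" for m by (cases m) auto
  ultimately show ?thesis by (simp add: cmpP_def)
qed

lemma cmpP_le [cmp_intros]: "cmp f \<Longrightarrow> cmp g \<Longrightarrow> cmpP (\<lambda>x. f x \<le> (g x :: nat))"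
  using cmpP_zero[OF cmp_diff_nat[of f g]] by simp

lemma cmpP_less [cmp_intros]: "cmp f \<Longrightarrow> cmp g \<Longrightarrow> cmpP (\<lambda>x. f x < (g x :: nat))"
  using cmpP_le[of "\<lambda>x. Suc (f x)" g] by (simp add: cmp_Suc Suc_le_eq)

lemma cmpP_eq [cmp_intros]:
  fixes f :: "'a::coded \<Rightarrow> 'b::coded"
  assumes "cmp f" "cmp g" shows "cmpP (\<lambda>x. f x = g x)"
proof -
  have "cmpP (\<lambda>x. (enc (f x) - enc (g x)) + (enc (g x) - enc (f x)) = 0)"
    by (intro cmpP_zero cmp_intros assms)
  moreover have "(enc a - enc b) + (enc b - enc a) = 0 \<longleftrightarrow> a = b" for a b :: 'b
    unfolding enc_eq_iff[of a b, symmetric] by arith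
  ultimately show ?thesis by simp
qed

lemma cmpP_not [cmp_intros]:
  assumes "cmpP P" shows "cmpP (\<lambda>x. \<not> P x)"
proof -
  have "cmp (\<lambda>x. if P x then 0 else (1::nat))"
    by (intro cmp_if cmp_const assms)
  moreover have "(if P x then 0 else (1::nat)) = (if \<not> P x then 1 else 0)" for x
    by simp
  ultimately show ?thesis unfolding cmpP_def by (simp only:)
qed

lemma cmpP_conj [cmp_intros]:
  assumes "cmpP P" "cmpP Q" shows "cmpP (\<lambda>x. P x \<and> Q x)"
proof -
  have "cmp (\<lambda>x. if P x then if Q x then 1 else 0 else (0::nat))"
    by (intro cmp_if cmp_const assms)
  moreover have "(if P x then if Q x then 1 else 0 else (0::nat)) = (if P x \<and> Q x then 1 else 0)" for x
    by simp
  ultimately show ?thesis unfolding cmpP_def by (simp only:)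
qed

lemma cmpP_disj [cmp_intros]: "cmpP P \<Longrightarrow> cmpP Q \<Longrightarrow> cmpP (\<lambda>x. P x \<or> Q x)"
  using cmpP_not[OF cmpP_conj[OF cmpP_not[of P] cmpP_not[of Q]]] by simp

lemma cmpP_cmp: "cmp (\<lambda>x. if P x then 1 else 0 :: nat) \<Longrightarrow> cmpP P"
  by (simp add: cmpP_def)

lemma cmp_Cons [cmp_intros]: "cmp f \<Longrightarrow> cmp g \<Longrightarrow> cmp (\<lambda>x. f x # g x)"
proof -
  assume "cmp f" "cmp g"
  hence "cmp (\<lambda>x. Suc (enc (f x, g x)))" by (intro cmp_intros)
  thus ?thesis by (simp add: cmp_def)
qed

text \<open>The empty list has code 0, and the predecessor of any other code is the code of the pair
  of head and tail.\<close>

lemma cmp_case_list [cmp_intros]: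
  fixes l :: "'a::coded \<Rightarrow> 'b::coded list"
  assumes "cmp a" "cmp (\<lambda>p. g (fst p) (fst (snd p)) (snd (snd p)))" "cmp l"
  shows "cmp (\<lambda>x. case l x of [] \<Rightarrow> a x | h # t \<Rightarrow> g x h t)"
proof -
  define p where "p x = (dec (enc (l x) - 1) :: 'b \<times> 'b list)" for x
  have p: "cmp p" unfolding p_def by (intro cmp_intros assms)
  have "cmp (\<lambda>x. if enc (l x) = 0 then a x else g x (fst (p x)) (snd (p x)))"
    by (intro cmp_intros assms cmp_comp[OF assms(2), of "\<lambda>x. (x, p x)", simplified] p)
  moreover have "(if enc (l x) = 0 then a x else g x (fst (p x)) (snd (p x)))
     = (case l x of [] \<Rightarrow> a x | h # t \<Rightarrow> g x h t)" for x
    by (cases "l x") (auto simp: p_def dec_prod_def)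
  ultimately show ?thesis by simp
qed

lemma length_le_enc: "length l \<le> enc l"
  by (induction l) (auto intro: order_trans[OF _ le_prod_encode_2])

text \<open>A fold becomes an iteration on pairs of remaining list and accumulator. The number of
  rounds must be computed beforehand: the code of the list bounds its length, and the surplus rounds
  change nothing once the list is empty.\<close>

lemma cmp_fold [cmp_intros]:
  assumes g: "cmp (\<lambda>p. g (fst p) (fst (snd p)) (snd (snd p)))" and l: "cmp l" and a: "cmp a"
  shows "cmp (\<lambda>x. fold (\<lambda>h r. g x h r) (l x) (a x))"
proof -
  define st where "st x s = (case fst s of [] \<Rightarrow> s | h # t \<Rightarrow> (t, g x h (snd s)))" for x s
  have "cmp (\<lambda>p. st (fst p) (snd (snd p)))"
    unfolding st_def
    by (rule cmp_case_list; (intro cmp_intros cmp_comp[OF g, of "\<lambda>p. (fst (fst p), fst (snd p), snd (snd (snd (fst p))))", simplified])?)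
  hence "cmp (\<lambda>x. snd (rec_nat (l x, a x) (\<lambda>_ s. st x s) (enc (l x))))"
    by (intro cmp_snd cmp_rec_nat cmp_intros l a)
  moreover have "rec_nat (l, a) (\<lambda>_ s. st x s) (length l + n) = ([], fold (g x) l a)" for x l a n
  proof -
    have 1: "(st x ^^ length l) (l, a) = ([], fold (g x) l a)" for l a
      by (induction l arbitrary: a) (simp_all add: st_def funpow_swap1)
    have 2: "(st x ^^ n) ([], r) = ([], r)" for r by (induction n) (simp_all add: st_def)
    have 3: "rec_nat s (\<lambda>_ s. st x s) k = (st x ^^ k) s" for s k by (induction k) auto
    show ?thesis unfolding 3 by (subst add.commute, simp add: funpow_add 1 2)
  qed
  from this[of _ _ _ "enc _ - length _"] length_le_enc
  have "snd (rec_nat (l, a) (\<lambda>_ s. st x s) (enc l)) = fold (g x) l a" for x l a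
    by (metis le_add_diff_inverse snd_conv)
  ultimately show ?thesis by simp
qed

lemma cmp_rev [cmp_intros]: "cmp l \<Longrightarrow> cmp (\<lambda>x. rev (l x))"
  unfolding rev_conv_fold by (intro cmp_intros)

lemma cmp_foldr [cmp_intros]:
  assumes "cmp (\<lambda>p. g (fst p) (fst (snd p)) (snd (snd p)))" "cmp l" "cmp a"
  shows "cmp (\<lambda>x. foldr (\<lambda>h r. g x h r) (l x) (a x))"
  unfolding foldr_conv_fold using cmp_fold[OF assms(1) cmp_rev[OF assms(2)] assms(3)] by simp

lemma cmp_map [cmp_intros]:
  assumes "cmp (\<lambda>p. f (fst p) (snd p))" "cmp l"
  shows "cmp (\<lambda>x. map (\<lambda>h. f x h) (l x))"
proof -
  have "cmp (\<lambda>x. foldr (\<lambda>h r. f x h # r) (l x) [])"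
    by (intro cmp_intros assms cmp_comp[OF assms(1), of "\<lambda>p. (fst p, fst (snd p))", simplified])
  moreover have "foldr (\<lambda>h r. f x h # r) l [] = map (f x) l" for x l by (induction l) auto
  ultimately show ?thesis by simp
qed

lemma cmp_append [cmp_intros]: "cmp f \<Longrightarrow> cmp g \<Longrightarrow> cmp (\<lambda>x. f x @ g x)"
proof -
  assume "cmp f" "cmp g"
  hence "cmp (\<lambda>x. foldr (\<lambda>h r. h # r) (f x) (g x))" by (intro cmp_intros)
  moreover have "foldr (\<lambda>h r. h # r) l m = l @ m" for l m :: "'b list" by (induction l) auto
  ultimately show ?thesis by simp
qed

lemma cmp_length [cmp_intros]: "cmp l \<Longrightarrow> cmp (\<lambda>x. length (l x))"
proof -
  assume "cmp l"
  hence "cmp (\<lambda>x. foldr (\<lambda>h r. Suc r) (l x) 0)" by (intro cmp_intros)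
  moreover have "foldr (\<lambda>h r. Suc r) l 0 = length l" for l :: "'b list" by (induction l) auto
  ultimately show ?thesis by simp
qed

lemma cmp_upt [cmp_intros]: "cmp n \<Longrightarrow> cmp (\<lambda>x. [0..<n x])"
proof -
  assume "cmp n"
  hence "cmp (\<lambda>x. rec_nat [] (\<lambda>m r. r @ [m]) (n x))" by (intro cmp_intros)
  moreover have "rec_nat [] (\<lambda>m r. r @ [m]) k = [0..<k]" for k by (induction k) auto
  ultimately show ?thesis by simp
qed

lemma cmp_replicate [cmp_intros]: "cmp n \<Longrightarrow> cmp a \<Longrightarrow> cmp (\<lambda>x. replicate (n x) (a x))"
proof -
  assume "cmp n" "cmp a"
  hence "cmp (\<lambda>x. map (\<lambda>i. a x) [0..<n x])" by (intro cmp_intros cmp_comp_fst)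
  thus ?thesis by (simp add: map_replicate_const)
qed

lemma cmp_nth_default [cmp_intros]:
  "cmp d \<Longrightarrow> cmp l \<Longrightarrow> cmp i \<Longrightarrow> cmp (\<lambda>x. nth_default (d x) (l x) (i x))"
proof -
  assume a: "cmp d" "cmp l" "cmp i"
  hence "cmp (\<lambda>x. case rec_nat (l x) (\<lambda>_ r. case r of [] \<Rightarrow> [] | h # t \<Rightarrow> t) (i x) of [] \<Rightarrow> d x | h # t \<Rightarrow> h)"
    by (intro cmp_intros)
  moreover have "rec_nat l (\<lambda>_ r. case r of [] \<Rightarrow> [] | h # t \<Rightarrow> t) k = drop k l" for k and l :: "'b list"
    by (induction k) (simp_all add: drop_Suc tl_def[symmetric] tl_drop)
  moreover have "(case drop k l of [] \<Rightarrow> e | h # t \<Rightarrow> h) = nth_default e l k" for k e and l :: "'b list"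
    by (induction l arbitrary: k) (auto simp: nth_default_def drop_Cons' nth_Cons' split: list.splits)
  ultimately show ?thesis by simp
qed

lemma cmpP_list_all [cmp_intros]:
  assumes "cmpP (\<lambda>p. P (fst p) (snd p))" "cmp l"
  shows "cmpP (\<lambda>x. list_all (\<lambda>h. P x h) (l x))"
proof (rule cmpP_cmp)
  have "cmpP (\<lambda>p. P (fst p) (fst (snd p)))"
    using cmp_comp[OF assms(1)[unfolded cmpP_def], of "\<lambda>p. (fst p, fst (snd p))"]
    by (simp add: cmpP_def cmp_intros)
  hence "cmp (\<lambda>x. foldr (\<lambda>h r. if P x h then r else 0) (l x) (1::nat))"
    by (intro cmp_intros assms)
  moreover have "foldr (\<lambda>h r. if P x h then r else 0) l (1::nat) = (if list_all (P x) l then 1 else 0)" for x l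
    by (induction l) auto
  ultimately show "cmp (\<lambda>x. if list_all (P x) (l x) then 1 else 0 :: nat)" by simp
qed

lemma cmp_divmod:
  assumes "cmp m" "cmp n"
  shows "cmp (\<lambda>x. (m x div n x, m x mod n x :: nat))"
proof -
  \<comment> \<open>For \<open>n x = 0\<close> the test never succeeds and the state ends at
    \<open>(0, m x)\<close>, in agreement with division by 0.\<close>
  have "cmp (\<lambda>x. rec_nat (0, 0) (\<lambda>_ s. if Suc (snd s) = n x then (Suc (fst s), 0) else (fst s, Suc (snd s))) (m x))"
    by (intro cmp_intros assms cmp_comp_fst)
  moreover have "rec_nat (0, 0) (\<lambda>_ s. if Suc (snd s) = n then (Suc (fst s), 0) else (fst s, Suc (snd s))) m
     = (m div n, m mod n)" for m n :: nat
    by (induction m) (auto simp: div_Suc mod_Suc)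
  ultimately show ?thesis by simp
qed

lemma cmp_div [cmp_intros]: "cmp m \<Longrightarrow> cmp n \<Longrightarrow> cmp (\<lambda>x. m x div n x :: nat)"
  using cmp_fst[OF cmp_divmod] by simp

lemma cmp_mod [cmp_intros]: "cmp m \<Longrightarrow> cmp n \<Longrightarrow> cmp (\<lambda>x. m x mod n x :: nat)"
  using cmp_snd[OF cmp_divmod] by simp

section \<open>Integer arithmetic on codes\<close>

lemma enc_int_eq: "enc (i::int) = (if 0 \<le> i then 2 * nat i else Suc (2 * nat (- i - 1)))"
  by (simp add: enc_int_def int_encode_def sum_encode_def)

lemma cmp_nat [cmp_intros]: "cmp f \<Longrightarrow> cmp (\<lambda>x. nat (f x))"
proof -
  assume "cmp f"
  hence "cmp (\<lambda>x. if enc (f x) mod 2 = 0 then enc (f x) div 2 else 0)" by (intro cmp_intros)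
  moreover have "(if enc i mod 2 = 0 then enc i div 2 else 0) = nat i" for i :: int
    by (auto simp: enc_int_eq)
  ultimately show ?thesis by simp
qed

lemma cmp_nat_neg: "cmp f \<Longrightarrow> cmp (\<lambda>x. nat (- f x))"
proof -
  assume "cmp f"
  hence "cmp (\<lambda>x. if enc (f x) mod 2 = 0 then 0 else Suc (enc (f x) div 2))" by (intro cmp_intros)
  moreover have "(if enc i mod 2 = 0 then 0 else Suc (enc i div 2)) = nat (- i)" for i :: int
    by (auto simp: enc_int_eq Suc_nat_eq_nat_zadd1)
  ultimately show ?thesis by simp
qed

lemma cmp_int_diff: "cmp m \<Longrightarrow> cmp n \<Longrightarrow> cmp (\<lambda>x. int (m x) - int (n x))"
proof -
  assume "cmp m" "cmp n"
  hence "cmp (\<lambda>x. if n x \<le> m x then 2 * (m x - n x) else Suc (2 * (n x - m x - 1)))" by (intro cmp_intros)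
  moreover have "(if n \<le> m then 2 * (m - n) else Suc (2 * (n - m - 1))) = enc (int m - int n)" for m n
    by (auto simp: enc_int_eq nat_diff_distrib)
  ultimately show ?thesis by (simp add: cmp_def)
qed

lemma cmp_int [cmp_intros]: "cmp m \<Longrightarrow> cmp (\<lambda>x. int (m x))"
  using cmp_int_diff[of m "\<lambda>_. 0"] by (simp add: cmp_const)

lemma int_nat_parts: "int (nat i) - int (nat (- i)) = i"
  by simp

lemma cmp_diff_int [cmp_intros]:
  assumes "cmp f" "cmp g" shows "cmp (\<lambda>x. f x - g x :: int)"
proof -
  have "cmp (\<lambda>x. int (nat (f x) + nat (- g x)) - int (nat (- f x) + nat (g x)))"
    using assms by (intro cmp_int_diff cmp_nat cmp_nat_neg cmp_add_nat)
  moreover have "int (nat i + nat (- j)) - int (nat (- i) + nat j) = i - j" for i j by simp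
  ultimately show ?thesis by simp
qed

lemma cmp_uminus_int [cmp_intros]: "cmp f \<Longrightarrow> cmp (\<lambda>x. - f x :: int)"
  using cmp_diff_int[of "\<lambda>_. 0" f] by (simp add: cmp_const)

lemma cmp_add_int [cmp_intros]: "cmp f \<Longrightarrow> cmp g \<Longrightarrow> cmp (\<lambda>x. f x + g x :: int)"
  using cmp_diff_int[of f "\<lambda>x. - g x"] by (simp add: cmp_uminus_int)

lemma cmp_mult_int [cmp_intros]:
  assumes "cmp f" "cmp g" shows "cmp (\<lambda>x. f x * g x :: int)"
proof -
  have "cmp (\<lambda>x. int (nat (f x) * nat (g x) + nat (- f x) * nat (- g x))
      - int (nat (f x) * nat (- g x) + nat (- f x) * nat (g x)))"
    using assms by (intro cmp_int_diff cmp_nat cmp_nat_neg cmp_add_nat cmp_mult_nat)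
  moreover have "int (nat i * nat j + nat (- i) * nat (- j)) - int (nat i * nat (- j) + nat (- i) * nat j) = i * j" for i j
  proof -
    have "int (nat i * nat j + nat (- i) * nat (- j)) - int (nat i * nat (- j) + nat (- i) * nat j)
      = (int (nat i) - int (nat (- i))) * (int (nat j) - int (nat (- j)))"
      by (simp only: of_nat_add of_nat_mult algebra_simps)
    thus ?thesis by (simp only: int_nat_parts)
  qed
  ultimately show ?thesis by (simp only:)
qed

lemma cmpP_le_int [cmp_intros]: "cmp f \<Longrightarrow> cmp g \<Longrightarrow> cmpP (\<lambda>x. f x \<le> (g x :: int))"
  using cmpP_zero[of "\<lambda>x. nat (f x - g x)"] by (simp add: cmp_intros)

lemma cmpP_less_int [cmp_intros]: "cmp f \<Longrightarrow> cmp g \<Longrightarrow> cmpP (\<lambda>x. f x < (g x :: int))"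
  using cmpP_not[OF cmpP_le_int[of g f]] by (simp add: not_le)

section \<open>The field generated by \<open>q\<close>\<close>

lemma ratq_of_poly_0 [simp]: "ratq_of_poly 0 = 0"
  by (simp add: ratq_of_poly_def Zero_fract_def)
lemma ratq_of_poly_1 [simp]: "ratq_of_poly 1 = 1"
  by (simp add: ratq_of_poly_def One_fract_def)
lemma ratq_of_poly_add: "ratq_of_poly (a + b) = ratq_of_poly a + ratq_of_poly b"
  by (simp add: ratq_of_poly_def)
lemma ratq_of_poly_mult: "ratq_of_poly (a * b) = ratq_of_poly a * ratq_of_poly b"
  by (simp add: ratq_of_poly_def)
lemma ratq_of_poly_minus: "ratq_of_poly (- a) = - ratq_of_poly a"
  by (simp add: ratq_of_poly_def)
lemma ratq_of_poly_power: "ratq_of_poly (a ^ n) = ratq_of_poly a ^ n"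
  by (induction n) (simp_all add: ratq_of_poly_mult)
lemma ratq_of_poly_sum: "ratq_of_poly (sum f A) = (\<Sum>x\<in>A. ratq_of_poly (f x))"
  by (induction A rule: infinite_finite_induct) (simp_all add: ratq_of_poly_add)
lemma ratq_of_poly_eq_0_iff [simp]: "ratq_of_poly a = 0 \<longleftrightarrow> a = 0"
  by (simp add: ratq_of_poly_def Zero_fract_def eq_fract)

lemma ratq_of_poly_of_nat: "ratq_of_poly (of_nat n) = of_nat n"
  by (induction n) (simp_all add: ratq_of_poly_add)
lemma ratq_of_poly_of_int: "ratq_of_poly (of_int n) = of_int n"
  by (cases n rule: int_cases2) (simp_all add: ratq_of_poly_of_nat ratq_of_poly_minus)

lemma ratq_of_poly_const: "ratq_of_poly [:r:] = of_rat r"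
proof -
  obtain a b where ab: "quotient_of r = (a, b)" by force
  hence b: "b > 0" and r: "r = of_int a / of_int b"
    using quotient_of_denom_pos quotient_of_div by auto
  have "[:r:] * [:of_int b:] = ([:of_int a:] :: rat poly)" using b r by simp
  hence "ratq_of_poly [:r:] * ratq_of_poly (of_int b) = ratq_of_poly (of_int a)"
    unfolding ratq_of_poly_mult[symmetric] by (simp add: of_int_poly)
  thus ?thesis using b unfolding r by (simp add: ratq_of_poly_of_int of_rat_divide field_simps)
qed

lemma qvar_neq_0 [simp]: "qvar \<noteq> 0"
  by (simp add: qvar_def)

lemma ratq_of_poly_monom: "ratq_of_poly (monom r n) = of_rat r * qvar ^ n"
proof -
  have "monom r n = [:r:] * [:0, 1:] ^ n" by (simp add: monom_altdef)
  thus ?thesis by (simp only: ratq_of_poly_mult ratq_of_poly_power ratq_of_poly_const qvar_def)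
qed

definition qp :: "int \<Rightarrow> ratq" where
  "qp e = qvar powi e"

lemma qp_0 [simp]: "qp 0 = 1" by (simp add: qp_def)
lemma qp_add: "qp (a + b) = qp a * qp b" by (simp add: qp_def power_int_add)
lemma qp_neq_0 [simp]: "qp e \<noteq> 0" by (simp add: qp_def)
lemma qp_nat: "qp (int n) = qvar ^ n" by (simp add: qp_def)

text \<open>Transcendence of q: after multiplication by a power of q that makes all exponents
  nonnegative, the sum is the image of a polynomial, whose coefficients can be compared.\<close>

lemma qp_independent:
  assumes "finite S" and 0: "(\<Sum>e\<in>S. of_rat (r e) * qp e) = 0" and "e \<in> S"
  shows "r e = 0"
proof -
  define N where "N = Max (insert 0 ((\<lambda>e. nat (- e)) ` S))"
  have N: "e + int N \<ge> 0" if "e \<in> S" for e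
  proof -
    have "nat (- e) \<le> N" unfolding N_def using assms(1) that by (intro Max_ge) auto
    thus ?thesis by linarith
  qed
  have "ratq_of_poly (\<Sum>e\<in>S. monom (r e) (nat (e + int N))) = (\<Sum>e\<in>S. of_rat (r e) * qp (e + int N))"
    unfolding ratq_of_poly_sum
    by (intro sum.cong refl) (simp add: ratq_of_poly_monom qp_nat[symmetric] N)
  also have "\<dots> = (\<Sum>e\<in>S. of_rat (r e) * qp e) * qp (int N)"
    by (simp add: qp_add sum_distrib_right mult.assoc)
  finally have "(\<Sum>e\<in>S. monom (r e) (nat (e + int N))) = 0" using 0 by simp
  hence "0 = coeff (\<Sum>e\<in>S. monom (r e) (nat (e + int N))) (nat (e + int N))" by simp
  also have "\<dots> = (\<Sum>e'\<in>S. if e' = e then r e' else 0)"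
    unfolding coeff_sum coeff_monom
  proof (intro sum.cong refl)
    fix x assume "x \<in> S"
    thus "(if nat (x + int N) = nat (e + int N) then r x else 0) = (if x = e then r x else 0)"
      using N[of x] N[OF assms(3)] by (auto simp: nat_eq_iff2)
  qed
  also have "\<dots> = r e" using assms by simp
  finally show ?thesis by simp
qed

section \<open>Computing with fractions of integer polynomials\<close>

definition ip_val :: "int list \<Rightarrow> ratq" where
  "ip_val xs = (\<Sum>i<length xs. of_int (xs ! i) * qvar ^ i)"

lemma ip_val_Nil [simp]: "ip_val [] = 0"
  by (simp add: ip_val_def)

lemma ip_val_Cons [simp]: "ip_val (x # xs) = of_int x + qvar * ip_val xs"
  unfolding ip_val_def length_Cons
  by (subst sum.lessThan_Suc_shift) (simp add: sum_distrib_left mult.assoc mult.left_commute)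

lemma ip_val_map_upt: "ip_val (map f [0..<n]) = (\<Sum>i<n. of_int (f i) * qvar ^ i)"
  by (simp add: ip_val_def)

lemma ip_val_nth_default:
  assumes "length xs \<le> n"
  shows "(\<Sum>i<n. of_int (nth_default 0 xs i) * qvar ^ i) = ip_val xs"
proof -
  have "(\<Sum>i<n. of_int (nth_default 0 xs i) * qvar ^ i) = (\<Sum>i<length xs. of_int (nth_default 0 xs i) * qvar ^ i)"
    by (rule sum.mono_neutral_right) (use assms in \<open>auto simp: nth_default_def\<close>)
  thus ?thesis by (simp add: ip_val_def nth_default_def)
qed

definition ip_add :: "int list \<Rightarrow> int list \<Rightarrow> int list" where
  "ip_add xs ys = map (\<lambda>i. nth_default 0 xs i + nth_default 0 ys i) [0..<length xs + length ys]"

lemma ip_val_add [simp]: "ip_val (ip_add xs ys) = ip_val xs + ip_val ys"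
  unfolding ip_add_def ip_val_map_upt by (simp add: ring_distribs sum.distrib ip_val_nth_default)

lemma cmp_ip_add [cmp_intros]: "cmp f \<Longrightarrow> cmp g \<Longrightarrow> cmp (\<lambda>x. ip_add (f x) (g x))"
  unfolding ip_add_def by (intro cmp_intros cmp_comp_fst)

definition ip_mult :: "int list \<Rightarrow> int list \<Rightarrow> int list" where
  "ip_mult xs ys = foldr (\<lambda>x r. ip_add (map (\<lambda>y. x * y) ys) (0 # r)) xs []"

lemma ip_val_smult: "ip_val (map (\<lambda>y. x * y) ys) = of_int x * ip_val ys"
  by (induction ys) (simp_all add: algebra_simps)

lemma ip_val_mult [simp]: "ip_val (ip_mult xs ys) = ip_val xs * ip_val ys"
  by (induction xs) (simp_all add: ip_mult_def ip_val_smult algebra_simps)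

lemma cmp_ip_mult [cmp_intros]: "cmp f \<Longrightarrow> cmp g \<Longrightarrow> cmp (\<lambda>x. ip_mult (f x) (g x))"
  unfolding ip_mult_def by (intro cmp_intros cmp_comp_fst)

definition ip_zero :: "int list \<Rightarrow> bool" where
  "ip_zero xs = list_all (\<lambda>x. x = 0) xs"

lemma cmpP_ip_zero [cmp_intros]: "cmp f \<Longrightarrow> cmpP (\<lambda>x. ip_zero (f x))"
  unfolding ip_zero_def by (intro cmp_intros)

lemma ratq_of_poly_pCons: "ratq_of_poly (pCons c p) = of_rat c + qvar * ratq_of_poly p"
proof -
  have "pCons c p = [:c:] + [:0, 1:] * p" by simp
  thus ?thesis by (simp only: ratq_of_poly_add ratq_of_poly_mult ratq_of_poly_const qvar_def)
qed

lemma ip_val_poly: "ip_val xs = ratq_of_poly (Poly (map of_int xs))"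
  by (induction xs) (simp_all add: ratq_of_poly_pCons)

text \<open>Equality in the field generated by q becomes decidable here, since polynomials embed
  injectively.\<close>

lemma ip_val_eq_0_iff: "ip_val xs = 0 \<longleftrightarrow> ip_zero xs"
proof -
  have "Poly (map of_int xs) = (0 :: rat poly) \<longleftrightarrow> ip_zero xs"
    by (induction xs) (auto simp: ip_zero_def)
  thus ?thesis by (simp add: ip_val_poly)
qed

section \<open>A computable copy of the field of rational functions in q\<close>

type_synonym frac = "int list \<times> int list"

definition fval :: "frac \<Rightarrow> ratq" where
  "fval a = ip_val (fst a) / ip_val (snd a)"

text \<open>A pair with vanishing denominator has value 0 by \<open>x / 0 = 0\<close>. The usual
  formula would then destroy the other summand; with the two cases \<open>fval\<close> respects
  addition without side conditions.\<close>

definition f_add :: "frac \<Rightarrow> frac \<Rightarrow> frac" where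
  "f_add a b = (if ip_zero (snd a) then b else if ip_zero (snd b) then a else
     (ip_add (ip_mult (fst a) (snd b)) (ip_mult (fst b) (snd a)), ip_mult (snd a) (snd b)))"
definition f_mult :: "frac \<Rightarrow> frac \<Rightarrow> frac" where
  "f_mult a b = (ip_mult (fst a) (fst b), ip_mult (snd a) (snd b))"
definition f_inv :: "frac \<Rightarrow> frac" where
  "f_inv a = (snd a, fst a)"
definition f_rat :: "int \<Rightarrow> int \<Rightarrow> frac" where
  "f_rat z w = ([z], [w])"
definition f_zero :: "frac \<Rightarrow> bool" where
  "f_zero a \<longleftrightarrow> ip_zero (fst a) \<or> ip_zero (snd a)"
definition f_qp :: "int \<Rightarrow> frac" where
  "f_qp e = (if 0 \<le> e then (replicate (nat e) 0 @ [1], [1]) else ([1], replicate (nat (- e)) 0 @ [1]))"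

lemma fval_add [simp]: "fval (f_add a b) = fval a + fval b"
  by (auto simp: f_add_def fval_def ip_val_eq_0_iff[symmetric] add_frac_eq)
lemma fval_mult [simp]: "fval (f_mult a b) = fval a * fval b"
  by (simp add: f_mult_def fval_def)
lemma fval_inv [simp]: "fval (f_inv a) = inverse (fval a)"
  by (simp add: f_inv_def fval_def)
lemma fval_rat [simp]: "fval (f_rat z w) = of_int z / of_int w"
  by (simp add: f_rat_def fval_def)
lemma fval_zero: "f_zero a \<longleftrightarrow> fval a = 0"
  by (simp add: f_zero_def fval_def ip_val_eq_0_iff)
lemma fval_qp [simp]: "fval (f_qp e) = qp e"
proof -
  have "ip_val (replicate n 0 @ [1]) = qvar ^ n" for n by (induction n) simp_all
  thus ?thesis by (auto simp: f_qp_def fval_def qp_def power_int_def field_simps)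
qed

lemma cmp_f_add [cmp_intros]: "cmp f \<Longrightarrow> cmp g \<Longrightarrow> cmp (\<lambda>x. f_add (f x) (g x))"
  unfolding f_add_def by (intro cmp_intros)
lemma cmp_f_mult [cmp_intros]: "cmp f \<Longrightarrow> cmp g \<Longrightarrow> cmp (\<lambda>x. f_mult (f x) (g x))"
  unfolding f_mult_def by (intro cmp_intros)
lemma cmp_f_inv [cmp_intros]: "cmp f \<Longrightarrow> cmp (\<lambda>x. f_inv (f x))"
  unfolding f_inv_def by (intro cmp_intros)
lemma cmp_f_rat [cmp_intros]: "cmp f \<Longrightarrow> cmp g \<Longrightarrow> cmp (\<lambda>x. f_rat (f x) (g x))"
  unfolding f_rat_def by (intro cmp_intros)
lemma cmpP_f_zero [cmp_intros]: "cmp f \<Longrightarrow> cmpP (\<lambda>x. f_zero (f x))"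
  unfolding f_zero_def by (intro cmp_intros)
lemma cmp_f_qp [cmp_intros]: "cmp f \<Longrightarrow> cmp (\<lambda>x. f_qp (f x))"
  unfolding f_qp_def by (intro cmp_intros)

definition f_sum :: "frac list \<Rightarrow> frac" where "f_sum l = foldr f_add l (f_rat 0 1)"
definition f_prod :: "frac list \<Rightarrow> frac" where "f_prod l = foldr f_mult l (f_rat 1 1)"

lemma fval_sum [simp]: "fval (f_sum l) = sum_list (map fval l)"
  by (induction l) (simp_all add: f_sum_def)
lemma fval_prod [simp]: "fval (f_prod l) = prod_list (map fval l)"
  by (induction l) (simp_all add: f_prod_def)
lemma cmp_f_sum [cmp_intros]: "cmp f \<Longrightarrow> cmp (\<lambda>x. f_sum (f x))"
  unfolding f_sum_def using cmp_foldr[of "\<lambda>x h r. f_add h r" f] by (simp add: cmp_intros)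
lemma cmp_f_prod [cmp_intros]: "cmp f \<Longrightarrow> cmp (\<lambda>x. f_prod (f x))"
  unfolding f_prod_def using cmp_foldr[of "\<lambda>x h r. f_mult h r" f] by (simp add: cmp_intros)

definition f_qfac :: "int \<Rightarrow> frac" where
  "f_qfac m = (if m < 0 then f_rat 0 1 else
     f_prod (map (\<lambda>i. f_add (f_rat 1 1) (f_mult (f_rat (- 1) 1) (f_qp (int i + 1)))) [0..<nat m]))"

lemma qp_1 [simp]: "qp 1 = qvar" by (simp add: qp_def)

lemma qfac_nonneg: "m \<ge> 0 \<Longrightarrow> qfac m = (\<Prod>i<nat m. 1 - qp (int i + 1))"
  unfolding qfac_def qpoch_def by (simp add: qp_add qp_nat mult.commute)

lemma qfac_neg: "m < 0 \<Longrightarrow> qfac m = 0"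
proof -
  assume "m < 0"
  hence "(1::nat) \<in> {1..nat (- m)}" by auto
  moreover have "1 - qvar * qvar powi (- int 1) = 0" by (simp add: power_int_minus)
  ultimately have "(\<Prod>i\<in>{1..nat (- m)}. 1 - qvar * qvar powi (- int i)) = 0"
    by (intro prod_zero bexI[of _ 1]) auto
  moreover have "\<not> 0 \<le> m" using \<open>m < 0\<close> by simp
  ultimately show ?thesis unfolding qfac_def qpoch_def by (simp only: if_False division_ring_divide_zero)
qed

lemma prod_list_upt: "prod_list (map f [0..<n]) = (\<Prod>i<n. f i :: 'a::comm_monoid_mult)"
  by (induction n) (simp_all add: mult.commute)

lemma fval_qfac [simp]: "fval (f_qfac m) = qfac m"
proof (cases "m < 0")
  case False
  have "fval (f_qfac m) = prod_list (map (\<lambda>i. 1 - qp (int i + 1)) [0..<nat m])"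
    using False by (simp add: f_qfac_def o_def)
  thus ?thesis using False by (simp only: prod_list_upt qfac_nonneg not_less)
qed (simp add: f_qfac_def qfac_neg)

lemma cmp_f_qfac [cmp_intros]: "cmp f \<Longrightarrow> cmp (\<lambda>x. f_qfac (f x))"
  unfolding f_qfac_def by (intro cmp_intros cmp_comp_fst)

section \<open>Laurent polynomials in \<open>q\<close>, \<open>q\<^sup>n\<close> and \<open>q\<^sup>k\<close>\<close>

lemma sum_rotate: "(\<Sum>h\<in>A. \<Sum>a\<in>B. \<Sum>i\<in>C. g h a i) = (\<Sum>i\<in>C. \<Sum>h\<in>A. \<Sum>a\<in>B. g h a i)"
proof -
  have "(\<Sum>h\<in>A. \<Sum>a\<in>B. \<Sum>i\<in>C. g h a i) = (\<Sum>h\<in>A. \<Sum>i\<in>C. \<Sum>a\<in>B. g h a i)"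
    by (rule sum.cong[OF refl], rule sum.swap)
  also have "\<dots> = (\<Sum>i\<in>C. \<Sum>h\<in>A. \<Sum>a\<in>B. g h a i)" by (rule sum.swap)
  finally show ?thesis .
qed

text \<open>Gaussian elimination, one equation at a time: a pivot \<open>u0\<close> in equation
  \<open>c\<close> removes one unknown and one equation, so the unknowns stay in the
  majority.\<close>

lemma homogeneous_system_nontrivial:
  fixes m :: "'c \<Rightarrow> 'u \<Rightarrow> 'a::field"
  assumes "finite C" "finite U" "card C < card U"
  shows "\<exists>\<alpha>. (\<exists>u\<in>U. \<alpha> u \<noteq> 0) \<and> (\<forall>c\<in>C. (\<Sum>u\<in>U. m c u * \<alpha> u) = 0)"
  using assms
proof (induction C arbitrary: U m rule: finite_induct)
  case empty
  then obtain u where "u \<in> U" by (metis card.empty ex_in_conv less_irrefl)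
  thus ?case by (intro exI[of _ "\<lambda>_. 1"]) auto
next
  case (insert c C)
  show ?case
  proof (cases "\<forall>u\<in>U. m c u = 0")
    case True
    from insert.IH[of U m] insert.prems insert.hyps
    obtain \<alpha> where "\<exists>u\<in>U. \<alpha> u \<noteq> 0" "\<forall>c\<in>C. (\<Sum>u\<in>U. m c u * \<alpha> u) = 0" by auto
    thus ?thesis using True by (intro exI[of _ \<alpha>]) auto
  next
    case False
    then obtain u0 where u0: "u0 \<in> U" "m c u0 \<noteq> 0" by blast
    define m' where "m' c' u = m c' u - m c' u0 * m c u / m c u0" for c' u
    have "card C < card (U - {u0})" using insert.prems insert.hyps u0 by simp
    from insert.IH[OF _ this, of m'] insert.prems
    obtain \<alpha> where \<alpha>: "\<exists>u\<in>U - {u0}. \<alpha> u \<noteq> 0" "\<forall>c\<in>C. (\<Sum>u\<in>U - {u0}. m' c u * \<alpha> u) = 0"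
      by auto
    define \<beta> where "\<beta> = \<alpha>(u0 := - (\<Sum>u\<in>U - {u0}. m c u * \<alpha> u) / m c u0)"
    have eq: "(\<Sum>u\<in>U. m c' u * \<beta> u) = m c' u0 * \<beta> u0 + (\<Sum>u\<in>U - {u0}. m c' u * \<alpha> u)" for c'
      using u0 insert.prems by (subst sum.remove[of U u0]) (auto simp: \<beta>_def intro!: sum.cong)
    have "(\<Sum>u\<in>U. m c' u * \<beta> u) = 0" if c': "c' \<in> insert c C" for c'
    proof (cases "c' = c")
      case True
      thus ?thesis unfolding eq using u0 by (simp add: \<beta>_def)
    next
      case False
      hence "0 = (\<Sum>u\<in>U - {u0}. m' c' u * \<alpha> u)" using \<alpha> c' by simp
      also have "\<dots> = (\<Sum>u\<in>U - {u0}. m c' u * \<alpha> u - m c' u0 / m c u0 * (m c u * \<alpha> u))"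
        by (intro sum.cong) (auto simp: m'_def algebra_simps)
      also have "\<dots> = (\<Sum>u\<in>U. m c' u * \<beta> u)"
        unfolding eq sum_subtractf sum_distrib_left[symmetric] by (simp add: \<beta>_def)
      finally show ?thesis by simp
    qed
    moreover have "\<exists>u\<in>U. \<beta> u \<noteq> 0" using \<alpha>(1) by (auto simp: \<beta>_def)
    ultimately show ?thesis by blast
  qed
qed

section \<open>Laurent polynomials with bounded exponents\<close>

definition mon :: "int \<times> int \<times> int \<Rightarrow> int \<Rightarrow> int \<Rightarrow> ratq" where
  "mon x n k = qp (fst x + fst (snd x) * n + snd (snd x) * k)"

definition box :: "nat \<Rightarrow> nat \<Rightarrow> nat \<Rightarrow> (int \<times> int \<times> int) set" where
  "box G E F = {- int G..int G} \<times> {- int E..int E} \<times> {- int F..int F}"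

lemma finite_box [simp]: "finite (box G E F)"
  by (simp add: box_def)

lemma card_box: "card (box G E F) = (2 * G + 1) * (2 * E + 1) * (2 * F + 1)"
proof -
  have "nat (1 + int M + int M) = 2 * M + 1" for M by linarith
  thus ?thesis by (simp add: box_def card_cartesian_product algebra_simps)
qed

text \<open>\<open>G\<close>, \<open>E\<close>, \<open>F\<close> bound the exponents of q, q^n and
  q^k. The coefficients are rational, so conditions on them are linear over the rationals and the
  degree in q is part of the count.\<close>

definition lau :: "nat \<Rightarrow> nat \<Rightarrow> nat \<Rightarrow> (int \<Rightarrow> int \<Rightarrow> ratq) \<Rightarrow> bool" where
  "lau G E F \<phi> \<longleftrightarrow> (\<exists>m. \<forall>n k. \<phi> n k = (\<Sum>x\<in>box G E F. of_rat (m x) * mon x n k))"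

lemma lau_zero: "lau G E F (\<lambda>n k. 0)"
  unfolding lau_def by (intro exI[of _ "\<lambda>_. 0"]) simp

lemma lau_add: "lau G E F \<phi> \<Longrightarrow> lau G E F \<psi> \<Longrightarrow> lau G E F (\<lambda>n k. \<phi> n k + \<psi> n k)"
proof -
  assume "lau G E F \<phi>" "lau G E F \<psi>"
  then obtain m m' where "\<And>n k. \<phi> n k = (\<Sum>x\<in>box G E F. of_rat (m x) * mon x n k)"
    "\<And>n k. \<psi> n k = (\<Sum>x\<in>box G E F. of_rat (m' x) * mon x n k)"
    unfolding lau_def by blast
  thus ?thesis unfolding lau_def
    by (intro exI[of _ "\<lambda>x. m x + m' x"]) (simp add: of_rat_add ring_distribs sum.distrib)
qed

lemma lau_smult: "lau G E F \<phi> \<Longrightarrow> lau G E F (\<lambda>n k. of_rat c * \<phi> n k)"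
proof -
  assume "lau G E F \<phi>"
  then obtain m where "\<And>n k. \<phi> n k = (\<Sum>x\<in>box G E F. of_rat (m x) * mon x n k)"
    unfolding lau_def by blast
  thus ?thesis unfolding lau_def
    by (intro exI[of _ "\<lambda>x. c * m x"]) (simp add: of_rat_mult sum_distrib_left mult.assoc)
qed

lemma lau_uminus: "lau G E F \<phi> \<Longrightarrow> lau G E F (\<lambda>n k. - \<phi> n k)"
  using lau_smult[of G E F \<phi> "-1"] by simp

lemma lau_sum: "(\<And>x. x \<in> A \<Longrightarrow> lau G E F (\<phi> x)) \<Longrightarrow> lau G E F (\<lambda>n k. \<Sum>x\<in>A. \<phi> x n k)"
  by (induction A rule: infinite_finite_induct) (simp_all add: lau_zero lau_add)

lemma lau_qp:
  assumes "\<bar>g\<bar> \<le> int G" "\<bar>e\<bar> \<le> int E" "\<bar>f\<bar> \<le> int F"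
  shows "lau G E F (\<lambda>n k. qp (g + e * n + f * k))"
  unfolding lau_def
proof (intro exI allI)
  fix n k
  have "(g, e, f) \<in> box G E F" using assms by (auto simp: box_def)
  hence "(\<Sum>x\<in>box G E F. if x = (g, e, f) then mon x n k else 0) = mon (g, e, f) n k" by simp
  also have "(\<Sum>x\<in>box G E F. if x = (g, e, f) then mon x n k else 0)
     = (\<Sum>x\<in>box G E F. of_rat (if x = (g, e, f) then 1 else 0) * mon x n k)"
    by (intro sum.cong) auto
  finally show "qp (g + e * n + f * k) = (\<Sum>x\<in>box G E F. of_rat (if x = (g, e, f) then 1 else 0) * mon x n k)"
    by (simp add: mon_def)
qed

lemma lau_one: "lau G E F (\<lambda>n k. 1)"
  using lau_qp[of 0 G 0 E 0 F] by simp

lemma lau_induct: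
  assumes "lau G E F \<phi>"
    and mon: "\<And>g e f. \<bar>g\<bar> \<le> int G \<Longrightarrow> \<bar>e\<bar> \<le> int E \<Longrightarrow> \<bar>f\<bar> \<le> int F \<Longrightarrow> P (\<lambda>n k. qp (g + e * n + f * k))"
    and zero: "P (\<lambda>n k. 0)"
    and add: "\<And>\<phi> \<psi>. P \<phi> \<Longrightarrow> P \<psi> \<Longrightarrow> P (\<lambda>n k. \<phi> n k + \<psi> n k)"
    and smult: "\<And>\<phi> c. P \<phi> \<Longrightarrow> P (\<lambda>n k. of_rat c * \<phi> n k)"
  shows "P \<phi>"
proof -
  obtain m where m: "\<And>n k. \<phi> n k = (\<Sum>x\<in>box G E F. of_rat (m x) * mon x n k)"
    using assms(1) unfolding lau_def by blast
  have "P (\<lambda>n k. \<Sum>x\<in>A. of_rat (m x) * mon x n k)" if "A \<subseteq> box G E F" for A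
    using finite_subset[OF that finite_box] that
  proof (induction A rule: finite_induct)
    case (insert x A)
    have "P (\<lambda>n k. mon x n k)" unfolding mon_def
      using insert.prems by (intro mon) (auto simp: box_def)
    thus ?case using insert by (simp add: add smult)
  qed (simp add: zero)
  from this[of "box G E F"] have "P (\<lambda>n k. \<phi> n k)" unfolding m by simp
  thus ?thesis .
qed

lemma lau_mono: "lau G E F \<phi> \<Longrightarrow> G \<le> G' \<Longrightarrow> E \<le> E' \<Longrightarrow> F \<le> F' \<Longrightarrow> lau G' E' F' \<phi>"
  by (erule lau_induct[where P = "lau G' E' F'"]) (auto intro: lau_qp lau_zero lau_add lau_smult)

lemma lau_mult:
  assumes "lau G E F \<phi>" "lau G' E' F' \<psi>"
  shows "lau (G + G') (E + E') (F + F') (\<lambda>n k. \<phi> n k * \<psi> n k)"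
proof -
  let ?P = "lau (G + G') (E + E') (F + F')"
  show ?thesis using assms(1)
  proof (rule lau_induct[where P = "\<lambda>\<phi>. ?P (\<lambda>n k. \<phi> n k * \<psi> n k)"])
    fix g e f assume b: "\<bar>g\<bar> \<le> int G" "\<bar>e\<bar> \<le> int E" "\<bar>f\<bar> \<le> int F"
    show "?P (\<lambda>n k. qp (g + e * n + f * k) * \<psi> n k)" using assms(2)
    proof (rule lau_induct[where P = "\<lambda>\<psi>. ?P (\<lambda>n k. qp (g + e * n + f * k) * \<psi> n k)"])
      fix g' e' f' assume b': "\<bar>g'\<bar> \<le> int G'" "\<bar>e'\<bar> \<le> int E'" "\<bar>f'\<bar> \<le> int F'"
      have "?P (\<lambda>n k. qp ((g + g') + (e + e') * n + (f + f') * k))"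
        by (rule lau_qp) (use b b' in auto)
      thus "?P (\<lambda>n k. qp (g + e * n + f * k) * qp (g' + e' * n + f' * k))"
        by (simp add: qp_add[symmetric] algebra_simps)
    next
      fix \<phi> c assume "?P (\<lambda>n k. qp (g + e * n + f * k) * \<phi> n k)"
      from lau_smult[OF this, of c] show "?P (\<lambda>n k. qp (g + e * n + f * k) * (of_rat c * \<phi> n k))"
        by (simp add: mult.left_commute)
    qed (simp_all add: lau_zero lau_add ring_distribs)
  next
    fix \<phi> c assume "?P (\<lambda>n k. \<phi> n k * \<psi> n k)"
    from lau_smult[OF this, of c] show "?P (\<lambda>n k. of_rat c * \<phi> n k * \<psi> n k)"
      by (simp add: mult.assoc)
  qed (simp_all add: lau_zero lau_add ring_distribs)
qed

lemma lau_prod: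
  assumes "finite A" "\<And>x. x \<in> A \<Longrightarrow> lau G E F (\<phi> x)"
  shows "lau (card A * G) (card A * E) (card A * F) (\<lambda>n k. \<Prod>x\<in>A. \<phi> x n k)"
  using assms
proof (induction A rule: finite_induct)
  case (insert x A)
  have "lau (G + card A * G) (E + card A * E) (F + card A * F) (\<lambda>n k. \<phi> x n k * (\<Prod>x\<in>A. \<phi> x n k))"
    by (rule lau_mult) (use insert in auto)
  thus ?case using insert.hyps by simp
qed (simp add: lau_one)

text \<open>A shift turns q^(e n) into q^(e i) q^(e n): only the degree in q grows.\<close>

lemma lau_shift:
  assumes "lau G E F \<phi>"
  shows "lau (G + E * i + F * j) E F (\<lambda>n k. \<phi> (n + int i) (k + int j))"
  using assms
proof (rule lau_induct[where P = "\<lambda>\<phi>. lau (G + E * i + F * j) E F (\<lambda>n k. \<phi> (n + int i) (k + int j))"])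
  fix g e f assume b: "\<bar>g\<bar> \<le> int G" "\<bar>e\<bar> \<le> int E" "\<bar>f\<bar> \<le> int F"
  have "\<bar>e * int i\<bar> \<le> int (E * i)" "\<bar>f * int j\<bar> \<le> int (F * j)"
    using b by (auto simp: abs_mult intro!: mult_right_mono)
  hence "lau (G + E * i + F * j) E F (\<lambda>n k. qp ((g + e * int i + f * int j) + e * n + f * k))"
    using b by (intro lau_qp) auto
  thus "lau (G + E * i + F * j) E F (\<lambda>n k. qp (g + e * (n + int i) + f * (k + int j)))"
    by (simp add: algebra_simps)
qed (simp_all add: lau_zero lau_add lau_smult)

text \<open>On the line, \<open>b * k\<close> may be replaced by \<open>t - a * n\<close>. Writing
  \<open>f = b * u + f mod b\<close> leaves only the exponent \<open>f mod b\<close> of q^k, below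
  \<open>\<bar>b\<bar>\<close>; the rest moves into the exponents of q and q^n, which grow in
  proportion to \<open>F\<close>. This makes a line cheap although \<open>F\<close> is
  large.\<close>

lemma lau_line:
  assumes "lau G E F \<phi>" and b: "b \<noteq> 0" and ab: "\<bar>a\<bar> \<le> int s" "\<bar>b\<bar> \<le> int s" "\<bar>t\<bar> \<le> int T"
  shows "\<exists>\<psi>. lau (G + F * T) (E + F * s) s \<psi> \<and> (\<forall>n k. a * n + b * k = t \<longrightarrow> \<phi> n k = \<psi> n k)"
proof -
  let ?P = "\<lambda>\<phi>. \<exists>\<psi>. lau (G + F * T) (E + F * s) s \<psi> \<and> (\<forall>n k. a * n + b * k = t \<longrightarrow> \<phi> n k = \<psi> n k)"
  show "?P \<phi>" using assms(1)
  proof (rule lau_induct[where P = ?P])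
    fix g e f assume bd: "\<bar>g\<bar> \<le> int G" "\<bar>e\<bar> \<le> int E" "\<bar>f\<bar> \<le> int F"
    define u where "u = f div b"
    \<comment> \<open>Rounding down moves a negative quotient away from 0, yet not beyond
      \<open>f\<close>, as \<open>b\<close> is a nonzero integer; a negative \<open>b\<close> is
      treated by changing both signs.\<close>
    have "\<bar>u\<bar> \<le> \<bar>f\<bar>"
    proof (cases "f = 0")
      case False
      have *: "\<bar>x div y\<bar> \<le> \<bar>x\<bar>" if "y > 0" for x y :: int
      proof (cases "x \<ge> 0")
        case True
        have "x div y \<le> x" using zdiv_mono2[of x 1 y] True that by simp
        moreover have "0 \<le> x div y" using True that by (simp add: pos_imp_zdiv_nonneg_iff)
        ultimately show ?thesis using True by simp
      next
        case False
        have "x \<le> x div y" using zdiv_mono2_neg[of x 1 y] False that by simp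
        moreover have "x div y < 0" using False that by (simp add: pos_imp_zdiv_neg_iff)
        ultimately show ?thesis using False by simp
      qed
      show ?thesis
      proof (cases "b > 0")
        case True thus ?thesis unfolding u_def by (rule *)
      next
        case False
        hence "\<bar>(- f) div (- b)\<bar> \<le> \<bar>- f\<bar>" using b by (intro *) auto
        thus ?thesis by (simp add: u_def)
      qed
    qed (simp add: u_def)
    hence u: "\<bar>u\<bar> \<le> int F" using bd by simp
    have r: "\<bar>f mod b\<bar> \<le> int s" using abs_mod_less[OF b, of f] ab by simp
    have "\<bar>u * t\<bar> \<le> int (F * T)" "\<bar>u * a\<bar> \<le> int (F * s)"
      using u ab by (auto simp: abs_mult intro!: mult_mono)
    hence "lau (G + F * T) (E + F * s) s (\<lambda>n k. qp ((g + u * t) + (e - u * a) * n + (f mod b) * k))"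
      using bd r by (intro lau_qp) auto
    moreover have "g + e * n + f * k = (g + u * t) + (e - u * a) * n + (f mod b) * k"
      if "a * n + b * k = t" for n k
    proof -
      have "f * k = (b * u + f mod b) * k" unfolding u_def by simp
      moreover have "u * t = u * a * n + u * b * k" using that by (simp flip: that add: algebra_simps)
      ultimately show ?thesis by (simp add: algebra_simps)
    qed
    ultimately show "?P (\<lambda>n k. qp (g + e * n + f * k))"
      by (intro exI[of _ "\<lambda>n k. qp ((g + u * t) + (e - u * a) * n + (f mod b) * k)"] conjI allI impI
            arg_cong[of _ _ qp])
  next
    show "?P (\<lambda>n k. 0)"
      by (intro exI[of _ "\<lambda>_ _. 0"]) (simp add: lau_zero)
  next
    fix \<phi> \<phi>' :: "int \<Rightarrow> int \<Rightarrow> ratq"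
    assume "?P \<phi>" "?P \<phi>'"
    then obtain \<psi> \<psi>' where "lau (G + F * T) (E + F * s) s \<psi>" "\<forall>n k. a * n + b * k = t \<longrightarrow> \<phi> n k = \<psi> n k"
      "lau (G + F * T) (E + F * s) s \<psi>'" "\<forall>n k. a * n + b * k = t \<longrightarrow> \<phi>' n k = \<psi>' n k" by blast
    thus "?P (\<lambda>n k. \<phi> n k + \<phi>' n k)"
      by (intro exI[of _ "\<lambda>n k. \<psi> n k + \<psi>' n k"]) (simp add: lau_add)
  next
    fix \<phi> :: "int \<Rightarrow> int \<Rightarrow> ratq" and c
    assume "?P \<phi>"
    then obtain \<psi> where "lau (G + F * T) (E + F * s) s \<psi>" "\<forall>n k. a * n + b * k = t \<longrightarrow> \<phi> n k = \<psi> n k"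
      by blast
    thus "?P (\<lambda>n k. of_rat c * \<phi> n k)"
      by (intro exI[of _ "\<lambda>n k. of_rat c * \<psi> n k"]) (simp add: lau_smult)
  qed
qed

text \<open>Each monomial of each box gives one linear condition on \<open>\<alpha>\<close>, namely
  that its total coefficient vanish; the same unknowns serve all classes \<open>d\<close>.\<close>

lemma common_annihilator:
  fixes \<Psi> :: "'d \<Rightarrow> 'u \<Rightarrow> int \<Rightarrow> int \<Rightarrow> ratq"
  assumes fin: "finite D" "finite U"
    and rep: "\<And>d u. d \<in> D \<Longrightarrow> u \<in> U \<Longrightarrow>
      \<exists>\<phi>. lau (G d) (E d) (F d) \<phi> \<and> (\<forall>(n, k)\<in>C d. \<Psi> d u n k = \<phi> n k)"
    and card: "(\<Sum>d\<in>D. card (box (G d) (E d) (F d))) < card U"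
  shows "\<exists>\<alpha>. (\<exists>u\<in>U. \<alpha> u \<noteq> 0) \<and>
    (\<forall>d\<in>D. \<forall>(n, k)\<in>C d. (\<Sum>u\<in>U. of_rat (\<alpha> u) * \<Psi> d u n k) = 0)"
proof -
  have "\<exists>m. \<forall>(n, k)\<in>C d. \<Psi> d u n k = (\<Sum>x\<in>box (G d) (E d) (F d). of_rat (m x) * mon x n k)"
    if du: "d \<in> D" "u \<in> U" for d u
  proof -
    obtain \<phi> where \<phi>: "lau (G d) (E d) (F d) \<phi>" "\<forall>(n, k)\<in>C d. \<Psi> d u n k = \<phi> n k"
      using rep[OF du] by blast
    from \<phi>(1) obtain m where "\<forall>n k. \<phi> n k = (\<Sum>x\<in>box (G d) (E d) (F d). of_rat (m x) * mon x n k)"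
      unfolding lau_def by blast
    with \<phi>(2) show ?thesis by (intro exI[of _ m]) auto
  qed
  note ex = this
  define m where "m d u = (SOME m. \<forall>(n, k)\<in>C d. \<Psi> d u n k = (\<Sum>x\<in>box (G d) (E d) (F d). of_rat (m x) * mon x n k))"
    for d u
  have m: "\<Psi> d u n k = (\<Sum>x\<in>box (G d) (E d) (F d). of_rat (m d u x) * mon x n k)"
    if "d \<in> D" "u \<in> U" "(n, k) \<in> C d" for d u n k
    using someI_ex[OF ex[OF that(1,2)], folded m_def] that(3) by blast
  let ?Q = "SIGMA d:D. box (G d) (E d) (F d)"
  obtain \<alpha> where \<alpha>: "\<exists>u\<in>U. \<alpha> u \<noteq> 0" "\<forall>c\<in>?Q. (\<Sum>u\<in>U. m (fst c) u (snd c) * \<alpha> u) = 0"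
    using homogeneous_system_nontrivial[of ?Q U "\<lambda>c u. m (fst c) u (snd c)"] fin card by auto
  have "(\<Sum>u\<in>U. of_rat (\<alpha> u) * \<Psi> d u n k) = 0" if d: "d \<in> D" "(n, k) \<in> C d" for d n k
  proof -
    have "(\<Sum>u\<in>U. of_rat (\<alpha> u) * \<Psi> d u n k)
       = (\<Sum>u\<in>U. \<Sum>x\<in>box (G d) (E d) (F d). of_rat (m d u x * \<alpha> u) * mon x n k)"
      by (intro sum.cong refl) (simp add: m d sum_distrib_left of_rat_mult algebra_simps)
    also have "\<dots> = (\<Sum>x\<in>box (G d) (E d) (F d). of_rat (\<Sum>u\<in>U. m d u x * \<alpha> u) * mon x n k)"
      by (subst sum.swap) (simp add: of_rat_sum sum_distrib_right)
    also have "\<dots> = 0"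
      using \<alpha>(2) d(1) by (intro sum.neutral ballI) auto
    finally show ?thesis .
  qed
  thus ?thesis using \<alpha>(1) by blast
qed

section \<open>Shifts of hypergeometric terms\<close>

lemma qp_eq_1_iff: "qp e = 1 \<longleftrightarrow> e = 0"
proof
  assume e: "qp e = 1"
  show "e = 0"
  proof (rule ccontr)
    assume "e \<noteq> 0"
    hence "(\<Sum>x\<in>{0, e}. of_rat (if x = 0 then -1 else 1) * qp x) = 0" using e by simp
    from qp_independent[OF _ this, of 0] show False by simp
  qed
qed simp

lemma qfac_Suc: "m \<ge> 0 \<Longrightarrow> qfac (m + 1) = qfac m * (1 - qp (m + 1))"
  by (simp add: qfac_nonneg nat_add_distrib)

lemma qfac_nonzero: "m \<ge> 0 \<Longrightarrow> qfac m \<noteq> 0"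
  using qp_eq_1_iff by (auto simp: qfac_nonneg)

lemma qfac_add: "m \<ge> 0 \<Longrightarrow> qfac (m + int r) = qfac m * (\<Prod>t\<in>{1..r}. 1 - qp (m + int t))"
proof (induction r)
  case (Suc r)
  have "qfac (m + int (Suc r)) = qfac (m + int r) * (1 - qp (m + int (Suc r)))"
    using qfac_Suc[of "m + int r"] Suc.prems by (simp add: add.assoc add.commute[of 1])
  thus ?case using Suc by simp
qed simp

text \<open>For negative \<open>m\<close> both sides are 0: the product then contains
  \<open>1 - qp 0\<close>. Reciprocals of factorials thus pass through the boundary without a case
  distinction, and only numerator factors force lines to be treated separately.\<close>

lemma inverse_qfac_add:
  assumes "m + int r \<ge> 0"
  shows "inverse (qfac m) = inverse (qfac (m + int r)) * (\<Prod>t\<in>{1..r}. 1 - qp (m + int t))"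
proof (cases "m \<ge> 0")
  case True
  have "qfac (m + int r) \<noteq> 0" by (rule qfac_nonzero[OF assms])
  thus ?thesis using qfac_add[OF True, of r] by (auto simp: field_simps)
next
  case False
  hence "nat (- m) \<in> {1..r}" "1 - qp (m + int (nat (- m))) = 0" using assms by auto
  hence "(\<Prod>t\<in>{1..r}. 1 - qp (m + int t)) = 0" by (intro prod_zero) (auto intro: bexI[of _ "nat (- m)"])
  thus ?thesis using False by (simp add: qfac_neg)
qed

section \<open>Linear and quadratic forms in n and k\<close>

fun lf :: "linform \<Rightarrow> int \<Rightarrow> int \<Rightarrow> int" where
  "lf (a, b, c) n k = a * n + b * k + c"

fun lf_bounded :: "nat \<Rightarrow> linform \<Rightarrow> bool" where
  "lf_bounded s (a, b, c) \<longleftrightarrow> \<bar>a\<bar> \<le> int s \<and> \<bar>b\<bar> \<le> int s \<and> \<bar>c\<bar> \<le> int s"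

type_synonym qform = "int \<times> int \<times> int \<times> int \<times> int \<times> int"

definition tri :: "int \<Rightarrow> int" where
  "tri n = n * (n - 1) div 2"

lemma two_tri: "2 * tri n = n * (n - 1)"
  unfolding tri_def by simp

lemma tri_add: "tri (n + i) = tri n + n * i + tri i"
proof -
  have "2 * tri (n + i) = 2 * (tri n + n * i + tri i)"
    unfolding distrib_left two_tri by (simp add: algebra_simps)
  thus ?thesis by simp
qed

text \<open>The binomial basis turns integer-valued quadratic functions into integer coefficient vectors.\<close>

fun qf :: "qform \<Rightarrow> int \<Rightarrow> int \<Rightarrow> int" where
  "qf (a, b, c, d, e, f) n k = a * tri n + b * n * k + c * tri k + d * n + e * k + f"

fun qf_bounded :: "nat \<Rightarrow> qform \<Rightarrow> bool" where
  "qf_bounded s (a, b, c, d, e, f) \<longleftrightarrow>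
     \<bar>a\<bar> \<le> int s \<and> \<bar>b\<bar> \<le> int s \<and> \<bar>c\<bar> \<le> int s \<and> \<bar>d\<bar> \<le> int s \<and> \<bar>e\<bar> \<le> int s \<and> \<bar>f\<bar> \<le> int s"

text \<open>Denominators enter through \<open>inverse\<close>, so a negative argument gives 0 in
  either list, and the term is defined on all pairs of integers.\<close>

definition hterm :: "linform list \<Rightarrow> linform list \<Rightarrow> qform \<Rightarrow> int \<Rightarrow> int \<Rightarrow> ratq" where
  "hterm ns ds q n k =
     (\<Prod>l\<leftarrow>ns. qfac (lf l n k)) * (\<Prod>l\<leftarrow>ds. inverse (qfac (lf l n k))) * qp (qf q n k)"

text \<open>
  If \<open>f\<close> is tame on \<open>C\<close>, then an operator annihilates \<open>f\<close> on \<open>C\<close> as soon as its coefficients satisfy one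
  linear condition for each monomial that occurs in the \<open>\<kappa>\<close>; the degree bounds make these few.
\<close>

definition tame :: "(int \<times> int) set \<Rightarrow> nat \<Rightarrow> nat \<Rightarrow> nat \<Rightarrow> nat \<Rightarrow> nat \<Rightarrow> (int \<Rightarrow> int \<Rightarrow> ratq) \<Rightarrow> bool" where
  "tame C I J G E F f \<longleftrightarrow> (\<exists>base. \<forall>i\<le>I. \<forall>j\<le>J. \<exists>\<kappa>. lau G E F \<kappa> \<and>
     (\<forall>(n, k)\<in>C. f (n + int i) (k + int j) = base n k * \<kappa> n k))"

lemma tameI:
  assumes "\<And>i j. i \<le> I \<Longrightarrow> j \<le> J \<Longrightarrow> lau G E F (\<kappa> i j)"
    "\<And>i j n k. i \<le> I \<Longrightarrow> j \<le> J \<Longrightarrow> (n, k) \<in> C \<Longrightarrow> f (n + int i) (k + int j) = base n k * \<kappa> i j n k"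
  shows "tame C I J G E F f"
  unfolding tame_def using assms by (intro exI[of _ base] allI impI exI conjI ballI) (auto split: prod.splits)

lemma tameE:
  assumes "tame C I J G E F f"
  obtains base \<kappa> where "\<And>i j. i \<le> I \<Longrightarrow> j \<le> J \<Longrightarrow> lau G E F (\<kappa> i j)"
    "\<And>i j n k. i \<le> I \<Longrightarrow> j \<le> J \<Longrightarrow> (n, k) \<in> C \<Longrightarrow> f (n + int i) (k + int j) = base n k * \<kappa> i j n k"
proof -
  obtain base where b: "\<And>i j. i \<le> I \<Longrightarrow> j \<le> J \<Longrightarrow> \<exists>\<kappa>. lau G E F \<kappa> \<and>
     (\<forall>(n, k)\<in>C. f (n + int i) (k + int j) = base n k * \<kappa> n k)"
    using assms unfolding tame_def by blast
  define \<kappa> where "\<kappa> i j = (SOME \<kappa>. lau G E F \<kappa> \<and>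
     (\<forall>(n, k)\<in>C. f (n + int i) (k + int j) = base n k * \<kappa> n k))" for i j
  have "lau G E F (\<kappa> i j) \<and> (\<forall>(n, k)\<in>C. f (n + int i) (k + int j) = base n k * \<kappa> i j n k)"
    if "i \<le> I" "j \<le> J" for i j
    unfolding \<kappa>_def by (rule someI_ex[OF b[OF that]])
  thus ?thesis by (intro that[of \<kappa> base]) fastforce+
qed

lemma tame_mono: "tame C I J G E F f \<Longrightarrow> G \<le> G' \<Longrightarrow> E \<le> E' \<Longrightarrow> F \<le> F' \<Longrightarrow> tame C I J G' E' F' f"
  by (erule tameE, rule tameI) (auto intro: lau_mono)

lemma tame_one: "tame C I J G E F (\<lambda>n k. 1)"
  by (rule tameI[where base = "\<lambda>_ _. 1" and \<kappa> = "\<lambda>_ _ _ _. 1"]) (auto intro: lau_one)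

lemma tame_mult:
  assumes "tame C I J G E F f" "tame C I J G' E' F' g"
  shows "tame C I J (G + G') (E + E') (F + F') (\<lambda>n k. f n k * g n k)"
proof -
  from assms(1) obtain b \<kappa> where 1: "\<And>i j. i \<le> I \<Longrightarrow> j \<le> J \<Longrightarrow> lau G E F (\<kappa> i j)"
    "\<And>i j n k. i \<le> I \<Longrightarrow> j \<le> J \<Longrightarrow> (n, k) \<in> C \<Longrightarrow> f (n + int i) (k + int j) = b n k * \<kappa> i j n k"
    by (rule tameE) blast
  from assms(2) obtain b' \<kappa>' where 2: "\<And>i j. i \<le> I \<Longrightarrow> j \<le> J \<Longrightarrow> lau G' E' F' (\<kappa>' i j)"
    "\<And>i j n k. i \<le> I \<Longrightarrow> j \<le> J \<Longrightarrow> (n, k) \<in> C \<Longrightarrow> g (n + int i) (k + int j) = b' n k * \<kappa>' i j n k"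
    by (rule tameE) blast
  show ?thesis
  proof (rule tameI[where base = "\<lambda>n k. b n k * b' n k" and \<kappa> = "\<lambda>i j n k. \<kappa> i j n k * \<kappa>' i j n k"])
    fix i j n k assume "i \<le> I" "j \<le> J" "(n, k) \<in> C"
    thus "f (n + int i) (k + int j) * g (n + int i) (k + int j) = b n k * b' n k * (\<kappa> i j n k * \<kappa>' i j n k)"
      by (simp add: 1 2)
  qed (intro lau_mult 1 2)
qed

lemma tame_prod_list:
  assumes "\<And>l. l \<in> set ls \<Longrightarrow> tame C I J G E F (f l)" "length ls \<le> s"
  shows "tame C I J (s * G) (s * E) (s * F) (\<lambda>n k. \<Prod>l\<leftarrow>ls. f l n k)"
proof -
  have "tame C I J (length ls * G) (length ls * E) (length ls * F) (\<lambda>n k. \<Prod>l\<leftarrow>ls. f l n k)"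
    using assms(1)
  proof (induction ls)
    case (Cons l ls)
    have "tame C I J (G + length ls * G) (E + length ls * E) (F + length ls * F)
        (\<lambda>n k. f l n k * (\<Prod>l\<leftarrow>ls. f l n k))"
      by (rule tame_mult) (use Cons in auto)
    thus ?case by simp
  qed (simp add: tame_one)
  thus ?thesis using assms(2) by (elim tame_mono) auto
qed

section \<open>Tameness of the factors of a proper term\<close>

lemma abs_mult_int_le: "\<bar>a\<bar> \<le> int s \<Longrightarrow> i \<le> I \<Longrightarrow> \<bar>a * int i\<bar> \<le> int (s * I)"
  by (simp add: abs_mult mult_mono)

lemma lf_shift: "lf (a, b, c) (n + int i) (k + int j) = lf (a, b, c) n k + (a * int i + b * int j)"
  by (simp add: algebra_simps)

lemma lf_shift_bound:
  assumes "lf_bounded s (a, b, c)" "s * (I + J) \<le> w" "i \<le> I" "j \<le> J"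
  shows "\<bar>a * int i + b * int j\<bar> \<le> int w"
proof -
  have "\<bar>a * int i\<bar> \<le> int (s * I)" "\<bar>b * int j\<bar> \<le> int (s * J)"
    by (intro abs_mult_int_le; use assms in simp)+
  moreover have "int (s * I) + int (s * J) \<le> int w" 
    using assms(2) unfolding of_nat_add[symmetric] of_nat_le_iff by (simp add: distrib_left)
  ultimately show ?thesis by linarith
qed

lemma lau_one_minus_qp:
  assumes "lf_bounded s l" "\<bar>t\<bar> \<le> int w"
  shows "lau (w + s) s s (\<lambda>n k. 1 - qp (t + lf l n k))"
proof -
  obtain a b c where l: "l = (a, b, c)" by (cases l) auto
  have "lau (w + s) s s (\<lambda>n k. qp ((t + c) + a * n + b * k))"
    by (rule lau_qp) (use assms l in auto)
  from lau_add[OF lau_one lau_uminus[OF this]] show ?thesis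
    by (simp add: l algebra_simps)
qed

lemma lau_prod_one_minus_qp:
  assumes "lf_bounded s l" "\<And>t. t \<in> {1..r} \<Longrightarrow> \<bar>u + int t\<bar> \<le> int w" "r \<le> 2 * w"
  shows "lau (2 * w * (w + s)) (2 * w * s) (2 * w * s) (\<lambda>n k. \<Prod>t\<in>{1..r}. 1 - qp (u + int t + lf l n k))"
proof -
  have "lau (card {1..r} * (w + s)) (card {1..r} * s) (card {1..r} * s)
      (\<lambda>n k. \<Prod>t\<in>{1..r}. 1 - qp (u + int t + lf l n k))"
    by (intro lau_prod lau_one_minus_qp assms) auto
  thus ?thesis by (rule lau_mono) (use assms(3) in \<open>auto intro!: mult_le_mono\<close>)
qed

text \<open>All shifts are measured from the smallest argument they can reach,
  \<open>lf l n k - w\<close>, which is nonnegative on \<open>C\<close>; each quotient is then a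
  product of at most \<open>2 * w\<close> factors.\<close>

lemma tame_qfac:
  assumes l: "lf_bounded s l" and w: "s * (I + J) \<le> w" and C: "\<And>n k. (n, k) \<in> C \<Longrightarrow> int w \<le> lf l n k"
  shows "tame C I J (2 * w * (w + s)) (2 * w * s) (2 * w * s) (\<lambda>n k. qfac (lf l n k))"
proof -
  obtain a b c where abc: "l = (a, b, c)" by (cases l) auto
  define \<delta> where "\<delta> i j = a * int i + b * int j" for i j
  have \<delta>: "\<bar>\<delta> i j\<bar> \<le> int w" if "i \<le> I" "j \<le> J" for i j
    unfolding \<delta>_def using l w that abc by (intro lf_shift_bound) auto
  show ?thesis
  proof (rule tameI[where base = "\<lambda>n k. qfac (lf l n k - int w)" and
       \<kappa> = "\<lambda>i j n k. \<Prod>t\<in>{1..nat (\<delta> i j + int w)}. 1 - qp (- int w + int t + lf l n k)"])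
    fix i j assume ij: "i \<le> I" "j \<le> J"
    show "lau (2 * w * (w + s)) (2 * w * s) (2 * w * s)
       (\<lambda>n k. \<Prod>t\<in>{1..nat (\<delta> i j + int w)}. 1 - qp (- int w + int t + lf l n k))"
      using \<delta>[OF ij] by (intro lau_prod_one_minus_qp l) auto
    fix n k assume "(n, k) \<in> C"
    hence 0: "0 \<le> lf l n k - int w" using C by simp
    have 1: "lf l (n + int i) (k + int j) = lf l n k - int w + int (nat (\<delta> i j + int w))"
      using \<delta>[OF ij] unfolding abc lf_shift \<delta>_def by linarith
    show "qfac (lf l (n + int i) (k + int j)) = qfac (lf l n k - int w) *
      (\<Prod>t\<in>{1..nat (\<delta> i j + int w)}. 1 - qp (- int w + int t + lf l n k))"
      unfolding 1 qfac_add[OF 0] by (simp add: algebra_simps)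
  qed
qed

text \<open>Measured from the largest argument, \<open>lf l n k + w\<close>, which only has to be
  nonnegative; the shifted arguments themselves may be negative, by
  \<open>inverse_qfac_add\<close>.\<close>

lemma tame_inverse_qfac:
  assumes l: "lf_bounded s l" and w: "s * (I + J) \<le> w" and C: "\<And>n k. (n, k) \<in> C \<Longrightarrow> - int w \<le> lf l n k"
  shows "tame C I J (2 * w * (w + s)) (2 * w * s) (2 * w * s) (\<lambda>n k. inverse (qfac (lf l n k)))"
proof -
  obtain a b c where abc: "l = (a, b, c)" by (cases l) auto
  define \<delta> where "\<delta> i j = a * int i + b * int j" for i j
  have \<delta>: "\<bar>\<delta> i j\<bar> \<le> int w" if "i \<le> I" "j \<le> J" for i j
    unfolding \<delta>_def using l w that abc by (intro lf_shift_bound) auto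
  show ?thesis
  proof (rule tameI[where base = "\<lambda>n k. inverse (qfac (lf l n k + int w))" and
       \<kappa> = "\<lambda>i j n k. \<Prod>t\<in>{1..nat (int w - \<delta> i j)}. 1 - qp (\<delta> i j + int t + lf l n k)"])
    fix i j assume ij: "i \<le> I" "j \<le> J"
    show "lau (2 * w * (w + s)) (2 * w * s) (2 * w * s)
       (\<lambda>n k. \<Prod>t\<in>{1..nat (int w - \<delta> i j)}. 1 - qp (\<delta> i j + int t + lf l n k))"
      using \<delta>[OF ij] by (intro lau_prod_one_minus_qp l) auto
    fix n k assume "(n, k) \<in> C"
    hence 0: "0 \<le> lf l n k + \<delta> i j + int (nat (int w - \<delta> i j))" using C[of n k] \<delta>[OF ij] by simp
    have 1: "lf l (n + int i) (k + int j) = lf l n k + \<delta> i j"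
      unfolding abc lf_shift \<delta>_def ..
    have 2: "lf l n k + \<delta> i j + int (nat (int w - \<delta> i j)) = lf l n k + int w"
      using \<delta>[OF ij] by simp
    show "inverse (qfac (lf l (n + int i) (k + int j))) = inverse (qfac (lf l n k + int w)) *
      (\<Prod>t\<in>{1..nat (int w - \<delta> i j)}. 1 - qp (\<delta> i j + int t + lf l n k))"
      unfolding 1 inverse_qfac_add[OF 0] unfolding 2 by (simp add: algebra_simps)
  qed
qed

lemma lau_qfac:
  assumes "\<bar>m\<bar> \<le> int V"
  shows "lau (V * V) E F (\<lambda>n k. qfac m)"
proof (cases "m \<ge> 0")
  case True
  have "lau (card {..<nat m} * V) (card {..<nat m} * 0) (card {..<nat m} * 0) (\<lambda>n k. \<Prod>i\<in>{..<nat m}. 1 - qp (int i + 1))"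
  proof (rule lau_prod)
    fix i assume "i \<in> {..<nat m}"
    hence "lau V 0 0 (\<lambda>n k. qp ((int i + 1) + 0 * n + 0 * k))" using assms by (intro lau_qp) auto
    from lau_add[OF lau_one lau_uminus[OF this]] show "lau V 0 0 (\<lambda>n k. 1 - qp (int i + 1))" by simp
  qed simp
  hence "lau (card {..<nat m} * V) (card {..<nat m} * 0) (card {..<nat m} * 0) (\<lambda>n k. qfac m)"
    using True by (simp add: qfac_nonneg)
  thus ?thesis by (rule lau_mono) (use assms in \<open>auto intro!: mult_le_mono\<close>)
qed (simp add: qfac_neg lau_zero)

text \<open>Where the form is constant, the shifted factorial depends on the shift alone and may
  vanish or not: as a Laurent polynomial in q it belongs to \<open>\<kappa>\<close>.\<close>

lemma tame_qfac_const:
  assumes l: "lf_bounded s l" and w: "s * (I + J) \<le> w" and C: "\<And>n k. (n, k) \<in> C \<Longrightarrow> lf l n k = v"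
    and v: "\<bar>v\<bar> + int w \<le> int V"
  shows "tame C I J (V * V) E F (\<lambda>n k. qfac (lf l n k))"
proof -
  obtain a b c where abc: "l = (a, b, c)" by (cases l) auto
  show ?thesis
  proof (rule tameI[where base = "\<lambda>n k. 1" and \<kappa> = "\<lambda>i j n k. qfac (v + (a * int i + b * int j))"])
    fix i j assume ij: "i \<le> I" "j \<le> J"
    have "\<bar>a * int i + b * int j\<bar> \<le> int w" using l w ij abc by (intro lf_shift_bound) auto
    thus "lau (V * V) E F (\<lambda>n k. qfac (v + (a * int i + b * int j)))"
      using v by (intro lau_qfac) linarith
    fix n k assume "(n, k) \<in> C"
    from C[OF this] show "qfac (lf l (n + int i) (k + int j)) = 1 * qfac (v + (a * int i + b * int j))"
      unfolding abc lf_shift by simp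
  qed
qed

lemma tri_bounds: "0 \<le> tri (int i)" "tri (int i) \<le> int (i * i)"
proof -
  have "2 * tri (int i) = int i * int i - int i" using two_tri[of "int i"] by (simp add: algebra_simps)
  moreover have "int i \<le> int i * int i" by (cases i) auto
  ultimately show "0 \<le> tri (int i)" "tri (int i) \<le> int (i * i)" by auto
qed

text \<open>The difference of a quadratic form and its shift is linear in \<open>n\<close> and
  \<open>k\<close>, so the quotient of the powers of q is a single monomial.\<close>

lemma tame_qp_qf:
  assumes "qf_bounded s q"
  shows "tame C I J (s * (I + J + 1) ^ 2) (s * (I + J)) (s * (I + J)) (\<lambda>n k. qp (qf q n k))"
proof -
  obtain a b c d e f where q: "q = (a, b, c, d, e, f)" by (cases q) auto
  show ?thesis
  proof (rule tameI[where base = "\<lambda>n k. qp (qf q n k)" and \<kappa> = "\<lambda>i j n k. qp ((a * tri (int i) + b * int (i * j)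
      + c * tri (int j) + d * int i + e * int j) + (a * int i + b * int j) * n + (b * int i + c * int j) * k)"])
    fix i j assume ij: "i \<le> I" "j \<le> J"
    have tr: "nat (tri (int i)) \<le> i * i" "nat (tri (int j)) \<le> j * j" "tri (int i) \<ge> 0" "tri (int j) \<ge> 0"
      using tri_bounds[of i] tri_bounds[of j] by linarith+
    have "\<bar>a * int (nat (tri (int i)))\<bar> \<le> int (s * (i * i))" "\<bar>b * int (i * j)\<bar> \<le> int (s * (i * j))"
      "\<bar>c * int (nat (tri (int j)))\<bar> \<le> int (s * (j * j))" "\<bar>d * int i\<bar> \<le> int (s * i)" "\<bar>e * int j\<bar> \<le> int (s * j)"
      by (intro abs_mult_int_le; use assms q tr in simp)+
    hence "\<bar>a * tri (int i) + b * int (i * j) + c * tri (int j) + d * int i + e * int j\<bar>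
       \<le> int (s * (i * i)) + int (s * (i * j)) + int (s * (j * j)) + int (s * i) + int (s * j)"
      unfolding nat_0_le[OF tr(3)] nat_0_le[OF tr(4)] by linarith
    also have "\<dots> \<le> int (s * (i + j + 1) ^ 2)"
      by (simp only: of_nat_add[symmetric] of_nat_le_iff) (simp add: power2_eq_square algebra_simps)
    also have "\<dots> \<le> int (s * (I + J + 1) ^ 2)"
      using ij by (simp only: of_nat_le_iff) (intro mult_le_mono power_mono; simp)
    finally have 1: "\<bar>a * tri (int i) + b * int (i * j) + c * tri (int j) + d * int i + e * int j\<bar> \<le> int (s * (I + J + 1) ^ 2)" .
    have "\<bar>a * int i\<bar> \<le> int (s * I)" "\<bar>b * int j\<bar> \<le> int (s * J)" "\<bar>b * int i\<bar> \<le> int (s * I)" "\<bar>c * int j\<bar> \<le> int (s * J)"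
      using assms q ij by (auto intro!: abs_mult_int_le simp del: of_nat_mult)
    moreover have "int (s * I) + int (s * J) = int (s * (I + J))" by (simp add: algebra_simps)
    ultimately have 2: "\<bar>a * int i + b * int j\<bar> \<le> int (s * (I + J))" "\<bar>b * int i + c * int j\<bar> \<le> int (s * (I + J))"
      by linarith+
    show "lau (s * (I + J + 1) ^ 2) (s * (I + J)) (s * (I + J)) (\<lambda>n k. qp ((a * tri (int i) + b * int (i * j)
      + c * tri (int j) + d * int i + e * int j) + (a * int i + b * int j) * n + (b * int i + c * int j) * k))"
      by (rule lau_qp[OF 1 2])
    fix n k
    show "qp (qf q (n + int i) (k + int j)) = qp (qf q n k) * qp ((a * tri (int i) + b * int (i * j)
      + c * tri (int j) + d * int i + e * int j) + (a * int i + b * int j) * n + (b * int i + c * int j) * k)"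
      by (simp add: q tri_add qp_add[symmetric] algebra_simps)
  qed
qed

lemma tame_hterm:
  assumes len: "length ns \<le> s" "length ds \<le> s"
    and bd: "\<And>l. l \<in> set ns \<union> set ds \<Longrightarrow> lf_bounded s l" "qf_bounded s q"
    and w: "s * (I + J) \<le> w"
    and ns: "\<And>l. l \<in> set ns \<Longrightarrow> (\<exists>v. \<bar>v\<bar> + int w \<le> int V \<and> (\<forall>(n, k)\<in>C. lf l n k = v)) \<or> (\<forall>(n, k)\<in>C. int w \<le> lf l n k)"
    and ds: "\<And>l n k. l \<in> set ds \<Longrightarrow> (n, k) \<in> C \<Longrightarrow> - int w \<le> lf l n k"
  shows "tame C I J (s * (V * V + 2 * w * (w + s)) + s * (2 * w * (w + s)) + s * (I + J + 1) ^ 2)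
     (s * (2 * w * s) + s * (2 * w * s) + w) (s * (2 * w * s) + s * (2 * w * s) + w) (hterm ns ds q)"
proof -
  have "tame C I J (V * V + 2 * w * (w + s)) (2 * w * s) (2 * w * s) (\<lambda>n k. qfac (lf l n k))"
    if l: "l \<in> set ns" for l
    using ns[OF l]
  proof
    assume "\<exists>v. \<bar>v\<bar> + int w \<le> int V \<and> (\<forall>(n, k)\<in>C. lf l n k = v)"
    then obtain v where v: "\<bar>v\<bar> + int w \<le> int V" "\<And>n k. (n, k) \<in> C \<Longrightarrow> lf l n k = v" by auto
    have "tame C I J (V * V) (2 * w * s) (2 * w * s) (\<lambda>n k. qfac (lf l n k))"
      by (rule tame_qfac_const[OF _ w v(2) v(1)]) (use l bd in auto)
    thus ?thesis by (rule tame_mono) auto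
  next
    assume "\<forall>(n, k)\<in>C. int w \<le> lf l n k"
    hence "tame C I J (2 * w * (w + s)) (2 * w * s) (2 * w * s) (\<lambda>n k. qfac (lf l n k))"
      using l bd by (intro tame_qfac w) auto
    thus ?thesis by (rule tame_mono) auto
  qed
  hence 1: "tame C I J (s * (V * V + 2 * w * (w + s))) (s * (2 * w * s)) (s * (2 * w * s)) (\<lambda>n k. \<Prod>l\<leftarrow>ns. qfac (lf l n k))"
    by (rule tame_prod_list[OF _ len(1)])
  have 2: "tame C I J (s * (2 * w * (w + s))) (s * (2 * w * s)) (s * (2 * w * s)) (\<lambda>n k. \<Prod>l\<leftarrow>ds. inverse (qfac (lf l n k)))"
    by (rule tame_prod_list[OF tame_inverse_qfac[OF _ w ds] len(2)]) (use bd in auto)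
  have 3: "tame C I J (s * (I + J + 1) ^ 2) w w (\<lambda>n k. qp (qf q n k))"
    by (rule tame_mono[OF tame_qp_qf[OF bd(2)]]) (use w in auto)
  show ?thesis
    unfolding hterm_def[abs_def] by (rule tame_mult[OF tame_mult[OF 1 2] 3])
qed

section \<open>Operators in the shift of n\<close>

definition cube :: "nat \<Rightarrow> (nat \<times> nat \<times> nat) set" where
  "cube s = {..s} \<times> {..s} \<times> {..s}"

lemma finite_cube [simp]: "finite (cube s)" by (simp add: cube_def)

text \<open>The operator \<open>\<Sum> \<epsilon>(h,a,i) q\<^sup>h (q\<^sup>n)\<^sup>a N\<^sup>i\<close> applied to \<open>c\<close>, where \<open>N\<close> is the shift of \<open>n\<close>.\<close>

definition nop :: "nat \<Rightarrow> (nat \<times> nat \<times> nat \<Rightarrow> rat) \<Rightarrow> (int \<Rightarrow> int \<Rightarrow> ratq) \<Rightarrow> int \<Rightarrow> int \<Rightarrow> ratq" where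
  "nop s \<epsilon> c n k = (\<Sum>(h, a, i)\<in>cube s. of_rat (\<epsilon> (h, a, i)) * qp (int h + int a * n) * c (n + int i) k)"

text \<open>Shifts of the new function are combinations of shifts of \<open>c\<close> of order up to
  \<open>I + s\<close>, hence multiples of the same base; the powers of q^n in the operator only
  raise degrees.\<close>

lemma tame_nop:
  assumes "tame C (I + s) J G E F c"
  shows "tame C I J (s + s * I + G) (s + E) F (nop s \<epsilon> c)"
proof -
  from assms obtain b \<kappa> where 1: "\<And>i j. i \<le> I + s \<Longrightarrow> j \<le> J \<Longrightarrow> lau G E F (\<kappa> i j)"
    "\<And>i j n k. i \<le> I + s \<Longrightarrow> j \<le> J \<Longrightarrow> (n, k) \<in> C \<Longrightarrow> c (n + int i) (k + int j) = b n k * \<kappa> i j n k"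
    by (rule tameE) blast
  show ?thesis
  proof (rule tameI[where base = b and \<kappa> = "\<lambda>i j n k. \<Sum>x\<in>cube s. case x of (h, a, i') \<Rightarrow>
      of_rat (\<epsilon> (h, a, i')) * (qp ((int h + int a * int i) + int a * n + 0 * k) * \<kappa> (i + i') j n k)"])
    fix i j assume ij: "i \<le> I" "j \<le> J"
    show "lau (s + s * I + G) (s + E) F (\<lambda>n k. \<Sum>x\<in>cube s. case x of (h, a, i') \<Rightarrow>
      of_rat (\<epsilon> (h, a, i')) * (qp ((int h + int a * int i) + int a * n + 0 * k) * \<kappa> (i + i') j n k))"
    proof (rule lau_sum)
      fix x assume x: "x \<in> cube s"
      obtain h a i' where x': "x = (h, a, i')" by (cases x) auto
      have hai: "h \<le> s" "a \<le> s" "i' \<le> s" using x x' by (auto simp: cube_def)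
      have "h + a * i \<le> s + s * I" using hai ij by (intro add_mono mult_mono) auto
      hence "\<bar>int h + int a * int i\<bar> \<le> int (s + s * I)" by (simp flip: of_nat_mult of_nat_add)
      hence "lau (s + s * I) s 0 (\<lambda>n k. qp ((int h + int a * int i) + int a * n + 0 * k))"
        using hai by (intro lau_qp) auto
      from lau_smult[OF lau_mult[OF this 1(1)[of "i + i'" j]]] hai ij
      show "lau (s + s * I + G) (s + E) F (\<lambda>n k. case x of (h, a, i') \<Rightarrow>
         of_rat (\<epsilon> (h, a, i')) * (qp ((int h + int a * int i) + int a * n + 0 * k) * \<kappa> (i + i') j n k))"
        by (simp add: x')
    qed
    fix n k assume nk: "(n, k) \<in> C"
    show "nop s \<epsilon> c (n + int i) (k + int j) = b n k * (\<Sum>x\<in>cube s. case x of (h, a, i') \<Rightarrow>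
      of_rat (\<epsilon> (h, a, i')) * (qp ((int h + int a * int i) + int a * n + 0 * k) * \<kappa> (i + i') j n k))"
      unfolding nop_def sum_distrib_left
    proof (intro sum.cong refl)
      fix x assume x: "x \<in> cube s"
      obtain h a i' where x': "x = (h, a, i')" by (cases x) auto
      have "i' \<le> s" using x x' by (auto simp: cube_def)
      hence "c (n + int i + int i') (k + int j) = b n k * \<kappa> (i + i') j n k"
        using 1(2)[of "i + i'" j n k] ij nk by (simp add: add.assoc)
      thus "(case x of (h, a, i') \<Rightarrow> of_rat (\<epsilon> (h, a, i')) * qp (int h + int a * (n + int i)) *
              c (n + int i + int i') (k + int j)) = b n k * (case x of (h, a, i') \<Rightarrow>
         of_rat (\<epsilon> (h, a, i')) * (qp ((int h + int a * int i) + int a * n + 0 * k) * \<kappa> (i + i') j n k))"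
        by (simp add: x' algebra_simps)
    qed
  qed
qed

section \<open>Shifts of solutions of an equation\<close>

definition solves :: "nat \<Rightarrow> (nat \<Rightarrow> int \<Rightarrow> ratq) \<Rightarrow> (nat \<Rightarrow> ratq) \<Rightarrow> bool" where
  "solves d b u \<longleftrightarrow> (\<forall>k. (\<Sum>i\<le>d. b i (int k) * u (k + i)) = 0)"

text \<open>The equation expresses every value through \<open>d\<close> consecutive ones. The
  product of shifted leading coefficients clears all divisions, with one multiplier for all
  \<open>j\<close>; shifting the factors makes the degree in q grow quadratically in
  \<open>J\<close>, that in q^k only linearly.\<close>

lemma solves_shift_reduction:
  assumes b: "\<And>i. i \<le> d \<Longrightarrow> lau s 0 s (\<lambda>n k. b i k)"
  shows "lau (s * (J + 1) * (J + 2)) 0 (s * (J + 1)) (\<lambda>n k. \<Prod>u\<le>J. b d (k + int u)) \<and>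
    (\<exists>\<Gamma>. (\<forall>j\<le>J. \<forall>t<d. lau (s * (J + 1) * (J + 2)) 0 (s * (J + 1)) (\<lambda>n k. \<Gamma> j t k)) \<and>
      (\<forall>u. solves d b u \<longrightarrow> (\<forall>j\<le>J. \<forall>k. (\<Prod>v\<le>J. b d (int k + int v)) * u (k + j)
         = (\<Sum>t<d. \<Gamma> j t (int k) * u (k + t)))))"
proof (induction J)
  case 0
  have l: "lau (s * (0 + 1) * (0 + 2)) 0 (s * (0 + 1)) (\<lambda>n k. \<Prod>u\<le>0. b d (k + int u))"
    using lau_mono[OF b[of d], of "s + s" 0 s] by simp
  define \<Gamma> where "\<Gamma> j t k = (if t = 0 then b d k else 0)" for j t :: nat and k :: int
  show ?case
  proof (intro conjI exI[of _ \<Gamma>] allI impI)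
    fix j t assume "j \<le> (0::nat)" "t < d"
    show "lau (s * (0 + 1) * (0 + 2)) 0 (s * (0 + 1)) (\<lambda>n k. \<Gamma> j t k)"
      using l by (cases "t = 0") (simp_all add: \<Gamma>_def lau_zero)
  next
    fix u j k assume u: "solves d b u" and "j \<le> (0::nat)"
    show "(\<Prod>v\<le>0. b d (int k + int v)) * u (k + j) = (\<Sum>t<d. \<Gamma> j t (int k) * u (k + t))"
    proof (cases d)
      case 0
      thus ?thesis using u \<open>j \<le> 0\<close> by (auto simp: solves_def)
    next
      case (Suc e)
      thus ?thesis using \<open>j \<le> 0\<close> by (simp add: \<Gamma>_def if_distrib[of "\<lambda>x. x * _"] cong: if_cong)
    qed
  qed (rule l)
next
  case (Suc J)
  let ?G = "s * (J + 1) * (J + 2)" let ?F = "s * (J + 1)"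
  let ?G' = "s * (Suc J + 1) * (Suc J + 2)" let ?F' = "s * (Suc J + 1)"
  define B where "B J k = (\<Prod>u\<le>J. b d (k + int u))" for J k
  have B_Suc: "B (Suc J) k = b d k * B J (k + 1)" for k
    unfolding B_def by (subst prod.atMost_Suc_shift) (simp add: add.assoc add.commute[of 1])
  from Suc.IH have lB: "lau ?G 0 ?F (\<lambda>n k. B J k)" by (simp add: B_def)
  from Suc.IH obtain \<Gamma> where \<Gamma>: "\<And>j t. j \<le> J \<Longrightarrow> t < d \<Longrightarrow> lau ?G 0 ?F (\<lambda>n k. \<Gamma> j t k)"
    "\<And>u j k. solves d b u \<Longrightarrow> j \<le> J \<Longrightarrow> B J (int k) * u (k + j) = (\<Sum>t<d. \<Gamma> j t (int k) * u (k + t))"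
    unfolding B_def by blast
  have step: "lau ?G' 0 ?F' (\<lambda>n k. b i k * \<phi> (k + 1))" if "lau ?G 0 ?F (\<lambda>n k. \<phi> k)" "i \<le> d" for \<phi> i
  proof -
    have "lau (?G + 0 * 0 + ?F * 1) 0 ?F (\<lambda>n k. \<phi> (k + int 1))" by (rule lau_shift[OF that(1)])
    from lau_mult[OF b[OF that(2)] this, unfolded of_nat_1] show ?thesis
      by (rule lau_mono) (simp_all add: algebra_simps)
  qed
  have l: "lau ?G' 0 ?F' (\<lambda>n k. B (Suc J) k)" unfolding B_Suc by (rule step[OF lB]) simp
  \<comment> \<open>The reduction at \<open>k + 1\<close> ends in the values at
    \<open>k + 1, ..., k + d\<close>. The last is replaced through the equation at \<open>k\<close>,
    at the price of a factor \<open>b d k\<close>; the others move by one index.\<close>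
  define \<Gamma>' where "\<Gamma>' j t k = (if j = 0 then (if t = 0 then B (Suc J) k else 0)
     else b d k * (if t = 0 then 0 else \<Gamma> (j - 1) (t - 1) (k + 1)) - b t k * \<Gamma> (j - 1) (d - 1) (k + 1))" for j t k
  have "\<exists>\<Gamma>. (\<forall>j\<le>Suc J. \<forall>t<d. lau ?G' 0 ?F' (\<lambda>n k. \<Gamma> j t k)) \<and>
      (\<forall>u. solves d b u \<longrightarrow> (\<forall>j\<le>Suc J. \<forall>k. B (Suc J) (int k) * u (k + j) = (\<Sum>t<d. \<Gamma> j t (int k) * u (k + t))))"
  proof (intro conjI exI[of _ \<Gamma>'] allI impI)
    fix j t assume jt: "j \<le> Suc J" "t < d"
    show "lau ?G' 0 ?F' (\<lambda>n k. \<Gamma>' j t k)"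
    proof (cases "j = 0")
      case True thus ?thesis using l by (cases "t = 0") (simp_all add: \<Gamma>'_def lau_zero)
    next
      case False
      have 1: "lau ?G' 0 ?F' (\<lambda>n k. b d k * (if t = 0 then 0 else \<Gamma> (j - 1) (t - 1) (k + 1)))"
      proof (cases "t = 0")
        case True thus ?thesis by (simp add: lau_zero)
      next
        case t: False
        show ?thesis using step[OF \<Gamma>(1)[of "j - 1" "t - 1"], of d] False t jt by simp
      qed
      have 2: "lau ?G' 0 ?F' (\<lambda>n k. b t k * \<Gamma> (j - 1) (d - 1) (k + 1))"
        using step[OF \<Gamma>(1)[of "j - 1" "d - 1"], of t] False jt by auto
      from lau_add[OF 1 lau_uminus[OF 2]] show ?thesis using False by (simp add: \<Gamma>'_def)
    qed
  next
    fix u j k assume u: "solves d b u" and j: "j \<le> Suc J"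
    have eq: "(\<Sum>i\<le>d. b i (int k) * u (k + i)) = 0" using u by (simp add: solves_def)
    show "B (Suc J) (int k) * u (k + j) = (\<Sum>t<d. \<Gamma>' j t (int k) * u (k + t))"
    proof (cases j)
      case 0
      show ?thesis
      proof (cases d)
        case [simp]: 0
        show ?thesis using eq by (auto simp: B_Suc \<open>j = 0\<close>)
      next
        case (Suc e)
        thus ?thesis using \<open>j = 0\<close> by (simp add: \<Gamma>'_def if_distrib[of "\<lambda>x. x * _"] cong: if_cong)
      qed
    next
      case [simp]: (Suc j')
      have "B (Suc J) (int k) * u (k + j) = b d (int k) * (B J (int (Suc k)) * u (Suc k + j'))"
        by (simp add: B_Suc algebra_simps)
      also have "\<dots> = b d (int k) * (\<Sum>t<d. \<Gamma> j' t (int k + 1) * u (Suc k + t))"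
        using \<Gamma>(2)[OF u, of j' "Suc k"] j by (simp add: add.commute)
      also have "\<dots> = (\<Sum>t<d. \<Gamma>' j t (int k) * u (k + t))"
      proof (cases d)
        case [simp]: (Suc e)
        have bd: "b d (int k) * u (k + d) = - (\<Sum>i<d. b i (int k) * u (k + i))"
          using eq by (simp add: lessThan_Suc_atMost[symmetric] add_eq_0_iff2 del: sum.lessThan_Suc)
             (simp add: add_eq_0_iff)
        have "b d (int k) * (\<Sum>t<d. \<Gamma> j' t (int k + 1) * u (Suc k + t))
          = b d (int k) * (\<Sum>t<e. \<Gamma> j' t (int k + 1) * u (k + Suc t)) + \<Gamma> j' e (int k + 1) * (b d (int k) * u (k + d))"
          by (simp add: algebra_simps)
        also have "\<dots> = (\<Sum>t<e. b d (int k) * \<Gamma> j' t (int k + 1) * u (k + Suc t))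
           - (\<Sum>t<d. b t (int k) * \<Gamma> j' e (int k + 1) * u (k + t))"
          unfolding bd by (simp add: sum_distrib_left algebra_simps)
        also have "(\<Sum>t<e. b d (int k) * \<Gamma> j' t (int k + 1) * u (k + Suc t))
          = (\<Sum>t<d. b d (int k) * (if t = 0 then 0 else \<Gamma> j' (t - 1) (int k + 1)) * u (k + t))"
          unfolding Suc by (subst sum.lessThan_Suc_shift) simp
        also have "\<dots> - (\<Sum>t<d. b t (int k) * \<Gamma> j' e (int k + 1) * u (k + t))
          = (\<Sum>t<d. \<Gamma>' j t (int k) * u (k + t))"
          unfolding sum_subtractf[symmetric] by (intro sum.cong refl) (simp add: \<Gamma>'_def algebra_simps)
        finally show ?thesis .
      qed simp
      finally show ?thesis .
    qed
  qed
  with l show ?case unfolding B_def by blast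
qed

text \<open>
  The unknown operator has order \<open>I\<close> in \<open>n\<close> and \<open>J\<close> in \<open>k\<close>, and degrees \<open>X\<close> in \<open>q\<^sup>n\<close> and \<open>H\<close> in \<open>q\<close>; its shifts
  change a linear form by at most \<open>w\<close>. The number of unknowns grows like \<open>H X I J\<close>, but the number of
  conditions only like \<open>H X (s\<^sup>4 (I + J) + s J\<^sup>2)\<close>, so \<open>J\<close>, \<open>I\<close>, \<open>X\<close>, \<open>H\<close> are chosen large in this order.
\<close>

definition par_J :: "nat \<Rightarrow> nat" where "par_J s = 1216 * s ^ 4"
definition par_I :: "nat \<Rightarrow> nat" where "par_I s = 96 * s * (par_J s + s)"
text \<open>Bounds the change of a form under shifts by at most \<open>I + s\<close> in n, those of
  the operator included, and \<open>J\<close> in k.\<close>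

definition par_w :: "nat \<Rightarrow> nat" where "par_w s = s * (par_I s + par_J s + s + 1)"
text \<open>Bounds \<open>\<bar>v\<bar> + w\<close> for the value \<open>v\<close> of a numerator
  form that is constant on a class of points, as in \<open>tame_line\<close>.\<close>

definition par_V :: "nat \<Rightarrow> nat" where "par_V s = s * par_w s + 2 * s * s + par_w s"
text \<open>From here on, two forms that are not parallel cannot both be at most \<open>w\<close> in
  absolute value; see \<open>parallel\<close>.\<close>

definition par_n0 :: "nat \<Rightarrow> nat" where "par_n0 s = 2 * s * par_w s + 2 * s * s + 1"
definition par_G :: "nat \<Rightarrow> nat" where
  "par_G s = s + s * par_I s + (s * (par_V s * par_V s + 2 * par_w s * (par_w s + s)) +
     s * (2 * par_w s * (par_w s + s)) + s * (par_I s + s + par_J s + 1) ^ 2)"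
definition par_F :: "nat \<Rightarrow> nat" where
  "par_F s = s * (2 * par_w s * s) + s * (2 * par_w s * s) + par_w s"
definition par_F1 :: "nat \<Rightarrow> nat" where "par_F1 s = par_F s + s * (par_J s + 1)"
text \<open>\<open>par_X\<close> and \<open>par_H\<close> equal the growth of the degrees in q^n and
  q caused by the term, by the reduction of shifts and by the restriction to lines. Together with
  the degrees of the operator this gives exactly \<open>2 * X\<close> and
  \<open>2 * H\<close>.\<close>

definition par_X :: "nat \<Rightarrow> nat" where "par_X s = s + par_F s + par_F1 s * s"
definition par_H :: "nat \<Rightarrow> nat" where
  "par_H s = par_G s + s * (par_J s + 1) * (par_J s + 2) + par_F1 s * (par_w s + s)"

text \<open>The factor 16 compares boxes with \<open>(4 * H + 1) * (4 * X + 1)\<close> exponents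
  with the \<open>(H + 1) * (X + 1)\<close> degrees of the unknowns. The first two summands are at
  most \<open>19 * s ^ 3 * w\<close>, where \<open>w\<close> is at most \<open>2 * s * I\<close>;
  \<open>J = 1216 * s ^ 4\<close>, with 1216 = 2 * 16 * 19 * 2, keeps them below half of the right
  side. The third is kept below the other half by \<open>I = 96 * s * (J + s)\<close>, with 96 = 2 *
  16 * 3.\<close>

lemma par_count:
  assumes s: "s \<ge> 1"
  shows "16 * (s * (2 * par_F1 s + 1) + 2 * s ^ 2 * par_w s * (2 * s + 1) + (par_J s + s) * (par_J s + 1) * (2 * s + 1))
     < (par_I s + 1) * (par_J s + 1)"
proof -
  let ?J = "par_J s" and ?I = "par_I s" and ?w = "par_w s"
  have J1: "?J \<ge> 1" using s by (simp add: par_J_def)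
  define P where "P = s * (?J + s)"
  have "1 * (?J + s) \<le> P" unfolding P_def using s by (intro mult_le_mono) auto
  moreover have "?I = 96 * P" by (simp add: P_def par_I_def)
  ultimately have "?J + s + 1 \<le> ?I" using J1 s by simp
  hence "?I + ?J + s + 1 \<le> 2 * ?I" by simp
  hence w: "?w \<le> s * (2 * ?I)" unfolding par_w_def by (intro mult_le_mono) auto
  have pw: "s \<le> s ^ 2" "1 \<le> s ^ 2" "s^2 \<le> s ^ 3" "1 \<le> s ^ 3" using s by (auto simp: power2_eq_square power3_eq_cube)
  have "s * (?J + 1) \<le> ?w" unfolding par_w_def by (intro mult_le_mono) auto
  hence F1: "par_F1 s \<le> 4 * (s ^ 2 * ?w) + 2 * ?w"
    unfolding par_F1_def par_F_def by (simp add: power2_eq_square)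
  have "1 * ?w \<le> s ^ 2 * ?w" using pw by (intro mult_le_mono) auto
  hence "?w \<le> s ^ 2 * ?w" by (simp only: mult_1)
  with F1 have F1': "par_F1 s \<le> 6 * (s ^ 2 * ?w)" by linarith
  have "s \<le> ?w" unfolding par_w_def by simp
  hence "1 \<le> ?w" using s by simp
  hence "1 * 1 \<le> s ^ 2 * ?w" using pw by (intro mult_le_mono) auto
  hence "1 \<le> s ^ 2 * ?w" by (simp only: mult_1)
  with F1' have "2 * par_F1 s + 1 \<le> 13 * (s ^ 2 * ?w)" by linarith
  hence "s * (2 * par_F1 s + 1) \<le> s * (13 * (s ^ 2 * ?w))" by (rule mult_le_mono2)
  hence a: "s * (2 * par_F1 s + 1) \<le> 13 * (s ^ 3 * ?w)" by (simp add: power2_eq_square power3_eq_cube mult_ac)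
  have "2 * s + 1 \<le> 3 * s" using s by simp
  hence "2 * s ^ 2 * ?w * (2 * s + 1) \<le> 2 * s ^ 2 * ?w * (3 * s)" by (rule mult_le_mono2)
  hence b: "2 * s ^ 2 * ?w * (2 * s + 1) \<le> 6 * (s ^ 3 * ?w)" by (simp add: power2_eq_square power3_eq_cube mult_ac)
  have "s ^ 3 * ?w \<le> s ^ 3 * (s * (2 * ?I))" using w by (rule mult_le_mono2)
  also have "\<dots> = 2 * (s ^ 4 * ?I)" by (simp add: eval_nat_numeral mult_ac)
  finally have "16 * (19 * (s ^ 3 * ?w)) \<le> 608 * (s ^ 4 * ?I)" by linarith
  moreover have "2 * (608 * (s ^ 4 * ?I)) = ?I * ?J" by (simp add: par_J_def)
  ultimately have c: "2 * (16 * (19 * (s ^ 3 * ?w))) \<le> ?I * ?J" by linarith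
  have "(?J + s) * (?J + 1) * (2 * s + 1) \<le> (?J + s) * (?J + 1) * (3 * s)"
    using \<open>2 * s + 1 \<le> 3 * s\<close> by (rule mult_le_mono2)
  moreover have "2 * (16 * ((?J + s) * (?J + 1) * (3 * s))) = ?I * (?J + 1)"
    by (simp add: par_I_def algebra_simps)
  ultimately have d: "2 * (16 * ((?J + s) * (?J + 1) * (2 * s + 1))) \<le> ?I * (?J + 1)" by linarith
  have "2 * (16 * (s * (2 * par_F1 s + 1) + 2 * s ^ 2 * ?w * (2 * s + 1) + (?J + s) * (?J + 1) * (2 * s + 1)))
     \<le> ?I * ?J + ?I * (?J + 1)"
  proof -
    have "2 * (16 * (A + B + C)) \<le> K1 + K2"
      if "A \<le> 13 * W" "B \<le> 6 * W" "2 * (16 * (19 * W)) \<le> K1" "2 * (16 * C) \<le> K2" for A B C W K1 K2 :: nat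
    proof -
      have "608 * W \<le> K1" "32 * C \<le> K2" using that(3,4) by simp_all
      with that(1,2) have "32 * A + 32 * B + 32 * C \<le> K1 + K2" by linarith
      thus ?thesis by simp
    qed
    from this[OF a b c d] show ?thesis .
  qed
  also have "?I * ?J + ?I * (?J + 1) < 2 * ((?I + 1) * (?J + 1))" by (simp add: algebra_simps)
  finally show ?thesis by simp
qed

section \<open>Annihilating operators free of \<open>q\<^sup>k\<close>\<close>

text \<open>One number \<open>s\<close> bounds all data, so that every later bound depends on
  \<open>s\<close> alone. The two forms of \<open>support\<close> make the term vanish outside
  \<open>0 <= k <= n\<close>; \<open>\<epsilon>\<close> is the operator to be tested and is
  arbitrary.\<close>

locale summand =
  fixes s d k0 :: nat and ns ds :: "linform list" and q :: qform
    and b :: "nat \<Rightarrow> int \<Rightarrow> ratq" and \<epsilon> :: "nat \<times> nat \<times> nat \<Rightarrow> rat"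
  assumes s1: "s \<ge> 1" and len: "length ns \<le> s" "length ds \<le> s"
    and bounded: "\<And>l. l \<in> set ns \<union> set ds \<Longrightarrow> lf_bounded s l" "qf_bounded s q"
    and support: "(0, 1, 0) \<in> set ns" "(1, -1, 0) \<in> set ns"
    and d: "d \<le> s" and k0: "k0 \<le> s"
    and b: "\<And>i. i \<le> d \<Longrightarrow> lau s 0 s (\<lambda>n k. b i k)"
    and lead: "\<And>k. int k0 \<le> k \<Longrightarrow> b d k \<noteq> 0"
begin

abbreviation "f \<equiv> nop s \<epsilon> (hterm ns ds q)"
abbreviation "I \<equiv> par_I s"
abbreviation "J \<equiv> par_J s"
abbreviation "w \<equiv> par_w s"
abbreviation "n0 \<equiv> par_n0 s"
abbreviation "X \<equiv> par_X s"
abbreviation "H \<equiv> par_H s"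

lemma hterm_zero: "l \<in> set ns \<union> set ds \<Longrightarrow> lf l n k < 0 \<Longrightarrow> hterm ns ds q n k = 0"
proof -
  assume l: "l \<in> set ns \<union> set ds" "lf l n k < 0"
  hence 0: "qfac (lf l n k) = 0" by (simp add: qfac_neg)
  have "(\<Prod>l\<leftarrow>ns. qfac (lf l n k)) = 0 \<or> (\<Prod>l\<leftarrow>ds. inverse (qfac (lf l n k))) = 0"
    using l(1) 0 by (force simp: prod_list_zero_iff)
  thus ?thesis by (auto simp: hterm_def)
qed

lemma shift_le: "\<bar>a\<bar> \<le> int s \<Longrightarrow> \<bar>b'\<bar> \<le> int s \<Longrightarrow> i \<le> I + s \<Longrightarrow> j \<le> J \<Longrightarrow> \<bar>a * int i + b' * int j\<bar> \<le> int w"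
  using lf_shift_bound[of s a b' 0 "I + s" J w i j] by (simp add: par_w_def algebra_simps)

lemma f_zero: "k < 0 \<Longrightarrow> f n k = 0"
  unfolding nop_def by (intro sum.neutral) (auto simp: hterm_zero[of "(0, 1, 0)"] support)

lemma f_zero': "k > n + int s \<Longrightarrow> f n k = 0"
  unfolding nop_def by (intro sum.neutral) (auto simp: cube_def hterm_zero[of "(1, -1, 0)"] support)

lemma f_zero_shift:
  assumes l: "l \<in> set ns \<union> set ds" "lf l n k < - int w" and ij: "i \<le> I" "j \<le> J"
  shows "f (n + int i) (k + int j) = 0"
  unfolding nop_def
proof (intro sum.neutral ballI)
  fix x assume x: "x \<in> cube s"
  obtain h a i' where x': "x = (h, a, i')" by (cases x) auto
  obtain a' b' c' where l': "l = (a', b', c')" by (cases l) auto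
  have "i + i' \<le> I + s" using x x' ij by (auto simp: cube_def)
  hence "\<bar>a' * int (i + i') + b' * int j\<bar> \<le> int w" using bounded(1)[OF l(1)] l' ij by (intro shift_le) auto
  hence "lf l (n + int (i + i')) (k + int j) < 0" using l(2) unfolding l' lf_shift by linarith
  from hterm_zero[OF l(1) this]
  show "(case x of (h, a, i') \<Rightarrow> of_rat (\<epsilon> (h, a, i')) * qp (int h + int a * (n + int i)) *
      hterm ns ds q (n + int i + int i') (k + int j)) = 0" by (simp add: x' add.assoc)
qed

text \<open>
  Away from \<open>pts\<close>, all shifts of the summand vanish for large \<open>n\<close>. On \<open>generic\<close>, no numerator factor
  changes between zero and nonzero; otherwise such a factor is close to its boundary, and the point
  lies on one of finitely many lines parallel to it.
\<close>

definition pts :: "(int \<times> int) set" where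
  "pts = {(n, k). int n0 \<le> n \<and> (\<forall>l\<in>set ns \<union> set ds. - int w \<le> lf l n k)}"
definition generic :: "(int \<times> int) set" where
  "generic = {(n, k)\<in>pts. \<forall>(a, b, c)\<in>set ns. (a, b) \<noteq> (0, 0) \<longrightarrow> int w \<le> lf (a, b, c) n k}"
definition line :: "linform \<Rightarrow> int \<Rightarrow> (int \<times> int) set" where
  "line l \<tau> = {(n, k)\<in>pts. lf l n k = \<tau>}"

lemma tame_f:
  assumes ns: "\<And>l. l \<in> set ns \<Longrightarrow> (\<exists>v. \<bar>v\<bar> + int w \<le> int (par_V s) \<and> (\<forall>(n, k)\<in>C. lf l n k = v)) \<or> (\<forall>(n, k)\<in>C. int w \<le> lf l n k)"
    and C: "C \<subseteq> pts"
  shows "tame C I J (par_G s) (s + par_F s) (par_F s) f"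
proof -
  have "s * (I + s + J) \<le> w" unfolding par_w_def by (intro mult_le_mono) auto
  moreover have "\<And>l n k. l \<in> set ds \<Longrightarrow> (n, k) \<in> C \<Longrightarrow> - int w \<le> lf l n k"
    using C by (auto simp: pts_def)
  ultimately show ?thesis
    unfolding par_G_def par_F_def by (intro tame_nop tame_hterm len bounded ns)
qed

lemma tame_generic: "tame generic I J (par_G s) (s + par_F s) (par_F s) f"
proof (rule tame_f)
  fix l assume l: "l \<in> set ns"
  obtain a b c where abc: "l = (a, b, c)" by (cases l) auto
  show "(\<exists>v. \<bar>v\<bar> + int w \<le> int (par_V s) \<and> (\<forall>(n, k)\<in>generic. lf l n k = v)) \<or> (\<forall>(n, k)\<in>generic. int w \<le> lf l n k)"
  proof (cases "(a, b) = (0, 0)")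
    case True
    have "\<bar>c\<bar> \<le> int s" "int s \<le> int (2 * s * s)" using bounded(1)[of l] l s1 by (auto simp: abc)
    moreover have "0 \<le> int (s * w)" by simp
    ultimately have "\<bar>c\<bar> + int w \<le> int (par_V s)" unfolding par_V_def of_nat_add by linarith
    thus ?thesis using True by (auto simp: abc)
  next
    case False
    thus ?thesis using l by (auto simp: generic_def abc)
  qed
qed (auto simp: generic_def)

text \<open>By Cramer's rule, two independent forms determine \<open>n\<close>; small values of both
  would force \<open>n\<close> below \<open>n0\<close>.\<close>

lemma parallel:
  assumes l: "lf_bounded s (a, b', c)" "lf_bounded s (a', b'', c')" and n: "int n0 \<le> n"
    and small: "\<bar>lf (a, b', c) n k\<bar> \<le> int w" "\<bar>lf (a', b'', c') n k\<bar> \<le> int w"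
  shows "a * b'' = a' * b'"
proof (rule ccontr)
  assume "a * b'' \<noteq> a' * b'"
  hence "1 \<le> \<bar>a * b'' - a' * b'\<bar>" by simp
  hence "1 * n \<le> \<bar>a * b'' - a' * b'\<bar> * n" using n by (intro mult_right_mono) auto
  also have "\<dots> = \<bar>(a * b'' - a' * b') * n\<bar>" using n by (simp add: abs_mult)
  also have "(a * b'' - a' * b') * n
     = b'' * lf (a, b', c) n k - b' * lf (a', b'', c') n k - (b'' * c - b' * c')"
    by (simp add: algebra_simps)
  finally have "n \<le> \<bar>b'' * lf (a, b', c) n k - b' * lf (a', b'', c') n k - (b'' * c - b' * c')\<bar>" by simp
  moreover have "\<bar>b'' * lf (a, b', c) n k\<bar> \<le> int s * int w" "\<bar>b' * lf (a', b'', c') n k\<bar> \<le> int s * int w"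
    "\<bar>b'' * c\<bar> \<le> int s * int s" "\<bar>b' * c'\<bar> \<le> int s * int s"
    unfolding abs_mult using l small by (auto intro!: mult_mono simp del: lf.simps)
  ultimately have "n \<le> 2 * (int s * int w) + 2 * (int s * int s)" by linarith
  thus False using n by (simp add: par_n0_def mult.assoc)
qed

text \<open>A numerator form parallel to the line is constant on it; any other is at least
  \<open>w\<close> there by \<open>parallel\<close>. No factor changes its behaviour along the
  line.\<close>

lemma tame_line:
  assumes l: "lf_bounded s l" "fst (snd l) \<noteq> 0" and \<tau>: "\<bar>\<tau>\<bar> \<le> int w"
  shows "tame (line l \<tau>) I J (par_G s) (s + par_F s) (par_F s) f"
proof (rule tame_f)
  fix l' assume l': "l' \<in> set ns"
  obtain a b' c where abc: "l = (a, b', c)" by (cases l) auto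
  obtain a' b'' c' where abc': "l' = (a', b'', c')" by (cases l') auto
  have bd': "lf_bounded s l'" using bounded(1) l' by blast
  show "(\<exists>v. \<bar>v\<bar> + int w \<le> int (par_V s) \<and> (\<forall>(n, k)\<in>line l \<tau>. lf l' n k = v)) \<or> (\<forall>(n, k)\<in>line l \<tau>. int w \<le> lf l' n k)"
  proof (cases "a * b'' = a' * b'")
    case par: True
    have b': "b' \<noteq> 0" using l by (simp add: abc)
    have *: "b' * lf l' n k = b'' * \<tau> - b'' * c + b' * c'" if "(n, k) \<in> line l \<tau>" for n k
    proof -
      have "\<tau> = a * n + b' * k + c" using that by (auto simp: line_def abc)
      hence "b'' * \<tau> - b'' * c + b' * c' = (a * b'') * n + b' * b'' * k + b' * c'" by (simp add: algebra_simps)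
      thus ?thesis unfolding par by (simp add: abc' algebra_simps)
    qed
    show ?thesis
    proof (cases "line l \<tau> = {}")
      case False
      then obtain n1 k1 where p: "(n1, k1) \<in> line l \<tau>" by auto
      define v where "v = lf l' n1 k1"
      have "lf l' n k = v" if "(n, k) \<in> line l \<tau>" for n k
      proof -
        have "b' * lf l' n k = b' * v" unfolding v_def *[OF that] *[OF p] ..
        thus ?thesis using b' by simp
      qed
      moreover have "\<bar>v\<bar> + int w \<le> int (par_V s)"
      proof -
        have "1 * \<bar>v\<bar> \<le> \<bar>b'\<bar> * \<bar>v\<bar>" using b' by (intro mult_right_mono) auto
        hence "\<bar>v\<bar> \<le> \<bar>b'' * \<tau> - b'' * c + b' * c'\<bar>"
          using *[OF p] by (simp add: abs_mult[symmetric] v_def)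
        moreover have "\<bar>b'' * \<tau>\<bar> \<le> int s * int w" "\<bar>b'' * c\<bar> \<le> int s * int s" "\<bar>b' * c'\<bar> \<le> int s * int s"
          unfolding abs_mult using l \<tau> bd' abc abc' by (auto intro!: mult_mono)
        ultimately have "\<bar>v\<bar> \<le> int s * int w + 2 * (int s * int s)" by linarith
        thus ?thesis by (simp add: par_V_def mult.assoc)
      qed
      ultimately show ?thesis by blast
    qed auto
  next
    case False
    have "int w \<le> lf l' n k" if p: "(n, k) \<in> line l \<tau>" for n k
    proof (rule ccontr)
      assume "\<not> int w \<le> lf l' n k"
      moreover have "- int w \<le> lf l' n k" "lf l n k = \<tau>" "int n0 \<le> n"
        using p l' by (auto simp: line_def pts_def)
      ultimately have "a * b'' = a' * b'" using l bd' \<tau> unfolding abc abc'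
        by (intro parallel[of a b' c a' b'' c' n k]) auto
      with False show False by simp
    qed
    thus ?thesis by auto
  qed
qed (auto simp: line_def)

section \<open>Unknowns and conditions of the linear system\<close>

definition unk :: "(nat \<times> nat \<times> nat \<times> nat) set" where
  "unk = {..H} \<times> {..X} \<times> {..I} \<times> {..J}"

lemma finite_unk [simp]: "finite unk" by (simp add: unk_def)
lemma card_unk: "card unk = (H + 1) * (X + 1) * ((I + 1) * (J + 1))"
  by (simp only: unk_def card_cartesian_product card_atMost Suc_eq_plus1 mult.assoc)

definition cls :: "nat \<times> linform \<times> int \<Rightarrow> (int \<times> int) set" where
  "cls x = (case x of (g, l, \<tau>) \<Rightarrow> if g = 0 then generic else line l \<tau>)"

text \<open>
  The three kinds of conditions: at generic points and on the lines of \<open>idx1\<close>, all shifts of the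
  solution reduce to \<open>d\<close> consecutive values; on the lines \<open>k = const\<close> of \<open>idx2\<close>, where the leading
  coefficient may vanish, the \<open>J + 1\<close> shifts are treated as independent.
\<close>

definition idx0 :: "((nat \<times> linform \<times> int) \<times> nat) set" where
  "idx0 = {(0, (0, 0, 0), 0)} \<times> {..<d}"
definition idx1 :: "((nat \<times> linform \<times> int) \<times> nat) set" where
  "idx1 = ({1} \<times> {l\<in>set ns. fst (snd l) \<noteq> 0} \<times> {- int w..<int w}) \<times> {..<d}"
definition idx2 :: "((nat \<times> linform \<times> int) \<times> nat) set" where
  "idx2 = ({2} \<times> {(0, 1, 0)} \<times> {- int J..<int k0}) \<times> {..J}"

lemma finite_idx: "finite idx0" "finite idx1" "finite idx2"
  by (auto simp: idx0_def idx1_def idx2_def)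

lemma card_idx: "card idx0 \<le> s" "card idx1 \<le> 2 * s ^ 2 * w" "card idx2 \<le> (J + s) * (J + 1)"
proof -
  show "card idx0 \<le> s" using d by (simp add: idx0_def card_cartesian_product)
  have "card {l\<in>set ns. fst (snd l) \<noteq> 0} \<le> card (set ns)" by (intro card_mono) auto
  also have "\<dots> \<le> s" using card_length[of ns] len by simp
  finally have 1: "card {l\<in>set ns. fst (snd l) \<noteq> 0} \<le> s" .
  have 2: "card {- int w..<int w} = 2 * w" unfolding card_atLeastLessThan_int by linarith
  have "card idx1 = card {l\<in>set ns. fst (snd l) \<noteq> 0} * (2 * w) * d"
    by (simp only: idx1_def card_cartesian_product 2) simp
  also have "\<dots> \<le> s * (2 * w) * s" using 1 d by (intro mult_le_mono) auto
  finally show "card idx1 \<le> 2 * s ^ 2 * w" by (simp add: power2_eq_square mult_ac)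
  have "nat (int k0 + int J) = k0 + J" by simp
  hence "card idx2 = (k0 + J) * (J + 1)" by (simp add: idx2_def card_cartesian_product)
  also have "\<dots> \<le> (J + s) * (J + 1)" using k0 by (intro mult_le_mono) auto
  finally show "card idx2 \<le> (J + s) * (J + 1)" .
qed

lemma s_le_w: "s \<le> w" "J \<le> w"
proof -
  show "s \<le> w" by (simp add: par_w_def)
  have "1 * J \<le> w" unfolding par_w_def using s1 by (intro mult_le_mono) auto
  thus "J \<le> w" by simp
qed

lemma idx2_line: "(x, t) \<in> idx2 \<Longrightarrow> \<exists>\<tau>. x = (2, (0, 1, 0), \<tau>) \<and> \<bar>\<tau>\<bar> \<le> int w"
  using s_le_w k0 by (auto simp: idx2_def)

lemma tame_cls: "(x, t) \<in> idx0 \<union> idx1 \<union> idx2 \<Longrightarrow> tame (cls x) I J (par_G s) (s + par_F s) (par_F s) f"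
proof -
  assume x: "(x, t) \<in> idx0 \<union> idx1 \<union> idx2"
  then consider "(x, t) \<in> idx0" | "(x, t) \<in> idx1" | "(x, t) \<in> idx2" by blast
  thus ?thesis
  proof cases
    case 1 thus ?thesis by (auto simp: idx0_def cls_def tame_generic)
  next
    case 2
    then obtain l \<tau> where "x = (1, l, \<tau>)" "l \<in> set ns" "fst (snd l) \<noteq> 0" "\<bar>\<tau>\<bar> \<le> int w"
      by (auto simp: idx1_def)
    thus ?thesis by (auto simp: cls_def intro!: tame_line bounded simp del: lf_bounded.simps)
  next
    case 3
    then obtain \<tau> where "x = (2, (0, 1, 0), \<tau>)" "\<bar>\<tau>\<bar> \<le> int w" using idx2_line by blast
    thus ?thesis using s1 by (auto simp: cls_def intro!: tame_line)
  qed
qed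

end

context summand begin

definition fam :: "((nat \<times> linform \<times> int) \<times> nat) set" where
  "fam = idx0 \<union> idx1 \<union> idx2"

text \<open>The degree in q^k cannot be lowered on the generic class, but this class contributes
  only \<open>d\<close> families of conditions; on the many lines it drops to
  \<open>s\<close>.\<close>

definition famF :: "(nat \<times> linform \<times> int) \<times> nat \<Rightarrow> nat" where
  "famF x = (if fst (fst x) = 0 then par_F1 s else s)"

lemma fam_count: "(\<Sum>x\<in>fam. card (box (2 * H) (2 * X) (famF x))) < card unk"
proof -
  have box: "card (box (2 * H) (2 * X) F) \<le> (H + 1) * (X + 1) * (16 * (2 * F + 1))" for F
  proof -
    have "card (box (2 * H) (2 * X) F) \<le> (4 * (H + 1)) * (4 * (X + 1)) * (2 * F + 1)"
      unfolding card_box by (intro mult_le_mono) auto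
    moreover have "4 * (h + 1) * (4 * (x + 1)) * z = (h + 1) * (x + 1) * (16 * z)" for h x z :: nat
      by (simp add: algebra_simps)
    ultimately show ?thesis by (simp only:)
  qed
  let ?HX = "(H + 1) * (X + 1)"
  have part: "(\<Sum>x\<in>A. card (box (2 * H) (2 * X) (famF x))) \<le> ?HX * (16 * (c * (2 * F + 1)))"
    if A: "\<And>x. x \<in> A \<Longrightarrow> famF x = F" "card A \<le> c" for A c F
  proof -
    have "(\<Sum>x\<in>A. card (box (2 * H) (2 * X) (famF x))) \<le> card A * (?HX * (16 * (2 * F + 1)))"
      using sum_bounded_above[of A "\<lambda>x. card (box (2 * H) (2 * X) (famF x))" "?HX * (16 * (2 * F + 1))"] A(1) box
      by simp
    also have "\<dots> \<le> c * (?HX * (16 * (2 * F + 1)))" using A(2) by (rule mult_le_mono1)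
    finally show ?thesis by (simp only: mult_ac)
  qed
  have un: "sum g (A \<union> B) \<le> sum g A + sum g B" if "finite A" "finite B"
    for g :: "(nat \<times> linform \<times> int) \<times> nat \<Rightarrow> nat" and A B
    using sum_Un_nat[OF that, of g] by linarith
  have "(\<Sum>x\<in>fam. card (box (2 * H) (2 * X) (famF x))) \<le>
     (\<Sum>x\<in>idx0. card (box (2 * H) (2 * X) (famF x))) + (\<Sum>x\<in>idx1. card (box (2 * H) (2 * X) (famF x)))
     + (\<Sum>x\<in>idx2. card (box (2 * H) (2 * X) (famF x)))"
    unfolding fam_def using un[of "idx0 \<union> idx1" idx2] un[of idx0 idx1] finite_idx
    by (meson add_le_mono1 finite_UnI le_trans)
  also have "\<dots> \<le> ?HX * (16 * (s * (2 * par_F1 s + 1))) + ?HX * (16 * (2 * s ^ 2 * w * (2 * s + 1)))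
     + ?HX * (16 * ((J + s) * (J + 1) * (2 * s + 1)))"
    by (intro add_le_mono part card_idx) (auto simp: famF_def idx0_def idx1_def idx2_def)
  also have "\<dots> = ?HX * (16 * (s * (2 * par_F1 s + 1) + 2 * s ^ 2 * w * (2 * s + 1) + (J + s) * (J + 1) * (2 * s + 1)))"
    by (simp only: distrib_left)
  also have "\<dots> < ?HX * ((I + 1) * (J + 1))"
    by (rule mult_less_mono2[OF par_count[OF s1]]) simp
  also have "\<dots> = card unk" by (simp only: card_unk)
  finally show ?thesis .
qed

lemma lau_on_cls:
  assumes x: "(x, t) \<in> fam" and \<phi>: "lau (H + par_G s + s * (J + 1) * (J + 2)) (X + s + par_F s) (par_F1 s) \<phi>"
  shows "\<exists>\<psi>. lau (2 * H) (2 * X) (famF (x, t)) \<psi> \<and> (\<forall>(n, k)\<in>cls x. \<phi> n k = \<psi> n k)"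
proof (cases "fst x = 0")
  case True
  have "lau (2 * H) (2 * X) (famF (x, t)) \<phi>"
    by (rule lau_mono[OF \<phi>]) (use True in \<open>auto simp: famF_def par_X_def par_H_def\<close>)
  thus ?thesis by blast
next
  case False
  obtain a b' c \<tau> where x': "x = (fst x, (a, b', c), \<tau>)" by (metis prod.collapse)
  have l: "lf_bounded s (a, b', c)" "b' \<noteq> 0" "\<bar>\<tau>\<bar> \<le> int w"
  proof -
    consider "(x, t) \<in> idx1" | "(x, t) \<in> idx2" using x False by (auto simp: fam_def idx0_def)
    hence "lf_bounded s (a, b', c) \<and> b' \<noteq> 0 \<and> \<bar>\<tau>\<bar> \<le> int w"
    proof cases
      case 1
      hence "(a, b', c) \<in> set ns" "b' \<noteq> 0" "\<bar>\<tau>\<bar> \<le> int w" by (subst (asm) x', auto simp: idx1_def)+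
      thus ?thesis using bounded(1) by blast
    next
      case 2
      from idx2_line[OF this] have "(a, b', c) = (0, 1, 0)" "\<bar>\<tau>\<bar> \<le> int w" by (subst (asm) x', auto)+
      thus ?thesis using s1 by simp
    qed
    thus "lf_bounded s (a, b', c)" "b' \<noteq> 0" "\<bar>\<tau>\<bar> \<le> int w" by auto
  qed
  have "\<exists>\<psi>. lau (H + par_G s + s * (J + 1) * (J + 2) + par_F1 s * (w + s)) (X + s + par_F s + par_F1 s * s) s \<psi>
      \<and> (\<forall>n k. a * n + b' * k = \<tau> - c \<longrightarrow> \<phi> n k = \<psi> n k)"
    by (rule lau_line[OF \<phi>]) (use l in auto)
  then obtain \<psi> where \<psi>0: "lau (H + par_G s + s * (J + 1) * (J + 2) + par_F1 s * (w + s)) (X + s + par_F s + par_F1 s * s) s \<psi>"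
    and \<psi>2: "\<And>n k. a * n + b' * k = \<tau> - c \<Longrightarrow> \<phi> n k = \<psi> n k"
    by blast
  have \<psi>: "lau (2 * H) (2 * X) s \<psi>"
    by (rule lau_mono[OF \<psi>0]) (simp_all add: par_X_def par_H_def)
  have "\<phi> n k = \<psi> n k" if "(n, k) \<in> cls x" for n k
  proof (rule \<psi>2)
    have "lf (a, b', c) n k = \<tau>" using that False unfolding cls_def by (subst (asm) x') (auto simp: line_def)
    thus "a * n + b' * k = \<tau> - c" by simp
  qed
  thus ?thesis using \<psi> False by (auto simp: famF_def)
qed

text \<open>The conditions concern the coefficients of the independent values of \<open>g\<close>,
  never these values, so one \<open>\<alpha>\<close> serves all solutions.\<close>

lemma annihilator:
  obtains \<alpha> where "\<exists>u\<in>unk. \<alpha> u \<noteq> 0"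
    "\<And>g n k. solves d b g \<Longrightarrow> int n0 \<le> n \<Longrightarrow> (\<Sum>(h, a, i, j)\<in>unk. of_rat (\<alpha> (h, a, i, j)) *
       qp (int h + int a * n) * (f (n + int i) (k + int j) * g (nat (k + int j)))) = 0"
proof -
  have "\<forall>x\<in>fst ` fam. \<exists>p. (\<forall>i\<le>I. \<forall>j\<le>J. lau (par_G s) (s + par_F s) (par_F s) (snd p i j)) \<and>
      (\<forall>i\<le>I. \<forall>j\<le>J. \<forall>(n, k)\<in>cls x. f (n + int i) (k + int j) = fst p n k * snd p i j n k)"
  proof
    fix x assume "x \<in> fst ` fam"
    then obtain t where "(x, t) \<in> fam" by auto
    hence "(x, t) \<in> idx0 \<union> idx1 \<union> idx2" by (simp add: fam_def)
    from tame_cls[OF this] obtain base \<kappa> where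
      "\<And>i j. i \<le> I \<Longrightarrow> j \<le> J \<Longrightarrow> lau (par_G s) (s + par_F s) (par_F s) (\<kappa> i j)"
      "\<And>i j n k. i \<le> I \<Longrightarrow> j \<le> J \<Longrightarrow> (n, k) \<in> cls x \<Longrightarrow> f (n + int i) (k + int j) = base n k * \<kappa> i j n k"
      by (rule tameE) blast
    thus "\<exists>p. (\<forall>i\<le>I. \<forall>j\<le>J. lau (par_G s) (s + par_F s) (par_F s) (snd p i j)) \<and>
      (\<forall>i\<le>I. \<forall>j\<le>J. \<forall>(n, k)\<in>cls x. f (n + int i) (k + int j) = fst p n k * snd p i j n k)"
      by (intro exI[of _ "(base, \<kappa>)"]) auto
  qed
  from bchoice[OF this] obtain p where
    p: "\<And>x t i j. (x, t) \<in> fam \<Longrightarrow> i \<le> I \<Longrightarrow> j \<le> J \<Longrightarrow> lau (par_G s) (s + par_F s) (par_F s) (snd (p x) i j)"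
    "\<And>x t i j n k. (x, t) \<in> fam \<Longrightarrow> i \<le> I \<Longrightarrow> j \<le> J \<Longrightarrow> (n, k) \<in> cls x \<Longrightarrow>
       f (n + int i) (k + int j) = fst (p x) n k * snd (p x) i j n k"
    by fastforce
  from solves_shift_reduction[where d = d and s = s and b = b and J = J, OF b] obtain \<Gamma> where
    \<Gamma>: "\<And>j t. j \<le> J \<Longrightarrow> t < d \<Longrightarrow> lau (s * (J + 1) * (J + 2)) 0 (s * (J + 1)) (\<lambda>n k. \<Gamma> j t k)"
    "\<And>g j k. solves d b g \<Longrightarrow> j \<le> J \<Longrightarrow> (\<Prod>v\<le>J. b d (int k + int v)) * g (k + j)
         = (\<Sum>t<d. \<Gamma> j t (int k) * g (k + t))"
    by blast
  \<comment> \<open>How \<open>g (k + j)\<close> depends on the independent values: through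
    \<open>\<Gamma>\<close>, or, on the lines \<open>k = const\<close> with tag 2, as one of these
    values itself.\<close>
  define W where "W x j t k = (if fst x = 2 then (if j = t then 1 else 0) else \<Gamma> j t k)"
    for x :: "nat \<times> linform \<times> int" and j t :: nat and k :: int
  define \<Psi> where "\<Psi> xt u n k = (case xt of (x, t) \<Rightarrow> case u of (h, a, i, j) \<Rightarrow>
      qp (int h + int a * n) * snd (p x) i j n k * W x j t k)"
    for xt :: "(nat \<times> linform \<times> int) \<times> nat" and u :: "nat \<times> nat \<times> nat \<times> nat" and n k
  have "\<exists>\<phi>. lau (2 * H) (2 * X) (famF xt) \<phi> \<and> (\<forall>(n, k)\<in>cls (fst xt). \<Psi> xt u n k = \<phi> n k)"
    if xt: "xt \<in> fam" and u: "u \<in> unk" for xt u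
  proof -
    obtain x t where xt': "xt = (x, t)" by (cases xt)
    obtain h a i j where u': "u = (h, a, i, j)" by (cases u) auto
    have bd: "h \<le> H" "a \<le> X" "i \<le> I" "j \<le> J" using u by (auto simp: unk_def u')
    have "lau H X 0 (\<lambda>n k. qp (int h + int a * n + 0 * k))" by (rule lau_qp) (use bd in auto)
    moreover have "lau (s * (J + 1) * (J + 2)) 0 (s * (J + 1)) (\<lambda>n k. W x j t k)"
    proof (cases "fst x = 2")
      case True
      thus ?thesis by (cases "j = t") (simp_all add: W_def lau_one lau_zero)
    next
      case False
      hence "t < d" using xt by (auto simp: xt' fam_def idx0_def idx1_def idx2_def)
      thus ?thesis using \<Gamma>(1)[of j t] bd False by (simp add: W_def)
    qed
    ultimately have "lau (H + par_G s + s * (J + 1) * (J + 2)) (X + (s + par_F s) + 0) (0 + par_F s + s * (J + 1))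
       (\<lambda>n k. qp (int h + int a * n + 0 * k) * snd (p x) i j n k * W x j t k)"
      using p(1)[of x t i j] xt bd by (intro lau_mult) (auto simp: xt')
    from lau_on_cls[of x t "\<Psi> xt u"] this xt show ?thesis
      by (simp add: xt' u' \<Psi>_def[abs_def] par_F1_def add.assoc)
  qed
  from common_annihilator[of fam unk "\<lambda>_. 2 * H" "\<lambda>_. 2 * X" famF "\<lambda>xt. cls (fst xt)" \<Psi>, OF _ _ this fam_count]
    finite_idx
  obtain \<alpha> where \<alpha>1: "\<exists>u\<in>unk. \<alpha> u \<noteq> 0"
    "\<forall>xt\<in>fam. \<forall>(n, k)\<in>cls (fst xt). (\<Sum>u\<in>unk. of_rat (\<alpha> u) * \<Psi> xt u n k) = 0"
    unfolding fam_def by (meson finite_UnI finite_unk)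
  have \<alpha>: "(\<Sum>u\<in>unk. of_rat (\<alpha> u) * \<Psi> xt u n k) = 0" if "xt \<in> fam" "(n, k) \<in> cls (fst xt)" for xt n k
    using \<alpha>1(2) that by blast
  show ?thesis
  proof (rule that[OF \<alpha>1(1)])
    fix g n k assume g: "solves d b g" and n: "int n0 \<le> n"
    let ?goal = "(\<Sum>(h, a, i, j)\<in>unk. of_rat (\<alpha> (h, a, i, j)) *
       qp (int h + int a * n) * (f (n + int i) (k + int j) * g (nat (k + int j)))) = 0"
    have trivial: ?goal if "\<And>i j. i \<le> I \<Longrightarrow> j \<le> J \<Longrightarrow> f (n + int i) (k + int j) = 0"
      by (intro sum.neutral) (auto simp: unk_def that)
    \<comment> \<open>After multiplication by \<open>B\<close> the expression is a combination of
      the independent values \<open>y t\<close>, and the coefficients are the sums that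
      \<open>\<alpha>\<close> makes vanish.\<close>
    have reduce: ?goal if x: "(n, k) \<in> cls x" "T \<noteq> {}" "finite T" "\<And>t. t \<in> T \<Longrightarrow> (x, t) \<in> fam"
      and B: "B \<noteq> 0" "\<And>j. j \<le> J \<Longrightarrow> B * g (nat (k + int j)) = (\<Sum>t\<in>T. W x j t k * y t)" for x T B y
    proof -
      obtain t0 where t0: "(x, t0) \<in> fam" using x by blast
      have "B * (\<Sum>(h, a, i, j)\<in>unk. of_rat (\<alpha> (h, a, i, j)) *
         qp (int h + int a * n) * (f (n + int i) (k + int j) * g (nat (k + int j))))
        = (\<Sum>u\<in>unk. \<Sum>t\<in>T. fst (p x) n k * y t * (of_rat (\<alpha> u) * \<Psi> (x, t) u n k))"
        unfolding sum_distrib_left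
      proof (intro sum.cong refl)
        fix u assume u: "u \<in> unk"
        obtain h a i j where u': "u = (h, a, i, j)" by (cases u) auto
        have bd: "i \<le> I" "j \<le> J" using u by (auto simp: unk_def u')
        have "B * (of_rat (\<alpha> (h, a, i, j)) * qp (int h + int a * n) * (f (n + int i) (k + int j) * g (nat (k + int j))))
          = of_rat (\<alpha> u) * qp (int h + int a * n) * (fst (p x) n k * snd (p x) i j n k) * (B * g (nat (k + int j)))"
          unfolding p(2)[OF t0 bd x(1)] by (simp add: u')
        also have "\<dots> = (\<Sum>t\<in>T. fst (p x) n k * y t * (of_rat (\<alpha> u) * \<Psi> (x, t) u n k))"
          unfolding B(2)[OF bd(2)] sum_distrib_left by (intro sum.cong refl) (simp add: \<Psi>_def u')
        finally show "B * (case u of (h, a, i, j) \<Rightarrow> of_rat (\<alpha> (h, a, i, j)) *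
           qp (int h + int a * n) * (f (n + int i) (k + int j) * g (nat (k + int j))))
           = (\<Sum>t\<in>T. fst (p x) n k * y t * (of_rat (\<alpha> u) * \<Psi> (x, t) u n k))"
          by (simp add: u')
      qed
      also have "\<dots> = (\<Sum>t\<in>T. fst (p x) n k * y t * (\<Sum>u\<in>unk. of_rat (\<alpha> u) * \<Psi> (x, t) u n k))"
        by (subst sum.swap) (simp add: sum_distrib_left)
      also have "\<dots> = 0" using \<alpha>[of "(x, _)" n k] x by (intro sum.neutral) auto
      finally show ?thesis using B(1) by simp
    qed
    show ?goal
    proof (cases "(n, k) \<in> pts")
      case False
      then obtain l where "l \<in> set ns \<union> set ds" "lf l n k < - int w" using n by (auto simp: pts_def not_le)
      thus ?thesis by (intro trivial f_zero_shift)
    next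
      case pts: True
      show ?thesis
      proof (cases "int k0 \<le> k")
        case small: False
        show ?thesis
        \<comment> \<open>Below \<open>- J\<close> every shift still has negative \<open>k\<close>
          and vanishes; the finitely many lines between \<open>- J\<close> and \<open>k0\<close>
          make up \<open>idx2\<close>.\<close>
        proof (cases "k < - int J")
          case True
          thus ?thesis by (intro trivial f_zero) auto
        next
          case False
          let ?x = "(2, (0, 1, 0), k) :: nat \<times> linform \<times> int"
          show ?thesis
          proof (rule reduce[of ?x "{..J}" 1 "\<lambda>j. g (nat (k + int j))"])
            show "(n, k) \<in> cls ?x" using pts by (simp add: cls_def line_def)
            show "(?x, t) \<in> fam" if "t \<in> {..J}" for t
              using that small False by (auto simp: fam_def idx2_def)
            show "1 * g (nat (k + int j)) = (\<Sum>t\<in>{..J}. W ?x j t k * g (nat (k + int t)))" if "j \<le> J" for j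
              using that by (simp add: W_def if_distrib[of "\<lambda>x. x * _"] cong: if_cong)
          qed auto
        qed
      next
        case large: True
        define k' where "k' = nat k"
        have k': "k = int k'" using large by (simp add: k'_def)
        define B where "B = (\<Prod>v\<le>J. b d (int k' + int v))"
        have B: "B \<noteq> 0" unfolding B_def using large lead by (auto simp: k')
        have "\<exists>x. fst x \<noteq> 2 \<and> (n, k) \<in> cls x \<and> (\<forall>t<d. (x, t) \<in> fam)"
        proof (cases "(n, k) \<in> generic")
          case True
          thus ?thesis by (intro exI[of _ "(0, (0, 0, 0), 0)"]) (auto simp: cls_def fam_def idx0_def)
        next
          case False
          with pts obtain a b' c where l: "(a, b', c) \<in> set ns" "(a, b') \<noteq> (0, 0)" "\<not> int w \<le> lf (a, b', c) n k"
            unfolding generic_def by blast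
          have bd: "lf_bounded s (a, b', c)" using bounded(1) l by blast
          have small: "- int w \<le> lf (a, b', c) n k" using pts l by (auto simp: pts_def simp del: lf.simps)
          \<comment> \<open>A form without \<open>k\<close> can be compared with the form
            \<open>k\<close> itself at \<open>(n, 0)\<close>, where the latter is 0: for
            \<open>n >= n0\<close> smallness would make the two parallel, so that
            \<open>a = 0\<close> as well.\<close>
          have "b' \<noteq> 0"
          proof
            assume "b' = 0"
            with l small bd have "a * 1 = 0 * 0"
              using s1 n by (intro parallel[of a 0 c 0 1 0 n 0]) auto
            thus False using l \<open>b' = 0\<close> by simp
          qed
          thus ?thesis using l small pts
            by (intro exI[of _ "(1, (a, b', c), lf (a, b', c) n k)"])
               (auto simp: cls_def line_def fam_def idx1_def simp del: lf.simps)
        qed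
        then obtain x where x: "fst x \<noteq> 2" "(n, k) \<in> cls x" "\<And>t. t < d \<Longrightarrow> (x, t) \<in> fam" by blast
        have red: "B * g (nat (k + int j)) = (\<Sum>t\<in>{..<d}. W x j t k * g (k' + t))" if "j \<le> J" for j
          using \<Gamma>(2)[OF g that, of k'] x(1) by (simp add: B_def W_def k' nat_int_add)
        show ?thesis
        \<comment> \<open>For order 0 there is no independent value to index a class; the equation
          then forces \<open>g\<close> to vanish at these points.\<close>
        proof (cases "d = 0")
          case True
          have "g (nat (k + int j)) = 0" if "j \<le> J" for j using red[OF that] B True by simp
          thus ?thesis by (intro sum.neutral) (auto simp: unk_def)
        next
          case False
          thus ?thesis by (intro reduce[OF x(2) _ _ _ B red]) (use x in auto)
        qed
      qed
    qed
  qed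
qed

end

section \<open>Recurrences for the sum\<close>

text \<open>Division with remainder by \<open>1 - K\<close>: the partial sums of the coefficients
  form the quotient, and the total, the value at \<open>K = 1\<close>, is the remainder.\<close>

lemma summation_by_parts:
  fixes a p :: "nat \<Rightarrow> 'a::comm_ring_1"
  shows "(\<Sum>j\<le>Suc J. a j * p j) = (\<Sum>j\<le>J. (\<Sum>i\<le>j. a i) * (p j - p (Suc j))) + (\<Sum>i\<le>Suc J. a i) * p (Suc J)"
  by (induction J) (simp_all add: algebra_simps)

lemma sum_shift_finite_support:
  fixes \<psi> :: "int \<Rightarrow> 'a::comm_monoid_add"
  assumes "\<And>k. k < 0 \<or> k > M \<Longrightarrow> \<psi> k = 0" "j \<le> J"
  shows "(\<Sum>k\<in>{- int J..M}. \<psi> (k + int j)) = (\<Sum>k\<in>{0..M}. \<psi> k)"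
proof -
  have "(\<Sum>k\<in>{- int J..M}. \<psi> (k + int j)) = (\<Sum>k\<in>(\<lambda>k. k + int j) ` {- int J..M}. \<psi> k)"
    by (subst sum.reindex) (auto simp: inj_on_def)
  also have "(\<lambda>k. k + int j) ` {- int J..M} = {- int J + int j..M + int j}"
    by simp
  also have "(\<Sum>k\<in>\<dots>. \<psi> k) = (\<Sum>k\<in>{0..M}. \<psi> k)"
    by (rule sum.mono_neutral_right) (use assms in auto)
  finally show ?thesis .
qed

text \<open>
  The coefficients \<open>\<alpha>\<close> describe an operator in the shift \<open>K\<close> of \<open>k\<close>. A factor \<open>K - 1\<close> can be
  cancelled, since a sequence of finite support that is invariant under \<open>K\<close> vanishes; once the
  operator no longer vanishes at \<open>K = 1\<close>, summation over \<open>k\<close> replaces \<open>K\<close> by \<open>1\<close>.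
\<close>

lemma cancel_difference_operator:
  fixes \<alpha> :: "'v \<Rightarrow> nat \<Rightarrow> rat"
  assumes "finite V" "\<exists>v\<in>V. \<exists>j\<le>J. \<alpha> v j \<noteq> 0"
  shows "\<exists>\<beta>. (\<exists>v\<in>V. \<beta> v \<noteq> 0) \<and> (\<forall>\<psi> :: 'v \<Rightarrow> int \<Rightarrow> ratq. \<forall>M.
     (\<forall>v\<in>V. \<forall>k. k < 0 \<or> k > M \<longrightarrow> \<psi> v k = 0) \<longrightarrow>
     (\<forall>k. (\<Sum>v\<in>V. \<Sum>j\<le>J. of_rat (\<alpha> v j) * \<psi> v (k + int j)) = 0) \<longrightarrow>
     (\<Sum>v\<in>V. of_rat (\<beta> v) * (\<Sum>k\<in>{0..M}. \<psi> v k)) = 0)"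
  using assms(2)
proof (induction J arbitrary: \<alpha>)
  case 0
  show ?case
  proof (intro exI[of _ "\<lambda>v. \<alpha> v 0"] conjI allI impI)
    fix \<psi> :: "'v \<Rightarrow> int \<Rightarrow> ratq" and M
    assume "\<forall>k. (\<Sum>v\<in>V. \<Sum>j\<le>0. of_rat (\<alpha> v j) * \<psi> v (k + int j)) = 0"
    hence "(\<Sum>k\<in>{0..M}. \<Sum>v\<in>V. of_rat (\<alpha> v 0) * \<psi> v k) = 0" by simp
    thus "(\<Sum>v\<in>V. of_rat (\<alpha> v 0) * (\<Sum>k\<in>{0..M}. \<psi> v k)) = 0"
      by (subst (asm) sum.swap) (simp add: sum_distrib_left)
  qed (use 0 in auto)
next
  case (Suc J)
  show ?case
  \<comment> \<open>The distinction concerns all \<open>v\<close> at once: either some coefficient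
    polynomial is nonzero at \<open>K = 1\<close>, or all of them are divisible by
    \<open>K - 1\<close>.\<close>
  proof (cases "\<exists>v\<in>V. (\<Sum>j\<le>Suc J. \<alpha> v j) \<noteq> 0")
    case True
    show ?thesis
    proof (intro exI[of _ "\<lambda>v. \<Sum>j\<le>Suc J. \<alpha> v j"] conjI allI impI True)
      fix \<psi> :: "'v \<Rightarrow> int \<Rightarrow> ratq" and M
      assume fs: "\<forall>v\<in>V. \<forall>k. k < 0 \<or> k > M \<longrightarrow> \<psi> v k = 0"
        and 0: "\<forall>k. (\<Sum>v\<in>V. \<Sum>j\<le>Suc J. of_rat (\<alpha> v j) * \<psi> v (k + int j)) = 0"
      have "0 = (\<Sum>k\<in>{- int (Suc J)..M}. \<Sum>v\<in>V. \<Sum>j\<le>Suc J. of_rat (\<alpha> v j) * \<psi> v (k + int j))"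
        using 0 by simp
      also have "\<dots> = (\<Sum>v\<in>V. \<Sum>k\<in>{- int (Suc J)..M}. \<Sum>j\<le>Suc J. of_rat (\<alpha> v j) * \<psi> v (k + int j))"
        by (rule sum.swap)
      also have "\<dots> = (\<Sum>v\<in>V. \<Sum>j\<le>Suc J. of_rat (\<alpha> v j) * (\<Sum>k\<in>{- int (Suc J)..M}. \<psi> v (k + int j)))"
        unfolding sum_distrib_left by (intro sum.cong refl sum.swap)
      also have "\<dots> = (\<Sum>v\<in>V. \<Sum>j\<le>Suc J. of_rat (\<alpha> v j) * (\<Sum>k\<in>{0..M}. \<psi> v k))"
        by (intro sum.cong refl arg_cong2[where f = "(*)"] sum_shift_finite_support) (use fs in auto)
      also have "\<dots> = (\<Sum>v\<in>V. of_rat (\<Sum>j\<le>Suc J. \<alpha> v j) * (\<Sum>k\<in>{0..M}. \<psi> v k))"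
        by (simp only: of_rat_sum sum_distrib_right)
      finally show "(\<Sum>v\<in>V. of_rat (\<Sum>j\<le>Suc J. \<alpha> v j) * (\<Sum>k\<in>{0..M}. \<psi> v k)) = 0" by simp
    qed
  next
    case False
    \<comment> \<open>The quotient by \<open>1 - K\<close>. It is not zero, since the partial sums
      determine the coefficients.\<close>
    define \<alpha>' where "\<alpha>' v j = (\<Sum>i\<le>j. \<alpha> v i)" for v j
    have "\<exists>v\<in>V. \<exists>j\<le>J. \<alpha>' v j \<noteq> 0"
    proof (rule ccontr)
      assume *: "\<not> ?thesis"
      have "\<alpha> v j = 0" if v: "v \<in> V" and j: "j \<le> Suc J" for v j
      proof -
        have A: "\<alpha>' v i = 0" if "i \<le> Suc J" for i
          using * False v that by (cases "i = Suc J") (auto simp: \<alpha>'_def)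
        show ?thesis
        proof (cases j)
          case 0 thus ?thesis using A[of 0] by (simp add: \<alpha>'_def)
        next
          case (Suc i) thus ?thesis using A[of i] A[of j] j by (simp add: \<alpha>'_def)
        qed
      qed
      thus False using Suc.prems by blast
    qed
    from Suc.IH[OF this] obtain \<beta> where \<beta>: "\<exists>v\<in>V. \<beta> v \<noteq> 0"
      "\<And>\<psi> :: 'v \<Rightarrow> int \<Rightarrow> ratq. \<And>M. (\<forall>v\<in>V. \<forall>k. k < 0 \<or> k > M \<longrightarrow> \<psi> v k = 0) \<Longrightarrow>
       (\<forall>k. (\<Sum>v\<in>V. \<Sum>j\<le>J. of_rat (\<alpha>' v j) * \<psi> v (k + int j)) = 0) \<Longrightarrow>
       (\<Sum>v\<in>V. of_rat (\<beta> v) * (\<Sum>k\<in>{0..M}. \<psi> v k)) = 0" by blast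
    show ?thesis
    proof (intro exI[of _ \<beta>] conjI allI impI \<beta>(1))
      fix \<psi> :: "'v \<Rightarrow> int \<Rightarrow> ratq" and M
      assume fs: "\<forall>v\<in>V. \<forall>k. k < 0 \<or> k > M \<longrightarrow> \<psi> v k = 0"
        and 0: "\<forall>k. (\<Sum>v\<in>V. \<Sum>j\<le>Suc J. of_rat (\<alpha> v j) * \<psi> v (k + int j)) = 0"
      define Z where "Z k = (\<Sum>v\<in>V. \<Sum>j\<le>J. of_rat (\<alpha>' v j) * \<psi> v (k + int j))" for k
      have step: "Z k = Z (k + 1)" for k
      proof -
        have "0 = (\<Sum>v\<in>V. \<Sum>j\<le>Suc J. of_rat (\<alpha> v j) * \<psi> v (k + int j))" using 0 by simp
        also have "\<dots> = (\<Sum>v\<in>V. \<Sum>j\<le>J. of_rat (\<alpha>' v j) * (\<psi> v (k + int j) - \<psi> v (k + int (Suc j))))"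
        proof (rule sum.cong[OF refl])
          fix v assume "v \<in> V"
          hence "(\<Sum>i\<le>Suc J. \<alpha> v i) = 0" using False by blast
          hence "(\<Sum>i\<le>Suc J. of_rat (\<alpha> v i) :: ratq) = 0" by (simp only: of_rat_sum[symmetric] of_rat_0)
          from summation_by_parts[of "\<lambda>j. of_rat (\<alpha> v j)" "\<lambda>j. \<psi> v (k + int j)" J, unfolded this]
          show "(\<Sum>j\<le>Suc J. of_rat (\<alpha> v j) * \<psi> v (k + int j)) =
             (\<Sum>j\<le>J. of_rat (\<alpha>' v j) * (\<psi> v (k + int j) - \<psi> v (k + int (Suc j))))"
            by (simp only: \<alpha>'_def of_rat_sum mult_zero_left add_0_right)
        qed
        also have "\<dots> = Z k - Z (k + 1)"
          by (simp add: Z_def right_diff_distrib sum_subtractf algebra_simps)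
        finally show ?thesis by simp
      qed
      have Z0: "Z k = 0" if "k > M" for k
        unfolding Z_def using fs that by (intro sum.neutral ballI) auto
      have shift: "Z k = Z (k + int r)" for k r
        by (induction r) (simp_all add: step[of "k + int _"] add.assoc add.commute[of 1])
      have "Z k = 0" for k
      proof -
        have "k + int (nat (M + 1 - k)) > M" by simp
        from Z0[OF this] show ?thesis using shift[of k "nat (M + 1 - k)"] by simp
      qed
      thus "(\<Sum>v\<in>V. of_rat (\<beta> v) * (\<Sum>k\<in>{0..M}. \<psi> v k)) = 0"
        by (intro \<beta>(2) fs) (simp add: Z_def)
    qed
  qed
qed

text \<open>For \<open>n > H\<close> the exponents \<open>h + a * n\<close> have the digits
  \<open>h\<close> and \<open>a\<close> in base \<open>n\<close>, so different pairs give different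
  powers of q and nothing cancels.\<close>

lemma qp_poly_nonzero:
  assumes "h0 \<le> H" "a0 \<le> X" "\<gamma> h0 a0 \<noteq> 0" "H < n"
  shows "(\<Sum>(h, a)\<in>{..H} \<times> {..X}. of_rat (\<gamma> h a) * qp (int h + int a * int n)) \<noteq> 0"
proof
  assume 0: "(\<Sum>(h, a)\<in>{..H} \<times> {..X}. of_rat (\<gamma> h a) * qp (int h + int a * int n)) = 0"
  let ?e = "\<lambda>(h, a). int h + int a * int n"
  let ?r = "\<lambda>e. \<gamma> (nat (e mod int n)) (nat (e div int n))"
  have inv: "nat ((int h + int a * int n) mod int n) = h" "nat ((int h + int a * int n) div int n) = a" if "h \<le> H" for h a
    using that assms(4) by (simp_all flip: of_nat_mod)
  have inv': "nat (int h mod int n) = h" if "h \<le> H" for h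
    using that assms(4) by (simp flip: of_nat_mod)
  have inj: "inj_on ?e ({..H} \<times> {..X})"
  proof (rule inj_onI, clarsimp)
    fix h a h' a' assume "h \<le> H" "h' \<le> H" and e: "int h + int a * int n = int h' + int a' * int n"
    thus "h = h' \<and> a = a'" using inv[of h a] inv[of h' a'] by simp
  qed
  have "(\<Sum>e\<in>?e ` ({..H} \<times> {..X}). of_rat (?r e) * qp e) = 0"
    unfolding 0[symmetric] by (subst sum.reindex[OF inj]) (auto intro!: sum.cong simp: inv inv')
  from qp_independent[OF _ this, of "int h0 + int a0 * int n"] assms inv[of h0 a0]
  show False by force
qed

text \<open>A functional that vanishes on the common kernel of finitely many others is a combination
  of them. The induction restricts to the kernel of the first one, which is why \<open>V\<close>
  varies.\<close>

lemma functional_in_span: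
  fixes V :: "('k \<Rightarrow> 'a::field) set" and \<phi> :: "('k \<Rightarrow> 'a) \<Rightarrow> 'a"
  defines "lin \<equiv> \<lambda>\<phi>. (\<forall>u v. \<phi> (\<lambda>k. u k + v k) = \<phi> u + \<phi> v) \<and> (\<forall>c v. \<phi> (\<lambda>k. c * v k) = (c :: 'a) * \<phi> v)"
  assumes "\<And>u v c. u \<in> V \<Longrightarrow> v \<in> V \<Longrightarrow> (\<lambda>k. u k + c * v k) \<in> V"
    and "lin \<phi>" "\<And>g. g \<in> set gs \<Longrightarrow> lin g"
    and "\<And>v. v \<in> V \<Longrightarrow> (\<And>g. g \<in> set gs \<Longrightarrow> g v = 0) \<Longrightarrow> \<phi> v = 0"
  shows "\<exists>\<mu>. \<forall>v\<in>V. \<phi> v = (\<Sum>i<length gs. \<mu> i * (gs ! i) v)"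
  using assms(2-)
proof (induction gs arbitrary: V)
  case Nil
  thus ?case by auto
next
  case (Cons g gs)
  have g: "g (\<lambda>k. u k + c * v k) = g u + c * g v" for u v c
    using Cons.prems(3)[of g] by (simp add: lin_def)
  have lin': "h (\<lambda>k. u k + c * v k) = h u + c * h v" if "h \<in> set gs" for u v c h
    using Cons.prems(3)[of h] that by (simp add: lin_def)
  have \<phi>: "\<phi> (\<lambda>k. u k + c * v k) = \<phi> u + c * \<phi> v" for u v c
    using Cons.prems(2) by (simp add: lin_def)
  have "\<exists>\<mu>. \<forall>v\<in>{v \<in> V. g v = 0}. \<phi> v = (\<Sum>i<length gs. \<mu> i * (gs ! i) v)"
  proof (rule Cons.IH)
    show "(\<lambda>k. u k + c * v k) \<in> {v \<in> V. g v = 0}" if "u \<in> {v \<in> V. g v = 0}" "v \<in> {v \<in> V. g v = 0}" for u v c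
      using that Cons.prems(1)[of u v c] by (auto simp: g)
    show "\<phi> v = 0" if "v \<in> {v \<in> V. g v = 0}" "\<And>h. h \<in> set gs \<Longrightarrow> h v = 0" for v
      by (rule Cons.prems(4)) (use that in auto)
  qed (use Cons.prems(2,3) in auto)
  then obtain \<mu> where \<mu>: "\<And>v. v \<in> V \<Longrightarrow> g v = 0 \<Longrightarrow> \<phi> v = (\<Sum>i<length gs. \<mu> i * (gs ! i) v)" by blast
  define rest where "rest v = (\<Sum>i<length gs. \<mu> i * (gs ! i) v)" for v
  have rest: "rest (\<lambda>k. u k + c * v k) = rest u + c * rest v" for u v c
  proof -
    have "rest (\<lambda>k. u k + c * v k) = (\<Sum>i<length gs. \<mu> i * (gs ! i) u + c * (\<mu> i * (gs ! i) v))"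
      unfolding rest_def by (intro sum.cong refl) (simp add: lin' algebra_simps)
    thus ?thesis by (simp add: rest_def sum.distrib sum_distrib_left)
  qed
  \<comment> \<open>If \<open>g\<close> vanishes on \<open>V\<close>, the multiplier is immaterial;
    otherwise one \<open>v0\<close> outside its kernel fixes it, since every vector differs from a
    kernel element by a multiple of \<open>v0\<close>.\<close>
  have "\<exists>m. \<forall>v\<in>V. \<phi> v = m * g v + rest v"
  proof (cases "\<exists>v0\<in>V. g v0 \<noteq> 0")
    case True
    then obtain v0 where v0: "v0 \<in> V" "g v0 \<noteq> 0" by blast
    show ?thesis
    proof (intro exI[of _ "(\<phi> v0 - rest v0) / g v0"] ballI)
      fix v assume v: "v \<in> V"
      define c where "c = - g v / g v0"
      have "g (\<lambda>k. v k + c * v0 k) = 0" unfolding g c_def using v0 by simp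
      hence "\<phi> (\<lambda>k. v k + c * v0 k) = rest (\<lambda>k. v k + c * v0 k)"
        unfolding rest_def using v v0 by (intro \<mu> Cons.prems(1))
      hence "\<phi> v + c * \<phi> v0 = rest v + c * rest v0" by (simp only: \<phi> rest)
      thus "\<phi> v = (\<phi> v0 - rest v0) / g v0 * g v + rest v"
        using v0 by (simp add: c_def field_simps)
    qed
  next
    case False
    thus ?thesis using \<mu> by (intro exI[of _ 0]) (auto simp: rest_def)
  qed
  then obtain m where "\<And>v. v \<in> V \<Longrightarrow> \<phi> v = m * g v + rest v" by blast
  thus ?case
    by (intro exI[of _ "\<lambda>i. case i of 0 \<Rightarrow> m | Suc i \<Rightarrow> \<mu> i"])
       (simp add: rest_def sum.lessThan_Suc_shift del: sum.lessThan_Suc)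
qed

text \<open>Continues prescribed values below \<open>L\<close> by solving the equation for its
  highest term.\<close>

fun extend_solution :: "nat \<Rightarrow> (nat \<Rightarrow> int \<Rightarrow> ratq) \<Rightarrow> nat \<Rightarrow> (nat \<Rightarrow> ratq) \<Rightarrow> nat \<Rightarrow> ratq" where
  "extend_solution d b L v k = (if k < L \<or> k < d then v k else
     - (\<Sum>i<d. b i (int (k - d)) * extend_solution d b L v (k - d + i)) / b d (int (k - d)))"

declare extend_solution.simps [simp del]

definition row :: "nat \<Rightarrow> (nat \<Rightarrow> int \<Rightarrow> ratq) \<Rightarrow> nat \<Rightarrow> nat \<Rightarrow> ratq" where
  "row d b m k = (if m \<le> k \<and> k \<le> m + d then b (k - m) (int m) else 0)"

lemma row_sum:
  assumes "m + d < L"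
  shows "(\<Sum>k<L. row d b m k * g k) = (\<Sum>i\<le>d. b i (int m) * g (m + i))"
proof -
  have "(\<Sum>k<L. row d b m k * g k) = (\<Sum>k\<in>{m..m + d}. row d b m k * g k)"
    by (rule sum.mono_neutral_right) (use assms in \<open>auto simp: row_def\<close>)
  also have "\<dots> = (\<Sum>i\<in>{0..d}. row d b m (i + m) * g (i + m))"
    using sum.shift_bounds_cl_nat_ivl[of "\<lambda>k. row d b m k * g k" 0 m d] by (simp add: add.commute)
  finally show ?thesis by (simp add: row_def atLeast0AtMost add.commute)
qed

text \<open>Initial values that satisfy the first equations extend to a full solution, on which
  \<open>\<gamma>\<close> vanishes by hypothesis. So \<open>\<gamma>\<close> vanishes on the common
  kernel of finitely many rows and lies in their span.\<close>

lemma functional_certificate: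
  assumes lead: "\<And>k. int k0 \<le> k \<Longrightarrow> b d k \<noteq> 0"
    and 0: "\<And>k. k \<ge> L0 \<Longrightarrow> \<gamma> k = 0"
    and van: "\<And>g. solves d b g \<Longrightarrow> (\<Sum>k<L0. \<gamma> k * g k) = 0"
  shows "\<exists>\<mu> M. \<forall>k. \<gamma> k = (\<Sum>m<M. \<mu> m * row d b m k)"
proof -
  \<comment> \<open>Rows below \<open>M\<close> involve only values below \<open>L\<close>; from
    \<open>M\<close> on the leading coefficient is nonzero, so any such values can be
    continued.\<close>
  define M where "M = max L0 k0 + 1"
  define L where "L = M + d"
  have sumL: "(\<Sum>k<L. \<gamma> k * g k) = (\<Sum>k<L0. \<gamma> k * g k)" for g
    by (rule sum.mono_neutral_right) (auto simp: L_def M_def 0)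
  define gs where "gs = map (\<lambda>m v. \<Sum>k<L. row d b m k * v k) [0..<M]"
  have "\<exists>\<mu>. \<forall>v\<in>UNIV. (\<Sum>k<L. \<gamma> k * v k) = (\<Sum>i<length gs. \<mu> i * (gs ! i) v)"
  proof (rule functional_in_span)
    fix v :: "nat \<Rightarrow> ratq"
    assume v: "\<And>g. g \<in> set gs \<Longrightarrow> g v = 0"
    define g where "g = extend_solution d b L v"
    have gv: "g k = v k" if "k < L" for k using that by (simp add: g_def extend_solution.simps)
    have "(\<Sum>i\<le>d. b i (int m) * g (m + i)) = 0" for m
    proof (cases "m < M")
      case True
      hence "(\<Sum>k<L. row d b m k * v k) = 0" by (intro v) (auto simp: gs_def)
      hence "(\<Sum>k<L. row d b m k * g k) = 0" by (simp add: gv)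
      thus ?thesis using True by (simp add: row_sum L_def)
    next
      case False
      have "b d (int m) \<noteq> 0" using False by (intro lead) (simp add: M_def)
      moreover have "g (m + d) = - (\<Sum>i<d. b i (int m) * g (m + i)) / b d (int m)"
        unfolding g_def using False by (subst extend_solution.simps) (simp add: L_def)
      ultimately show ?thesis by (simp add: lessThan_Suc_atMost[symmetric])
    qed
    hence "solves d b g" by (simp add: solves_def)
    from van[OF this] show "(\<Sum>k<L. \<gamma> k * v k) = 0"
      unfolding sumL[symmetric] by (simp add: gv)
  qed (auto simp: gs_def algebra_simps sum.distrib sum_distrib_left)
  then obtain \<mu> where \<mu>: "\<And>v. (\<Sum>k<L. \<gamma> k * v k) = (\<Sum>m<M. \<mu> m * (\<Sum>k<L. row d b m k * v k))"
    by (auto simp: gs_def)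
  have "\<gamma> k = (\<Sum>m<M. \<mu> m * row d b m k)" for k
  proof (cases "k < L")
    case True
    \<comment> \<open>Unit vectors turn the identity of functionals into one of
      coefficients.\<close>
    have "(\<Sum>k'<L. h k' * (if k' = k then 1 else 0)) = h k" for h :: "nat \<Rightarrow> ratq"
      using True by (simp add: if_distrib[of "\<lambda>x. _ * x"] cong: if_cong)
    from \<mu>[of "\<lambda>k'. if k' = k then 1 else 0", unfolded this] show ?thesis .
  next
    case False
    thus ?thesis by (simp add: 0 L_def M_def row_def)
  qed
  thus ?thesis by blast
qed

text \<open>
  The leading coefficient of a recurrence of degree \<open>H\<close> in \<open>q\<close> does not vanish at \<open>q\<^sup>n\<close> for \<open>n > H\<close>, so
  finitely many values decide whether a solution vanishes.
\<close>

definition par_N :: "nat \<Rightarrow> nat" where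
  "par_N s = par_n0 s + par_H s + par_I s + 1"

context summand begin

text \<open>The operator shifts \<open>n\<close> by up to \<open>s\<close>, so its support in
  \<open>k\<close> reaches \<open>n + s\<close>.\<close>

definition Rsum :: "(nat \<Rightarrow> ratq) \<Rightarrow> nat \<Rightarrow> ratq" where
  "Rsum g n = (\<Sum>k\<in>{0..int n + int s}. f (int n) k * g (nat k))"

text \<open>\<open>\<beta>\<close> is obtained from \<open>\<alpha>\<close> alone, before
  \<open>n\<close> and \<open>g\<close> are fixed; the cancellation at each single \<open>n\<close>
  therefore yields one recurrence, common to all \<open>n >= n0\<close> and to all
  solutions.\<close>

lemma recurrence:
  obtains \<beta> where "\<exists>v\<in>{..H} \<times> {..X} \<times> {..I}. \<beta> v \<noteq> 0"
    "\<And>g n. solves d b g \<Longrightarrow> n0 \<le> n \<Longrightarrow>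
       (\<Sum>(h, a, i)\<in>{..H} \<times> {..X} \<times> {..I}. of_rat (\<beta> (h, a, i)) * (qp (int h + int a * int n) * Rsum g (n + i))) = 0"
proof -
  let ?V = "{..H} \<times> {..X} \<times> {..I}"
  from annihilator obtain \<alpha> where \<alpha>: "\<exists>u\<in>unk. \<alpha> u \<noteq> 0"
    "\<And>g n k. solves d b g \<Longrightarrow> int n0 \<le> n \<Longrightarrow> (\<Sum>(h, a, i, j)\<in>unk. of_rat (\<alpha> (h, a, i, j)) *
       qp (int h + int a * n) * (f (n + int i) (k + int j) * g (nat (k + int j)))) = 0" by blast
  define \<alpha>' where "\<alpha>' v j = (case v of (h, a, i) \<Rightarrow> \<alpha> (h, a, i, j))" for v j
  have "\<exists>v\<in>?V. \<exists>j\<le>J. \<alpha>' v j \<noteq> 0" using \<alpha>(1) by (fastforce simp: unk_def \<alpha>'_def)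
  from cancel_difference_operator[OF _ this] obtain \<beta> where \<beta>: "\<exists>v\<in>?V. \<beta> v \<noteq> 0"
    "\<And>\<psi> :: nat \<times> nat \<times> nat \<Rightarrow> int \<Rightarrow> ratq. \<And>M. (\<forall>v\<in>?V. \<forall>k. k < 0 \<or> k > M \<longrightarrow> \<psi> v k = 0) \<Longrightarrow>
       (\<forall>k. (\<Sum>v\<in>?V. \<Sum>j\<le>J. of_rat (\<alpha>' v j) * \<psi> v (k + int j)) = 0) \<Longrightarrow>
       (\<Sum>v\<in>?V. of_rat (\<beta> v) * (\<Sum>k\<in>{0..M}. \<psi> v k)) = 0" by blast
  show ?thesis
  proof (rule that[OF \<beta>(1)])
    fix g n assume g: "solves d b g" and n: "n0 \<le> n"
    define \<psi> where "\<psi> v k = (case v of (h, a, i) \<Rightarrow> qp (int h + int a * int n) * (f (int n + int i) k * g (nat k)))"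
      for v :: "nat \<times> nat \<times> nat" and k
    have "(\<Sum>v\<in>?V. of_rat (\<beta> v) * (\<Sum>k\<in>{0..int n + int I + int s}. \<psi> v k)) = 0"
    proof (rule \<beta>(2); intro ballI allI impI)
      fix v k assume "v \<in> ?V" "k < 0 \<or> k > int n + int I + int s"
      thus "\<psi> v k = 0" by (auto simp: \<psi>_def f_zero f_zero')
    next
      fix k
      have "(\<Sum>v\<in>?V. \<Sum>j\<le>J. of_rat (\<alpha>' v j) * \<psi> v (k + int j)) = (\<Sum>u\<in>unk. case u of (h, a, i, j) \<Rightarrow>
         of_rat (\<alpha> (h, a, i, j)) * qp (int h + int a * int n) * (f (int n + int i) (k + int j) * g (nat (k + int j))))"
        unfolding unk_def sum.cartesian_product' by (simp add: \<alpha>'_def \<psi>_def mult.assoc)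
      thus "(\<Sum>v\<in>?V. \<Sum>j\<le>J. of_rat (\<alpha>' v j) * \<psi> v (k + int j)) = 0"
        using \<alpha>(2)[OF g, of "int n" k] n by simp
    qed
    moreover have "(\<Sum>k\<in>{0..int n + int I + int s}. \<psi> (h, a, i) k) = qp (int h + int a * int n) * Rsum g (n + i)"
      if "i \<le> I" for h a i
    proof -
      have "(\<Sum>k\<in>{0..int n + int I + int s}. \<psi> (h, a, i) k) = (\<Sum>k\<in>{0..int (n + i) + int s}. \<psi> (h, a, i) k)"
        by (rule sum.mono_neutral_right) (use that in \<open>auto simp: \<psi>_def f_zero'\<close>)
      thus ?thesis by (simp add: \<psi>_def Rsum_def sum_distrib_left)
    qed
    hence "(\<Sum>(h, a, i)\<in>?V. of_rat (\<beta> (h, a, i)) * (qp (int h + int a * int n) * Rsum g (n + i)))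
      = (\<Sum>v\<in>?V. of_rat (\<beta> v) * (\<Sum>k\<in>{0..int n + int I + int s}. \<psi> v k))"
      by (intro sum.cong refl) auto
    ultimately show "(\<Sum>(h, a, i)\<in>?V. of_rat (\<beta> (h, a, i)) * (qp (int h + int a * int n) * Rsum g (n + i))) = 0"
      by simp
  qed
qed

lemma vanishing:
  assumes g: "solves d b g" and van: "\<And>n. n \<le> par_N s \<Longrightarrow> Rsum g n = 0"
  shows "Rsum g n = 0"
proof -
  from recurrence obtain \<beta> where \<beta>: "\<exists>v\<in>{..H} \<times> {..X} \<times> {..I}. \<beta> v \<noteq> 0"
    "\<And>g n. solves d b g \<Longrightarrow> n0 \<le> n \<Longrightarrow>
       (\<Sum>(h, a, i)\<in>{..H} \<times> {..X} \<times> {..I}. of_rat (\<beta> (h, a, i)) * (qp (int h + int a * int n) * Rsum g (n + i))) = 0"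
    by blast
  define c where "c i n = (\<Sum>(h, a)\<in>{..H} \<times> {..X}. of_rat (\<beta> (h, a, i)) * qp (int h + int a * int n))" for i n
  have rec: "(\<Sum>i\<le>I. c i n * Rsum g (n + i)) = 0" if "n0 \<le> n" for n
  proof -
    have "(\<Sum>i\<le>I. c i n * Rsum g (n + i)) = (\<Sum>(h, a, i)\<in>{..H} \<times> {..X} \<times> {..I}.
        of_rat (\<beta> (h, a, i)) * (qp (int h + int a * int n) * Rsum g (n + i)))"
      unfolding c_def sum_distrib_right sum.cartesian_product[symmetric]
      by (subst sum_rotate[symmetric]) (simp add: mult.assoc)
    thus ?thesis using \<beta>(2)[OF g that] by simp
  qed
  let ?P = "\<lambda>i. i \<le> I \<and> (\<exists>h\<le>H. \<exists>a\<le>X. \<beta> (h, a, i) \<noteq> 0)"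
  \<comment> \<open>The true order of the recurrence: its coefficients above \<open>r\<close> vanish
    identically.\<close>
  define r where "r = (GREATEST i. ?P i)"
  have ex: "\<exists>i. ?P i" using \<beta>(1) by auto
  have r: "?P r" unfolding r_def by (rule GreatestI_ex_nat[of ?P I]) (use ex in auto)
  have above: "c i n = 0" if "r < i" "i \<le> I" for i n
  proof -
    have "\<not> ?P i" using Greatest_le_nat[of ?P i I] that unfolding r_def by auto
    thus ?thesis unfolding c_def using that by (intro sum.neutral) auto
  qed
  from r obtain h0 a0 where h0: "h0 \<le> H" "a0 \<le> X" "\<beta> (h0, a0, r) \<noteq> 0" by blast
  have lead: "c r n \<noteq> 0" if "H < n" for n
    unfolding c_def by (rule qp_poly_nonzero[where \<gamma> = "\<lambda>h a. \<beta> (h, a, r)", OF h0 that])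
  show ?thesis
  proof (induction n rule: less_induct)
    case (less n)
    show ?case
    proof (cases "n \<le> par_N s")
      case False
      \<comment> \<open>Since \<open>n > par_N s\<close> and \<open>r <= I\<close>, this
        \<open>m\<close> lies beyond both \<open>n0\<close> and \<open>H\<close>: the recurrence
        holds there, and its leading coefficient is nonzero.\<close>
      define m where "m = n - r"
      have m: "n0 \<le> m" "H < m" "n = m + r" using False r by (auto simp: m_def par_N_def)
      have "0 = (\<Sum>i\<le>I. c i m * Rsum g (m + i))" using rec[OF m(1)] by simp
      also have "\<dots> = (\<Sum>i\<in>{r}. c i m * Rsum g (m + i))"
      proof (rule sum.mono_neutral_right)
        show "\<forall>i\<in>{..I} - {r}. c i m * Rsum g (m + i) = 0"
        proof
          fix i assume i: "i \<in> {..I} - {r}"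
          show "c i m * Rsum g (m + i) = 0"
          proof (cases "i < r")
            case True thus ?thesis using less[of "m + i"] m by simp
          next
            case False thus ?thesis using above[of i m] i by auto
          qed
        qed
      qed (use r in auto)
      finally show ?thesis using lead[OF m(2)] m(3) by simp
    qed (simp add: van)
  qed
qed

end

section \<open>Evaluation of coded equations\<close>

text \<open>Shaped after the codes, so that \<open>dec\<close> yields it directly: outer index the
  degree in x, inner index the degree in q, rationals as pairs. Pairs need not be reduced, and a
  zero denominator counts as the value 0.\<close>

type_synonym rpoly = "(int \<times> int) list list"

definition rc_val :: "(int \<times> int) list \<Rightarrow> ratq" where
  "rc_val c = foldr (\<lambda>z r. of_int (fst z) / of_int (snd z) + qvar * r) c 0"

definition rp_val :: "rpoly \<Rightarrow> int \<Rightarrow> ratq" where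
  "rp_val P k = foldr (\<lambda>c r. rc_val c + qp k * r) P 0"

definition f_rc :: "(int \<times> int) list \<Rightarrow> frac" where
  "f_rc c = foldr (\<lambda>z r. f_add (f_rat (fst z) (snd z)) (f_mult (f_qp 1) r)) c (f_rat 0 1)"

definition f_rp :: "rpoly \<Rightarrow> int \<Rightarrow> frac" where
  "f_rp P k = foldr (\<lambda>c r. f_add (f_rc c) (f_mult (f_qp k) r)) P (f_rat 0 1)"

lemma fval_rc [simp]: "fval (f_rc c) = rc_val c"
  by (induction c) (simp_all add: f_rc_def rc_val_def)

lemma fval_rp [simp]: "fval (f_rp P k) = rp_val P k"
  by (induction P) (simp_all add: f_rp_def rp_val_def)

lemma cmp_f_rc [cmp_intros]: "cmp f \<Longrightarrow> cmp (\<lambda>x. f_rc (f x))"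
  unfolding f_rc_def by (intro cmp_intros)

lemma cmp_f_rp [cmp_intros]: "cmp f \<Longrightarrow> cmp g \<Longrightarrow> cmp (\<lambda>x. f_rp (f x) (g x))"
  unfolding f_rp_def by (intro cmp_intros cmp_comp_fst)

definition rp_coeff :: "rpoly \<Rightarrow> nat \<Rightarrow> nat \<Rightarrow> rat" where
  "rp_coeff P h a = (case nth_default (0, 1) (nth_default [] P a) h of (z, w) \<Rightarrow> of_int z / of_int w)"

definition rp_size :: "rpoly \<Rightarrow> nat" where
  "rp_size P = length P + sum_list (map length P)"

lemma rc_val_sum:
  assumes "length c \<le> s"
  shows "rc_val c = (\<Sum>h\<le>s. of_rat (case nth_default (0, 1) c h of (z, w) \<Rightarrow> of_int z / of_int w) * qp (int h))"
  using assms
proof (induction c arbitrary: s)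
  case (Cons x c)
  then obtain s' where s': "s = Suc s'" "length c \<le> s'" by (cases s) auto
  have "rc_val (x # c) = of_int (fst x) / of_int (snd x) + qvar * rc_val c" by (simp add: rc_val_def)
  also have "qvar * rc_val c = (\<Sum>h\<le>s'. of_rat (case nth_default (0, 1) c h of (z, w) \<Rightarrow> of_int z / of_int w) * qp (int (Suc h)))"
    unfolding Cons.IH[OF s'(2)] sum_distrib_left by (simp add: qp_add algebra_simps)
  finally show ?case
    unfolding s' by (subst sum.atMost_Suc_shift) (simp add: case_prod_beta of_rat_divide)
qed (simp add: rc_val_def)

lemma rp_val_sum:
  assumes "length P \<le> s" "\<And>c. c \<in> set P \<Longrightarrow> length c \<le> s"
  shows "rp_val P k = (\<Sum>a\<le>s. \<Sum>h\<le>s. of_rat (rp_coeff P h a) * qp (int h + int a * k))"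
proof -
  have "rp_val P k = (\<Sum>a\<le>t. rc_val (nth_default [] P a) * qp (int a * k))" if "length P \<le> t" for t
    using that
  proof (induction P arbitrary: t)
    case (Cons x P)
    then obtain t' where t': "t = Suc t'" "length P \<le> t'" by (cases t) auto
    have "rp_val (x # P) k = rc_val x + qp k * rp_val P k" by (simp add: rp_val_def)
    also have "qp k * rp_val P k = (\<Sum>a\<le>t'. rc_val (nth_default [] P a) * qp (int (Suc a) * k))"
      unfolding Cons.IH[OF t'(2)] sum_distrib_left by (simp add: qp_add algebra_simps)
    finally show ?case unfolding t' by (subst sum.atMost_Suc_shift) simp
  qed (simp add: rp_val_def rc_val_def)
  from this[OF assms(1)] have "rp_val P k = (\<Sum>a\<le>s. rc_val (nth_default [] P a) * qp (int a * k))" .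
  also have "\<dots> = (\<Sum>a\<le>s. \<Sum>h\<le>s. of_rat (rp_coeff P h a) * qp (int h + int a * k))"
  proof (intro sum.cong refl)
    fix a
    have "length (nth_default [] P a) \<le> s"
      using assms(2) by (auto simp: nth_default_def)
    from rc_val_sum[OF this]
    show "rc_val (nth_default [] P a) * qp (int a * k) = (\<Sum>h\<le>s. of_rat (rp_coeff P h a) * qp (int h + int a * k))"
      by (simp add: sum_distrib_right rp_coeff_def qp_add mult.assoc)
  qed
  finally show ?thesis .
qed

lemma rp_size_bounds: "length P \<le> rp_size P" "c \<in> set P \<Longrightarrow> length c \<le> rp_size P"
  using member_le_sum_list[of "length c" "map length P"] by (auto simp: rp_size_def)

lemma lau_rp: "rp_size P \<le> s \<Longrightarrow> lau s 0 s (\<lambda>n k. rp_val P k)"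
proof -
  assume s: "rp_size P \<le> s"
  have "lau s 0 s (\<lambda>n k. \<Sum>a\<le>s. \<Sum>h\<le>s. of_rat (rp_coeff P h a) * qp (int h + 0 * n + int a * k))"
    by (intro lau_sum lau_smult lau_qp) auto
  moreover have "rp_val P k = (\<Sum>a\<le>s. \<Sum>h\<le>s. of_rat (rp_coeff P h a) * qp (int h + 0 * n + int a * k))" for n k
    using rp_val_sum[of P s k] order_trans[OF rp_size_bounds(1) s] order_trans[OF rp_size_bounds(2) s] by simp
  ultimately show ?thesis by simp
qed

definition rp_nonzero :: "rpoly \<Rightarrow> bool" where
  "rp_nonzero P \<longleftrightarrow> \<not> list_all (\<lambda>c. list_all (\<lambda>z. fst z = 0 \<or> snd z = 0) c) P"

lemma cmpP_rp_nonzero [cmp_intros]: "cmp f \<Longrightarrow> cmpP (\<lambda>x. rp_nonzero (f x))"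
  unfolding rp_nonzero_def by (intro cmp_intros)

lemma rp_coeff_nonzero: "rp_nonzero P \<longleftrightarrow> (\<exists>h a. rp_coeff P h a \<noteq> 0)"
proof
  assume "rp_nonzero P"
  then obtain c z where "c \<in> set P" "z \<in> set c" "fst z \<noteq> 0" "snd z \<noteq> 0"
    by (auto simp: rp_nonzero_def list_all_iff)
  then obtain a h where "a < length P" "h < length (P ! a)" "fst (P ! a ! h) \<noteq> 0" "snd (P ! a ! h) \<noteq> 0"
    by (metis in_set_conv_nth)
  thus "\<exists>h a. rp_coeff P h a \<noteq> 0"
    by (intro exI[of _ h] exI[of _ a]) (simp add: rp_coeff_def nth_default_def case_prod_beta)
next
  assume "\<exists>h a. rp_coeff P h a \<noteq> 0"
  then obtain h a where "rp_coeff P h a \<noteq> 0" by blast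
  show "rp_nonzero P"
  proof (rule ccontr)
    assume "\<not> rp_nonzero P"
    hence *: "fst z = 0 \<or> snd z = 0" if "c \<in> set P" "z \<in> set c" for c z
      using that by (auto simp: rp_nonzero_def list_all_iff)
    have "fst (P ! a ! h) = 0 \<or> snd (P ! a ! h) = 0" if "a < length P" "h < length (P ! a)"
      using that by (intro *[of "P ! a"]) auto
    hence "rp_coeff P h a = 0" by (auto simp: rp_coeff_def nth_default_def case_prod_beta)
    with \<open>rp_coeff P h a \<noteq> 0\<close> show False by simp
  qed
qed

lemma rp_val_nonzero:
  assumes "rp_nonzero P" "rp_size P < n"
  shows "rp_val P (int n) \<noteq> 0"
proof -
  let ?s = "rp_size P"
  obtain h a where ha: "rp_coeff P h a \<noteq> 0" using assms(1) by (auto simp: rp_coeff_nonzero)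
  have a: "a < length P" using ha by (rule contrapos_np) (simp add: rp_coeff_def nth_default_def)
  have "h < length (P ! a)" using ha by (rule contrapos_np) (simp add: rp_coeff_def nth_default_def a)
  hence bd: "h \<le> ?s" "a \<le> ?s"
    using a rp_size_bounds(1)[where P = P] rp_size_bounds(2)[where P = P and c = "P ! a"] by auto
  have "rp_val P (int n) = (\<Sum>a\<le>?s. \<Sum>h\<le>?s. of_rat (rp_coeff P h a) * qp (int h + int a * int n))"
    by (rule rp_val_sum) (use rp_size_bounds[where P = P] in auto)
  also have "\<dots> = (\<Sum>(h, a)\<in>{..?s} \<times> {..?s}. of_rat (rp_coeff P h a) * qp (int h + int a * int n))"
    unfolding sum.cartesian_product[symmetric] by (rule sum.swap)
  also have "\<dots> \<noteq> 0" by (rule qp_poly_nonzero[where \<gamma> = "rp_coeff P", OF bd ha assms(2)])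
  finally show ?thesis .
qed

lemma rp_val_zero:
  assumes "\<not> rp_nonzero P" shows "rp_val P k = 0"
proof -
  have "rp_coeff P h a = 0" for h a using assms by (auto simp: rp_coeff_nonzero)
  thus ?thesis using rp_val_sum[of P "rp_size P" k] rp_size_bounds[where P = P] by simp
qed

definition rp_of_int :: "int list list \<Rightarrow> rpoly" where
  "rp_of_int P = map (\<lambda>c. map (\<lambda>z. (z, 1)) c) P"

lemma cmp_rp_of_int [cmp_intros]: "cmp f \<Longrightarrow> cmp (\<lambda>x. rp_of_int (f x))"
  unfolding rp_of_int_def by (intro cmp_intros)

lemma cmp_sum_list [cmp_intros]: "cmp f \<Longrightarrow> cmp (\<lambda>x. sum_list (f x) :: nat)"
proof -
  assume "cmp f"
  hence "cmp (\<lambda>x. foldr (\<lambda>a b. a + b) (f x) (0::nat))" by (intro cmp_intros)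
  moreover have "foldr (\<lambda>a b. a + b) l (0::nat) = sum_list l" for l by (induction l) auto
  ultimately show ?thesis by simp
qed

lemma cmp_rp_size [cmp_intros]: "cmp f \<Longrightarrow> cmp (\<lambda>x. rp_size (f x))"
  unfolding rp_size_def by (intro cmp_intros)

text \<open>
  Multiplying the equation \<open>\<Sum> (P\<^sub>i / R\<^sub>i) u(k + i) = 0\<close> by the square of the product of all \<open>R\<^sub>j\<close> makes
  the coefficients polynomials that vanish wherever some \<open>R\<^sub>j\<close> does.
\<close>

type_synonym req = "(rpoly \<times> rpoly) list"

abbreviation eq_num :: "req \<Rightarrow> nat \<Rightarrow> rpoly" where "eq_num E i \<equiv> fst (nth_default ([], []) E i)"
abbreviation eq_den :: "req \<Rightarrow> nat \<Rightarrow> rpoly" where "eq_den E i \<equiv> snd (nth_default ([], []) E i)"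

definition eq_coeff :: "req \<Rightarrow> nat \<Rightarrow> int \<Rightarrow> ratq" where
  "eq_coeff E i k = (if i < length E then rp_val (eq_num E i) k * rp_val (eq_den E i) k *
     (\<Prod>j<length E. if j = i then 1 else rp_val (eq_den E j) k * rp_val (eq_den E j) k) else 0)"

definition f_eq_coeff :: "req \<Rightarrow> nat \<Rightarrow> int \<Rightarrow> frac" where
  "f_eq_coeff E i k = (if i < length E then f_mult (f_mult (f_rp (eq_num E i) k) (f_rp (eq_den E i) k))
     (f_prod (map (\<lambda>j. if j = i then f_rat 1 1 else f_mult (f_rp (eq_den E j) k) (f_rp (eq_den E j) k)) [0..<length E]))
     else f_rat 0 1)"

lemma fval_eq_coeff [simp]: "fval (f_eq_coeff E i k) = eq_coeff E i k"
proof -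
  have "(\<lambda>j. fval (if j = i then f_rat 1 1 else f_mult (f_rp (eq_den E j) k) (f_rp (eq_den E j) k)))
    = (\<lambda>j. if j = i then 1 else rp_val (eq_den E j) k * rp_val (eq_den E j) k)"
    by (rule ext) simp
  thus ?thesis by (simp add: f_eq_coeff_def eq_coeff_def o_def prod_list_upt)
qed

lemma cmp_f_eq_coeff [cmp_intros]:
  "cmp E \<Longrightarrow> cmp i \<Longrightarrow> cmp k \<Longrightarrow> cmp (\<lambda>x. f_eq_coeff (E x) (i x) (k x))"
  unfolding f_eq_coeff_def by (intro cmp_intros cmp_comp_fst)

definition eq_size :: "req \<Rightarrow> nat" where
  "eq_size E = sum_list (map (\<lambda>p. rp_size (fst p) + rp_size (snd p)) E)"

lemma eq_size_bounds: "rp_size (eq_num E i) \<le> eq_size E" "rp_size (eq_den E i) \<le> eq_size E"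
proof -
  have "rp_size (fst p) + rp_size (snd p) \<le> eq_size E" if "p \<in> set E" for p
    unfolding eq_size_def by (rule member_le_sum_list) (use that in auto)
  moreover have "i < length E \<Longrightarrow> E ! i \<in> set E" by simp
  ultimately have "rp_size (eq_num E i) + rp_size (eq_den E i) \<le> eq_size E"
    by (cases "i < length E") (auto simp: nth_default_def rp_size_def)
  thus "rp_size (eq_num E i) \<le> eq_size E" "rp_size (eq_den E i) \<le> eq_size E" by auto
qed

lemma lau_eq_coeff:
  assumes "2 * eq_size E + length E * (2 * eq_size E) \<le> s"
  shows "lau s 0 s (\<lambda>n k. eq_coeff E i k)"
proof (cases "i < length E")
  case True
  let ?D = "eq_size E"
  have "lau (card {..<length E} * (?D + ?D)) (card {..<length E} * (0 + 0)) (card {..<length E} * (?D + ?D))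
     (\<lambda>n k. \<Prod>j\<in>{..<length E}. if j = i then 1 else rp_val (eq_den E j) k * rp_val (eq_den E j) k)"
  proof (rule lau_prod)
    fix j show "lau (?D + ?D) (0 + 0) (?D + ?D) (\<lambda>n k. if j = i then 1 else rp_val (eq_den E j) k * rp_val (eq_den E j) k)"
      using lau_mult[OF lau_rp lau_rp, OF eq_size_bounds(2) eq_size_bounds(2)] by (cases "j = i") (simp_all add: lau_one)
  qed simp
  from lau_mult[OF lau_mult[OF lau_rp lau_rp, OF eq_size_bounds(1)[of E i] eq_size_bounds(2)[of E i]] this]
  have "lau s 0 s (\<lambda>n k. rp_val (eq_num E i) k * rp_val (eq_den E i) k *
     (\<Prod>j\<in>{..<length E}. if j = i then 1 else rp_val (eq_den E j) k * rp_val (eq_den E j) k))"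
    by (rule lau_mono) (use assms in \<open>simp_all add: algebra_simps\<close>)
  thus ?thesis using True by (simp add: eq_coeff_def)
qed (simp add: eq_coeff_def lau_zero)

definition eq_good :: "req \<Rightarrow> bool" where
  "eq_good E \<longleftrightarrow> list_all (\<lambda>p. rp_nonzero (snd p)) E \<and> \<not> list_all (\<lambda>p. \<not> rp_nonzero (fst p)) E"

lemma cmpP_eq_good [cmp_intros]: "cmp f \<Longrightarrow> cmpP (\<lambda>x. eq_good (f x))"
  unfolding eq_good_def by (intro cmp_intros)

definition eq_order :: "req \<Rightarrow> nat" where
  "eq_order E = (GREATEST i. i < length E \<and> rp_nonzero (eq_num E i))"

text \<open>Beyond \<open>eq_size\<close> every nonzero numerator or denominator is nonzero at q^k
  by \<open>rp_val_nonzero\<close>, and so is the product that forms the leading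
  coefficient.\<close>

lemma eq_order:
  assumes "eq_good E"
  shows "eq_order E < length E" "rp_nonzero (eq_num E (eq_order E))"
    "\<And>i. i > eq_order E \<Longrightarrow> eq_coeff E i k = 0"
    "\<And>k. int (eq_size E + 1) \<le> k \<Longrightarrow> eq_coeff E (eq_order E) k \<noteq> 0"
proof -
  let ?P = "\<lambda>i. i < length E \<and> rp_nonzero (eq_num E i)"
  obtain p where p: "p \<in> set E" "rp_nonzero (fst p)" using assms by (auto simp: eq_good_def list_all_iff)
  then obtain i where "i < length E" "E ! i = p" by (metis in_set_conv_nth)
  hence ex: "\<exists>i. ?P i" using p by (auto simp: nth_default_def)
  have g: "?P (eq_order E)" unfolding eq_order_def by (rule GreatestI_ex_nat[OF ex, of "length E"]) auto
  thus "eq_order E < length E" "rp_nonzero (eq_num E (eq_order E))" by auto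
  show "eq_coeff E i k = 0" if "i > eq_order E" for i
  proof -
    have "\<not> ?P i"
    proof
      assume "?P i"
      hence "i \<le> eq_order E" unfolding eq_order_def by (rule Greatest_le_nat[of _ _ "length E"]) auto
      thus False using that by simp
    qed
    thus ?thesis by (auto simp: eq_coeff_def rp_val_zero)
  qed
  fix k assume k: "int (eq_size E + 1) \<le> k"
  define n where "n = nat k"
  have n: "k = int n" "eq_size E < n" using k by (auto simp: n_def)
  have den: "rp_val (eq_den E j) k \<noteq> 0" if "j < length E" for j
    unfolding n(1) using assms that eq_size_bounds(2)[of E j] n(2)
    by (intro rp_val_nonzero) (auto simp: eq_good_def list_all_iff nth_default_def)
  moreover have "rp_val (eq_num E (eq_order E)) k \<noteq> 0"
    unfolding n(1) using g eq_size_bounds(1)[of E "eq_order E"] n(2) by (intro rp_val_nonzero) auto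
  ultimately show "eq_coeff E (eq_order E) k \<noteq> 0" using g by (auto simp: eq_coeff_def)
qed

section \<open>Certificates\<close>

type_synonym rdata = "(int list list \<times> int list list) \<times> (int \<times> int) list"

definition lin_of :: "int list \<Rightarrow> linform" where
  "lin_of l = (nth_default 0 l 0, nth_default 0 l 1, nth_default 0 l 2)"

text \<open>
  The factors \<open>qfac k / qfac k\<close> and \<open>qfac (n - k) / qfac (n - k)\<close> restrict the term to \<open>0 \<le> k \<le> n\<close>.
\<close>

definition d_ns :: "rdata \<Rightarrow> linform list" where
  "d_ns T = (0, 1, 0) # (1, - 1, 0) # map lin_of (fst (fst T))"
definition d_ds :: "rdata \<Rightarrow> linform list" where
  "d_ds T = (0, 1, 0) # (1, - 1, 0) # map lin_of (snd (fst T))"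

text \<open>Meant for exact division by a positive number; on other inputs it only has to be total
  and computable.\<close>

definition idiv :: "int \<Rightarrow> int \<Rightarrow> int" where
  "idiv a b = (if 0 \<le> a then int (nat a div nat b) else - int (nat (- a) div nat b))"

abbreviation d_num :: "rdata \<Rightarrow> nat \<Rightarrow> int" where "d_num T i \<equiv> fst (nth_default (0, 1) (snd T) i)"
abbreviation d_den :: "rdata \<Rightarrow> nat \<Rightarrow> int" where "d_den T i \<equiv> snd (nth_default (0, 1) (snd T) i)"

text \<open>Change to the binomial basis: \<open>a * n ^ 2 + d * n\<close> is
  \<open>2 * a * tri n + (a + d) * n\<close>. For an integer-valued form the new coefficients are
  integers even where the old ones are not.\<close>

definition d_q :: "rdata \<Rightarrow> qform" where
  "d_q T = (idiv (2 * d_num T 0) (d_den T 0), idiv (d_num T 1) (d_den T 1), idiv (2 * d_num T 2) (d_den T 2),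
     idiv (d_num T 0 * d_den T 3 + d_num T 3 * d_den T 0) (d_den T 0 * d_den T 3),
     idiv (d_num T 2 * d_den T 4 + d_num T 4 * d_den T 2) (d_den T 2 * d_den T 4),
     idiv (d_num T 5) (d_den T 5))"

lemma cmp_lin_of [cmp_intros]: "cmp f \<Longrightarrow> cmp (\<lambda>x. lin_of (f x))"
  unfolding lin_of_def by (intro cmp_intros)
lemma cmp_d_ns [cmp_intros]: "cmp f \<Longrightarrow> cmp (\<lambda>x. d_ns (f x))"
  unfolding d_ns_def by (intro cmp_intros)
lemma cmp_d_ds [cmp_intros]: "cmp f \<Longrightarrow> cmp (\<lambda>x. d_ds (f x))"
  unfolding d_ds_def by (intro cmp_intros)
lemma cmp_idiv [cmp_intros]: "cmp f \<Longrightarrow> cmp g \<Longrightarrow> cmp (\<lambda>x. idiv (f x) (g x))"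
  unfolding idiv_def by (intro cmp_intros)
lemma cmp_d_q [cmp_intros]: "cmp f \<Longrightarrow> cmp (\<lambda>x. d_q (f x))"
  unfolding d_q_def by (intro cmp_intros)

definition nabs :: "int \<Rightarrow> nat" where "nabs x = nat x + nat (- x)"
lemma nabs: "\<bar>x\<bar> = int (nabs x)" by (simp add: nabs_def)
lemma cmp_nabs [cmp_intros]: "cmp f \<Longrightarrow> cmp (\<lambda>x. nabs (f x))"
  unfolding nabs_def by (intro cmp_intros)

definition lin_size :: "linform \<Rightarrow> nat" where
  "lin_size l = nabs (fst l) + nabs (fst (snd l)) + nabs (snd (snd l))"
lemma cmp_lin_size [cmp_intros]: "cmp f \<Longrightarrow> cmp (\<lambda>x. lin_size (f x))"
  unfolding lin_size_def by (intro cmp_intros)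

definition q_size :: "qform \<Rightarrow> nat" where
  "q_size q = nabs (fst q) + nabs (fst (snd q)) + nabs (fst (snd (snd q))) + nabs (fst (snd (snd (snd q))))
     + nabs (fst (snd (snd (snd (snd q))))) + nabs (snd (snd (snd (snd (snd q)))))"
lemma cmp_q_size [cmp_intros]: "cmp f \<Longrightarrow> cmp (\<lambda>x. q_size (f x))"
  unfolding q_size_def by (intro cmp_intros)

type_synonym ieq = "int list list list"

text \<open>A sum dominates each of its terms, so this one computable number meets every bound
  required by \<open>summand\<close>, that on the candidate operator included.\<close>

definition bnd :: "rdata \<Rightarrow> req \<Rightarrow> ieq \<Rightarrow> nat" where
  "bnd T E E' = 10 + length (d_ns T) + length (d_ds T) + sum_list (map lin_size (d_ns T)) + sum_list (map lin_size (d_ds T))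
     + q_size (d_q T) + length E + (2 * eq_size E + length E * (2 * eq_size E)) + length E'
     + sum_list (map (\<lambda>P. rp_size (rp_of_int P)) E')"

lemma cmp_eq_size [cmp_intros]: "cmp f \<Longrightarrow> cmp (\<lambda>x. eq_size (f x))"
  unfolding eq_size_def by (intro cmp_intros)
lemma cmp_bnd [cmp_intros]: "cmp T \<Longrightarrow> cmp E \<Longrightarrow> cmp E' \<Longrightarrow> cmp (\<lambda>x. bnd (T x) (E x) (E' x))"
  unfolding bnd_def by (intro cmp_intros)

lemma cmp_power_const: "cmp f \<Longrightarrow> cmp (\<lambda>x. f x ^ c :: nat)"
  by (induction c) (simp_all add: cmp_intros)

lemma cmp_par_N [cmp_intros]: "cmp f \<Longrightarrow> cmp (\<lambda>x. par_N (f x))"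
  unfolding par_N_def par_n0_def par_H_def par_G_def par_F1_def par_F_def par_V_def par_w_def par_I_def par_J_def
  by (intro cmp_power_const cmp_intros)

definition eps :: "ieq \<Rightarrow> nat \<times> nat \<times> nat \<Rightarrow> rat" where
  "eps E' = (\<lambda>(h, a, i). rp_coeff (rp_of_int (nth_default [] E' i)) h a)"

abbreviation d_term :: "rdata \<Rightarrow> int \<Rightarrow> int \<Rightarrow> ratq" where
  "d_term T \<equiv> hterm (d_ns T) (d_ds T) (d_q T)"

definition ieq_val :: "ieq \<Rightarrow> nat \<Rightarrow> int \<Rightarrow> ratq" where
  "ieq_val E' i n = rp_val (rp_of_int (nth_default [] E' i)) n"

text \<open>The coefficient of \<open>g k\<close> when the operator coded by \<open>E'\<close> is
  applied to the sum at \<open>n\<close>; see \<open>gam_sum\<close>.\<close>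

definition gam :: "rdata \<Rightarrow> ieq \<Rightarrow> nat \<Rightarrow> nat \<Rightarrow> ratq" where
  "gam T E' n k = (\<Sum>i<length E'. ieq_val E' i (int n) * d_term T (int n + int i) (int k))"

definition Jsum :: "rdata \<Rightarrow> (nat \<Rightarrow> ratq) \<Rightarrow> nat \<Rightarrow> ratq" where
  "Jsum T g n = (\<Sum>k\<le>n. d_term T (int n) (int k) * g k)"

lemma summandI:
  assumes "eq_good E"
  shows "summand (bnd T E E') (eq_order E) (eq_size E + 1) (d_ns T) (d_ds T) (d_q T) (eq_coeff E)"
proof
  let ?s = "bnd T E E'"
  fix l assume "l \<in> set (d_ns T) \<union> set (d_ds T)"
  hence "lin_size l \<le> sum_list (map lin_size (d_ns T)) + sum_list (map lin_size (d_ds T))"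
    using member_le_sum_list[of "lin_size l" "map lin_size (d_ns T)"] member_le_sum_list[of "lin_size l" "map lin_size (d_ds T)"]
    by (auto simp: trans_le_add1 trans_le_add2)
  hence "lin_size l \<le> ?s" by (simp add: bnd_def)
  thus "lf_bounded ?s l" by (cases l) (auto simp: lin_size_def nabs)
next
  have "q_size (d_q T) \<le> bnd T E E'" by (simp add: bnd_def)
  thus "qf_bounded (bnd T E E') (d_q T)" by (cases "d_q T") (auto simp: q_size_def nabs)
next
  fix i show "lau (bnd T E E') 0 (bnd T E E') (\<lambda>n k. eq_coeff E i k)"
    by (rule lau_eq_coeff) (simp add: bnd_def)
qed (use eq_order[OF assms] in \<open>auto simp: bnd_def d_ns_def\<close>)

lemma rp_size_ieq: "rp_size (rp_of_int (nth_default [] E' i)) \<le> bnd T E E'"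
proof (cases "i < length E'")
  case True
  hence "rp_size (rp_of_int (E' ! i)) \<le> sum_list (map (\<lambda>P. rp_size (rp_of_int P)) E')"
    by (intro member_le_sum_list) auto
  thus ?thesis using True by (simp add: bnd_def nth_default_def)
qed (simp add: nth_default_def rp_of_int_def rp_size_def)

lemma nop_eps: "nop (bnd T E E') (eps E') c n k = (\<Sum>i<length E'. ieq_val E' i n * c (n + int i) k)"
proof -
  let ?s = "bnd T E E'"
  have len: "length E' \<le> ?s" by (simp add: bnd_def)
  have v: "ieq_val E' i n = (\<Sum>a\<le>?s. \<Sum>h\<le>?s. of_rat (eps E' (h, a, i)) * qp (int h + int a * n))" for i
    unfolding ieq_val_def eps_def split
    using order_trans[OF rp_size_bounds(1) rp_size_ieq] order_trans[OF rp_size_bounds(2) rp_size_ieq]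
    by (intro rp_val_sum)
  have v0: "ieq_val E' i n = 0" if "\<not> i < length E'" for i
    using that by (simp add: ieq_val_def nth_default_def rp_of_int_def rp_val_def)
  have "nop ?s (eps E') c n k = (\<Sum>i\<le>?s. \<Sum>h\<le>?s. \<Sum>a\<le>?s. of_rat (eps E' (h, a, i)) * qp (int h + int a * n) * c (n + int i) k)"
    unfolding nop_def cube_def sum.cartesian_product[symmetric] by (subst sum_rotate) simp
  also have "\<dots> = (\<Sum>i\<le>?s. \<Sum>a\<le>?s. \<Sum>h\<le>?s. of_rat (eps E' (h, a, i)) * qp (int h + int a * n) * c (n + int i) k)"
    by (rule sum.cong[OF refl], rule sum.swap)
  also have "\<dots> = (\<Sum>i\<le>?s. ieq_val E' i n * c (n + int i) k)"
    by (simp add: v sum_distrib_right)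
  also have "\<dots> = (\<Sum>i<length E'. ieq_val E' i n * c (n + int i) k)"
    by (rule sum.mono_neutral_right) (use len v0 in auto)
  finally show ?thesis .
qed

lemma d_term_zero: "k > n \<Longrightarrow> d_term T n k = 0"
proof -
  assume "k > n"
  hence "qfac (lf (1, - 1, 0) n k) = 0" by (simp add: qfac_neg)
  hence "(\<Prod>l\<leftarrow>d_ns T. qfac (lf l n k)) = 0" by (simp add: d_ns_def)
  thus ?thesis by (simp add: hterm_def)
qed

lemma gam_zero: "k \<ge> n + length E' \<Longrightarrow> gam T E' n k = 0"
  unfolding gam_def by (intro sum.neutral) (auto simp: d_term_zero)

lemma gam_sum:
  assumes "L \<ge> n + length E'"
  shows "(\<Sum>k<L. gam T E' n k * g k) = (\<Sum>i<length E'. ieq_val E' i (int n) * Jsum T g (n + i))"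
proof -
  have "(\<Sum>k<L. gam T E' n k * g k) = (\<Sum>i<length E'. \<Sum>k<L. ieq_val E' i (int n) * (d_term T (int n + int i) (int k) * g k))"
    unfolding gam_def sum_distrib_right by (subst sum.swap) (simp add: mult.assoc)
  also have "\<dots> = (\<Sum>i<length E'. ieq_val E' i (int n) * Jsum T g (n + i))"
  proof (intro sum.cong refl)
    fix i assume i: "i \<in> {..<length E'}"
    have "Jsum T g (n + i) = (\<Sum>k<L. d_term T (int n + int i) (int k) * g k)"
      unfolding Jsum_def using i assms by (intro sum.mono_neutral_cong_left) (auto simp: d_term_zero)
    thus "(\<Sum>k<L. ieq_val E' i (int n) * (d_term T (int n + int i) (int k) * g k)) = ieq_val E' i (int n) * Jsum T g (n + i)"
      by (simp add: sum_distrib_left)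
  qed
  finally show ?thesis .
qed

lemma Rsum_eq:
  assumes "eq_good E"
  shows "summand.Rsum (bnd T E E') (d_ns T) (d_ds T) (d_q T) (eps E') g n
    = (\<Sum>i<length E'. ieq_val E' i (int n) * Jsum T g (n + i))"
proof -
  interpret summand "bnd T E E'" "eq_order E" "eq_size E + 1" "d_ns T" "d_ds T" "d_q T" "eq_coeff E" "eps E'"
    by (rule summandI[OF assms])
  let ?s = "bnd T E E'"
  have "Rsum g n = (\<Sum>k\<in>int ` {..<n + ?s + 1}. f (int n) k * g (nat k))"
  proof -
    have "{0..int n + int ?s} = int ` {..<n + ?s + 1}"
      using image_int_atLeastLessThan[of 0 "n + ?s + 1"] by (auto simp: lessThan_atLeast0)
    thus ?thesis by (simp add: Rsum_def)
  qed
  also have "\<dots> = (\<Sum>k<n + ?s + 1. gam T E' n k * g k)"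
    by (subst sum.reindex) (auto simp: nop_eps gam_def)
  also have "\<dots> = (\<Sum>i<length E'. ieq_val E' i (int n) * Jsum T g (n + i))"
    by (rule gam_sum) (simp add: bnd_def)
  finally show ?thesis .
qed

section \<open>Checking a certificate\<close>

definition f_hterm :: "rdata \<Rightarrow> int \<Rightarrow> int \<Rightarrow> frac" where
  "f_hterm T n k = f_mult (f_mult
     (f_prod (map (\<lambda>l. f_qfac (fst l * n + fst (snd l) * k + snd (snd l))) (d_ns T)))
     (f_prod (map (\<lambda>l. f_inv (f_qfac (fst l * n + fst (snd l) * k + snd (snd l)))) (d_ds T))))
     (f_qp (fst (d_q T) * int (nat (n * (n - 1)) div 2) + fst (snd (d_q T)) * n * k
        + fst (snd (snd (d_q T))) * int (nat (k * (k - 1)) div 2) + fst (snd (snd (snd (d_q T)))) * n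
        + fst (snd (snd (snd (snd (d_q T))))) * k + snd (snd (snd (snd (snd (d_q T)))))))"

lemma fval_hterm [simp]: "fval (f_hterm T n k) = d_term T n k"
proof -
  have tri: "int (nat (n * (n - 1)) div 2) = tri n" for n
  proof -
    have "0 \<le> n * (n - 1)" by (cases "n \<ge> 1") (auto simp: mult_nonpos_nonpos)
    thus ?thesis by (simp add: tri_def zdiv_int)
  qed
  have lf: "fst l * n + fst (snd l) * k + snd (snd l) = lf l n k" for l by (cases l) simp
  show ?thesis unfolding f_hterm_def tri lf hterm_def
    by (cases "d_q T") (simp add: o_def)
qed

lemma cmp_f_hterm [cmp_intros]: "cmp T \<Longrightarrow> cmp n \<Longrightarrow> cmp k \<Longrightarrow> cmp (\<lambda>x. f_hterm (T x) (n x) (k x))"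
  unfolding f_hterm_def by (intro cmp_intros cmp_comp_fst)

definition f_gam :: "rdata \<Rightarrow> ieq \<Rightarrow> nat \<Rightarrow> nat \<Rightarrow> frac" where
  "f_gam T E' n k = f_sum (map (\<lambda>i. f_mult (f_rp (rp_of_int (nth_default [] E' i)) (int n))
     (f_hterm T (int n + int i) (int k))) [0..<length E'])"

lemma sum_list_upt: "sum_list (map f [0..<n]) = (\<Sum>i<n. f i :: 'a::comm_monoid_add)"
  by (induction n) (simp_all add: add.commute)

lemma fval_gam [simp]: "fval (f_gam T E' n k) = gam T E' n k"
  by (simp add: f_gam_def gam_def o_def sum_list_upt ieq_val_def)

lemma cmp_f_gam [cmp_intros]: "cmp T \<Longrightarrow> cmp E' \<Longrightarrow> cmp n \<Longrightarrow> cmp k \<Longrightarrow> cmp (\<lambda>x. f_gam (T x) (E' x) (n x) (k x))"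
  unfolding f_gam_def by (intro cmp_intros cmp_comp_fst)

definition f_comb :: "req \<Rightarrow> frac list \<Rightarrow> nat \<Rightarrow> frac" where
  "f_comb E \<mu> k = f_sum (map (\<lambda>m. f_mult (nth_default (f_rat 0 1) \<mu> m)
     (if m \<le> k then f_eq_coeff E (k - m) (int m) else f_rat 0 1)) [0..<length \<mu>])"

lemma fval_comb:
  assumes "eq_good E"
  shows "fval (f_comb E \<mu> k) = (\<Sum>m<length \<mu>. fval (\<mu> ! m) * row (eq_order E) (eq_coeff E) m k)"
proof -
  have "fval (f_comb E \<mu> k) = (\<Sum>m<length \<mu>. fval (nth_default (f_rat 0 1) \<mu> m) *
     fval (if m \<le> k then f_eq_coeff E (k - m) (int m) else f_rat 0 1))"
    by (simp add: f_comb_def o_def sum_list_upt)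
  also have "\<dots> = (\<Sum>m<length \<mu>. fval (\<mu> ! m) * row (eq_order E) (eq_coeff E) m k)"
    using eq_order(3)[OF assms] by (intro sum.cong refl) (auto simp: row_def nth_default_def)
  finally show ?thesis .
qed

lemma cmp_f_comb [cmp_intros]: "cmp E \<Longrightarrow> cmp \<mu> \<Longrightarrow> cmp k \<Longrightarrow> cmp (\<lambda>x. f_comb (E x) (\<mu> x) (k x))"
  unfolding f_comb_def by (intro cmp_intros cmp_comp_fst)

text \<open>Entry \<open>n\<close> of \<open>\<Lambda>\<close> lists multipliers that exhibit the
  functional \<open>gam T E' n\<close> as a combination of instances of the equation. The range of
  \<open>k\<close> contains the support of both sides: \<open>gam\<close> stops before
  \<open>n + length E'\<close>, and the row of \<open>m\<close> at \<open>m\<close> plus the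
  order.\<close>

definition certified :: "rdata \<Rightarrow> req \<Rightarrow> ieq \<Rightarrow> frac list list \<Rightarrow> bool" where
  "certified T E E' \<Lambda> \<longleftrightarrow> list_all (\<lambda>n. list_all (\<lambda>k.
       f_zero (f_add (f_gam T E' n k) (f_mult (f_rat (- 1) 1) (f_comb E (nth_default [] \<Lambda> n) k))))
     [0..<par_N (bnd T E E') + length E' + sum_list (map length \<Lambda>) + length E + 1])
     [0..<Suc (par_N (bnd T E E'))]"

lemma cmpP_certified [cmp_intros]:
  "cmp T \<Longrightarrow> cmp E \<Longrightarrow> cmp E' \<Longrightarrow> cmp \<Lambda> \<Longrightarrow> cmpP (\<lambda>x. certified (T x) (E x) (E' x) (\<Lambda> x))"
  unfolding certified_def by (intro cmp_intros cmp_comp_fst)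

text \<open>The multipliers make the operator annihilate the sum up to \<open>par_N\<close> for
  every solution \<open>g\<close>; \<open>vanishing\<close> extends this to all
  \<open>n\<close>.\<close>

lemma certified_sound:
  assumes E: "eq_good E" and c: "certified T E E' \<Lambda>" and g: "solves (eq_order E) (eq_coeff E) g"
  shows "(\<Sum>i<length E'. ieq_val E' i (int n) * Jsum T g (n + i)) = 0"
proof -
  interpret summand "bnd T E E'" "eq_order E" "eq_size E + 1" "d_ns T" "d_ds T" "d_q T" "eq_coeff E" "eps E'"
    by (rule summandI[OF E])
  let ?b = "eq_coeff E" and ?d = "eq_order E"
  have "Rsum g n = 0" if n: "n \<le> par_N (bnd T E E')" for n
  proof -
    define \<mu> where "\<mu> = nth_default [] \<Lambda> n"
    define K where "K = par_N (bnd T E E') + length E' + sum_list (map length \<Lambda>) + length E + 1"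
    have \<mu>K: "n + length E' + length \<mu> + length E < K"
    proof -
      have "length \<mu> \<le> sum_list (map length \<Lambda>)"
        unfolding \<mu>_def by (cases "n < length \<Lambda>") (auto simp: nth_default_def intro!: member_le_sum_list)
      thus ?thesis using n by (simp add: K_def)
    qed
    have eq: "gam T E' n k = (\<Sum>m<length \<mu>. fval (\<mu> ! m) * row ?d ?b m k)" if "k < K" for k
    proof -
      have "f_zero (f_add (f_gam T E' n k) (f_mult (f_rat (- 1) 1) (f_comb E \<mu> k)))"
      proof -
        have "n \<in> set [0..<Suc (par_N (bnd T E E'))]" "k \<in> set [0..<K]" using n that by auto
        thus ?thesis using c unfolding certified_def list_all_iff K_def \<mu>_def by blast
      qed
      thus ?thesis by (simp add: fval_zero fval_comb[OF E])
    qed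
    have "(\<Sum>i<length E'. ieq_val E' i (int n) * Jsum T g (n + i)) = (\<Sum>k<K. gam T E' n k * g k)"
      using gam_sum[of n E' K T g] \<mu>K by simp
    also have "\<dots> = (\<Sum>k<K. \<Sum>m<length \<mu>. fval (\<mu> ! m) * (row ?d ?b m k * g k))"
      by (simp add: eq sum_distrib_right mult.assoc)
    also have "\<dots> = (\<Sum>m<length \<mu>. fval (\<mu> ! m) * (\<Sum>k<K. row ?d ?b m k * g k))"
      by (subst sum.swap) (simp add: sum_distrib_left)
    also have "\<dots> = 0"
    proof (intro sum.neutral ballI)
      fix m assume "m \<in> {..<length \<mu>}"
      hence "m + ?d < K" using \<mu>K eq_order(1)[OF E] by simp
      from row_sum[OF this, of ?b g] g show "fval (\<mu> ! m) * (\<Sum>k<K. row ?d ?b m k * g k) = 0"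
        by (simp add: solves_def)
    qed
    finally show ?thesis by (simp add: Rsum_eq[OF E])
  qed
  from vanishing[OF g this, of n] show ?thesis by (simp add: Rsum_eq[OF E])
qed

section \<open>Integer presentations of polynomials and rational functions\<close>

lemma common_denominator:
  assumes "finite (S :: rat set)"
  shows "\<exists>z>0. \<forall>r\<in>S. of_int z * r \<in> \<int>"
  using assms
proof (induction S rule: finite_induct)
  case empty
  show ?case by (intro exI[of _ 1]) auto
next
  case (insert r S)
  then obtain z where z: "z > 0" "\<forall>r\<in>S. of_int z * r \<in> \<int>" by blast
  obtain a b where ab: "quotient_of r = (a, b)" by force
  hence b: "b > 0" and r: "r = of_int a / of_int b"
    using quotient_of_denom_pos quotient_of_div by auto
  have "of_int (z * b) * x \<in> \<int>" if "x \<in> insert r S" for x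
  proof (cases "x = r")
    case True
    have "of_int (z * b) * r = of_int (z * a)" using b by (simp add: r)
    thus ?thesis using True by (metis Ints_of_int)
  next
    case False
    have "of_int (z * b) * x = of_int b * (of_int z * x)" by simp
    thus ?thesis using z(2) that False by (metis Ints_mult Ints_of_int insertE)
  qed
  thus ?case using z b by (intro exI[of _ "z * b"]) auto
qed

definition int_coeffs :: "int \<Rightarrow> rat poly \<Rightarrow> int list" where
  "int_coeffs z p = map (\<lambda>r. \<lfloor>of_int z * r\<rfloor>) (coeffs p)"

lemma ratq_of_poly_coeffs: "ratq_of_poly p = foldr (\<lambda>r s. of_rat r + qvar * s) (coeffs p) 0"
  by (induction p) (simp_all add: ratq_of_poly_pCons cCons_def)

lemma ip_val_int_coeffs:
  assumes "\<And>r. r \<in> set (coeffs p) \<Longrightarrow> of_int z * r \<in> \<int>"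
  shows "ip_val (int_coeffs z p) = of_int z * ratq_of_poly p"
proof -
  have "ip_val (map (\<lambda>r. \<lfloor>of_int z * r\<rfloor>) cs) = of_int z * foldr (\<lambda>r s. of_rat r + qvar * s) cs 0"
    if "\<And>r. r \<in> set cs \<Longrightarrow> of_int z * r \<in> \<int>" for cs
    using that
  proof (induction cs)
    case (Cons r cs)
    have "rat_of_int \<lfloor>of_int z * r\<rfloor> = of_int z * r" using Cons.prems[of r] by simp
    hence "of_rat (rat_of_int \<lfloor>of_int z * r\<rfloor>) = (of_rat (of_int z * r) :: ratq)" by (simp only:)
    hence "of_int \<lfloor>of_int z * r\<rfloor> = (of_int z * of_rat r :: ratq)" by (simp only: of_rat_of_int_eq of_rat_mult)
    thus ?case using Cons by (simp add: algebra_simps)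
  qed simp
  thus ?thesis using assms by (simp add: int_coeffs_def ratq_of_poly_coeffs)
qed

lemma fval_surj: "\<exists>a. fval a = x"
proof -
  obtain p r where x: "x = Fraction_Field.Fract p r" "r \<noteq> 0" by (cases x) auto
  obtain z where z: "z > 0" "\<forall>c\<in>set (coeffs p) \<union> set (coeffs r). of_int z * c \<in> \<int>"
    using common_denominator[of "set (coeffs p) \<union> set (coeffs r)"] by auto
  have "fval (int_coeffs z p, int_coeffs z r) = ratq_of_poly p / ratq_of_poly r"
    using z by (simp add: fval_def ip_val_int_coeffs)
  also have "\<dots> = x" by (simp add: x ratq_of_poly_def)
  finally show ?thesis by blast
qed

text \<open>Without trailing zeros at either level, the lists are the coefficient lists of the
  polynomials they denote, and their codes need no normalization. The defaults \<open>[0]\<close>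
  and \<open>1\<close> let empty lists pass; the last conjunct says that the equation is
  nontrivial.\<close>

definition ieq_canonical :: "ieq \<Rightarrow> bool" where
  "ieq_canonical E' \<longleftrightarrow> list_all (\<lambda>P. nth_default [0] (rev P) 0 \<noteq> [] \<and>
     list_all (\<lambda>c. nth_default 1 (rev c) 0 \<noteq> 0) P) E' \<and> \<not> list_all (\<lambda>P. P = []) E'"

lemma cmpP_ieq_canonical [cmp_intros]: "cmp f \<Longrightarrow> cmpP (\<lambda>x. ieq_canonical (f x))"
  unfolding ieq_canonical_def by (intro cmp_intros)

lemma nth_default_rev: "xs \<noteq> [] \<Longrightarrow> nth_default d (rev xs) 0 = last xs"
  by (cases xs rule: rev_cases) simp_all

definition ieq_poly :: "int list list \<Rightarrow> rat poly poly" where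
  "ieq_poly P = Poly (map (\<lambda>c. Poly (map of_int c)) P)"

definition bev :: "rat poly poly \<Rightarrow> nat \<Rightarrow> ratq" where
  "bev P n = ratq_of_poly (poly P (monom 1 n))"

lemma ratq_of_poly_qpower: "ratq_of_poly (monom 1 n) = qvar ^ n"
  by (simp add: ratq_of_poly_monom)

lemma bev_pCons: "bev (pCons p P) n = ratq_of_poly p + qvar ^ n * bev P n"
  by (simp add: bev_def ratq_of_poly_add ratq_of_poly_mult ratq_of_poly_qpower)

lemma bev_0 [simp]: "bev 0 n = 0" by (simp add: bev_def)

lemma bev_map_poly: "poly (map_poly ratq_of_poly P) (qvar ^ n) = bev P n"
  by (induction P) (simp_all add: map_poly_pCons bev_pCons)

lemma rp_val_of_int: "rp_val (rp_of_int P) (int n) = bev (ieq_poly P) n"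
proof -
  have "rc_val (map (\<lambda>z. (z, 1)) c) = ip_val c" for c
    by (induction c) (simp_all add: rc_val_def)
  thus ?thesis
    by (induction P) (simp_all add: rp_val_def rp_of_int_def ieq_poly_def bev_pCons ip_val_poly qp_nat)
qed

definition ieq_of :: "int \<Rightarrow> rat poly poly \<Rightarrow> int list list" where
  "ieq_of z P = map (int_coeffs z) (coeffs P)"

lemma int_coeffs_last:
  assumes "\<And>r. r \<in> set (coeffs p) \<Longrightarrow> of_int z * r \<in> \<int>" "z > 0"
  shows "nth_default 1 (rev (int_coeffs z p)) 0 \<noteq> 0"
proof (cases "p = 0")
  case False
  hence ne: "coeffs p \<noteq> []" by simp
  have "of_int \<lfloor>of_int z * last (coeffs p)\<rfloor> = of_int z * last (coeffs p)"
    using assms(1)[of "last (coeffs p)"] ne by simp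
  moreover have "last (coeffs p) \<noteq> 0" using False by (simp add: last_coeffs_eq_coeff_degree)
  ultimately have "\<lfloor>of_int z * last (coeffs p)\<rfloor> \<noteq> 0" using assms(2) by auto
  thus ?thesis using ne by (simp add: nth_default_rev int_coeffs_def last_map)
qed (simp add: int_coeffs_def)

lemma ieq_of:
  assumes "\<And>p r. p \<in> set (coeffs P) \<Longrightarrow> r \<in> set (coeffs p) \<Longrightarrow> of_int z * r \<in> \<int>" "z > 0"
  shows "rp_val (rp_of_int (ieq_of z P)) (int n) = of_int z * bev P n"
    "nth_default [0] (rev (ieq_of z P)) 0 \<noteq> []"
    "list_all (\<lambda>c. nth_default 1 (rev c) 0 \<noteq> 0) (ieq_of z P)"
    "ieq_of z P = [] \<longleftrightarrow> P = 0"
proof -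
  have "bev (Poly (map (\<lambda>p. Poly (map of_int (int_coeffs z p))) cs)) n = of_int z * bev (Poly cs) n"
    if "\<And>p r. p \<in> set cs \<Longrightarrow> r \<in> set (coeffs p) \<Longrightarrow> of_int z * r \<in> \<int>" for cs
    using that
  proof (induction cs)
    case (Cons p cs)
    have "ratq_of_poly (Poly (map of_int (int_coeffs z p))) = of_int z * ratq_of_poly p"
      unfolding ip_val_poly[symmetric] by (rule ip_val_int_coeffs) (use Cons.prems[of p] in auto)
    moreover have "bev (Poly (map (\<lambda>p. Poly (map of_int (int_coeffs z p))) cs)) n = of_int z * bev (Poly cs) n"
      by (rule Cons.IH) (use Cons.prems in auto)
    ultimately show ?case by (simp add: bev_pCons algebra_simps)
  qed simp
  from this[of "coeffs P"] assms(1)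
  show "rp_val (rp_of_int (ieq_of z P)) (int n) = of_int z * bev P n"
    by (simp add: rp_val_of_int ieq_poly_def ieq_of_def o_def)
  show "list_all (\<lambda>c. nth_default 1 (rev c) 0 \<noteq> 0) (ieq_of z P)"
    unfolding list_all_iff
  proof
    fix c assume "c \<in> set (ieq_of z P)"
    then obtain p where "p \<in> set (coeffs P)" "c = int_coeffs z p" by (auto simp: ieq_of_def)
    thus "nth_default 1 (rev c) 0 \<noteq> 0" using int_coeffs_last[of p z] assms by blast
  qed
  show "nth_default [0] (rev (ieq_of z P)) 0 \<noteq> []"
  proof (cases "P = 0")
    case False
    thus ?thesis
      by (simp add: nth_default_rev ieq_of_def last_map int_coeffs_def last_coeffs_eq_coeff_degree)
  qed (simp add: ieq_of_def)
  show "ieq_of z P = [] \<longleftrightarrow> P = 0" by (simp add: ieq_of_def)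
qed

text \<open>The recurrence for the operator 1 annihilates the sum for every solution; since it does
  so for all solutions, \<open>functional_certificate\<close> supplies the multipliers.\<close>

lemma exists_certified:
  assumes E: "eq_good E"
  shows "\<exists>E' \<Lambda>. ieq_canonical E' \<and> certified T E E' \<Lambda>"
proof -
  let ?b = "eq_coeff E" and ?d = "eq_order E"
  have "\<exists>p. (\<exists>i\<le>(N::nat). p i \<noteq> 0) \<and> (\<forall>g n. solves ?d ?b g \<longrightarrow> (\<Sum>i\<le>N. bev (p i) n * Jsum T g (n + i)) = 0)"
    if N: "N = par_I (bnd T E [[[1]]])" for N
  proof -
    \<comment> \<open>\<open>[[[1]]]\<close> is the operator 1, for which \<open>Rsum\<close> is the
      sum itself.\<close>
    interpret summand "bnd T E [[[1]]]" "eq_order E" "eq_size E + 1" "d_ns T" "d_ds T" "d_q T" "eq_coeff E" "eps [[[1]]]"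
      by (rule summandI[OF E])
    have R: "Rsum g n = Jsum T g n" for g n
      unfolding Rsum_eq[OF E] by (simp add: ieq_val_def rp_of_int_def rp_val_def rc_val_def)
    let ?V = "{..H} \<times> {..X} \<times> {..I}"
    obtain \<beta> where \<beta>: "\<exists>v\<in>?V. \<beta> v \<noteq> 0"
      "\<And>g n. solves ?d ?b g \<Longrightarrow> n0 \<le> n \<Longrightarrow>
       (\<Sum>(h, a, i)\<in>?V. of_rat (\<beta> (h, a, i)) * (qp (int h + int a * int n) * Jsum T g (n + i))) = 0"
      using recurrence unfolding R by blast
    define e where "e i = (\<Sum>a\<le>X. \<Sum>h\<le>H. monom (monom (\<beta> (h, a, i)) h) a)" for i
    \<comment> \<open>The recurrence is known from \<open>n0\<close> on, but it has to hold at every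
      \<open>n\<close>; the factor \<open>z\<close> vanishes at q^m for all
      \<open>m < n0\<close>.\<close>
    define z :: "rat poly poly" where "z = (\<Prod>m<n0. [:- monom 1 m, 1:])"
    have z: "z \<noteq> 0" by (simp add: z_def)
    have bev_e: "bev (e i) n = (\<Sum>a\<le>X. \<Sum>h\<le>H. of_rat (\<beta> (h, a, i)) * qp (int h + int a * int n))" for i n
      by (simp add: bev_def e_def poly_sum poly_monom ratq_of_poly_sum ratq_of_poly_mult ratq_of_poly_power
          ratq_of_poly_monom qp_add qp_nat power_mult[symmetric] mult.commute flip: of_nat_mult)
        (simp add: mult_ac)
    obtain h0 a0 i0 where h0: "h0 \<le> H" "a0 \<le> X" "i0 \<le> I" "\<beta> (h0, a0, i0) \<noteq> 0" using \<beta>(1) by auto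
    have "coeff (coeff (e i0) a0) h0 = \<beta> (h0, a0, i0)"
    proof -
      have "coeff (e i0) a0 = (\<Sum>a\<le>X. if a = a0 then (\<Sum>h\<le>H. monom (\<beta> (h, a0, i0)) h) else 0)"
        unfolding e_def coeff_sum by (intro sum.cong refl) simp
      also have "\<dots> = (\<Sum>h\<le>H. monom (\<beta> (h, a0, i0)) h)" using h0 by simp
      finally show ?thesis using h0 by (simp add: coeff_sum)
    qed
    hence "e i0 \<noteq> 0" using h0 by auto
    hence "z * e i0 \<noteq> 0" using z by simp
    moreover have "(\<Sum>i\<le>I. bev (z * e i) n * Jsum T g (n + i)) = 0" if g: "solves ?d ?b g" for g n
    proof -
      have m: "bev (z * e i) n = bev z n * bev (e i) n" for i by (simp add: bev_def ratq_of_poly_mult)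
      show ?thesis
      proof (cases "n0 \<le> n")
        case True
        have "(\<Sum>i\<le>I. bev (e i) n * Jsum T g (n + i)) =
           (\<Sum>i\<le>I. \<Sum>a\<le>X. \<Sum>h\<le>H. of_rat (\<beta> (h, a, i)) * (qp (int h + int a * int n) * Jsum T g (n + i)))"
          by (simp add: bev_e sum_distrib_right mult.assoc)
        also have "\<dots> = (\<Sum>i\<le>I. \<Sum>h\<le>H. \<Sum>a\<le>X. of_rat (\<beta> (h, a, i)) * (qp (int h + int a * int n) * Jsum T g (n + i)))"
          by (rule sum.cong[OF refl], rule sum.swap)
        also have "\<dots> = (\<Sum>h\<le>H. \<Sum>a\<le>X. \<Sum>i\<le>I. of_rat (\<beta> (h, a, i)) * (qp (int h + int a * int n) * Jsum T g (n + i)))"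
          by (rule sum_rotate[symmetric])
        also have "\<dots> = 0" using \<beta>(2)[OF g True] by (simp only: sum.cartesian_product)
        finally show ?thesis by (simp add: m mult.assoc flip: sum_distrib_left)
      next
        case False
        hence "poly z (monom 1 n) = 0"
          unfolding z_def poly_prod by (intro prod_zero) (auto intro!: bexI[of _ n])
        thus ?thesis by (simp add: m) (simp add: bev_def)
      qed
    qed
    ultimately show ?thesis unfolding N using h0(3) by (intro exI[of _ "\<lambda>i. z * e i"]) blast
  qed
  then obtain N p where p: "\<exists>i\<le>(N::nat). p i \<noteq> 0"
    "\<And>g n. solves ?d ?b g \<Longrightarrow> (\<Sum>i\<le>N. bev (p i) n * Jsum T g (n + i)) = 0" by blast
  have "finite (\<Union>i\<le>N. \<Union>q\<in>set (coeffs (p i)). set (coeffs q))" by auto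
  from common_denominator[OF this] obtain z where z1: "z > 0"
    and zz: "\<forall>r\<in>(\<Union>i\<le>N. \<Union>q\<in>set (coeffs (p i)). set (coeffs q)). of_int z * r \<in> \<int>"
    by (elim exE conjE)
  note z = z1
  have z2: "of_int z * r \<in> \<int>" if "i \<le> N" "q \<in> set (coeffs (p i))" "r \<in> set (coeffs q)" for i q r
    using bspec[OF zz, of r] that by auto
  define E' where "E' = map (\<lambda>i. ieq_of z (p i)) [0..<Suc N]"
  have E'_nth: "nth_default [] E' i = ieq_of z (p i)" if "i \<le> N" for i
    using that by (simp add: E'_def nth_default_def nth_append del: upt_Suc)
  have val: "ieq_val E' i (int n) = of_int z * bev (p i) n" if "i \<le> N" for i n
    unfolding ieq_val_def E'_nth[OF that] by (rule ieq_of(1)[OF z2 z]) (use that in auto)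
  have can: "ieq_canonical E'"
    unfolding ieq_canonical_def
  proof
    show "list_all (\<lambda>P. nth_default [0] (rev P) 0 \<noteq> [] \<and> list_all (\<lambda>c. nth_default 1 (rev c) 0 \<noteq> 0) P) E'"
      unfolding list_all_iff[of _ E']
    proof
      fix P assume "P \<in> set E'"
      then obtain i where i: "i \<le> N" and P: "P = ieq_of z (p i)" by (auto simp: E'_def less_Suc_eq_le simp del: upt_Suc)
      show "nth_default [0] (rev P) 0 \<noteq> [] \<and> list_all (\<lambda>c. nth_default 1 (rev c) 0 \<noteq> 0) P"
        unfolding P by (intro conjI ieq_of(2,3) z2[OF i] z)
    qed
    obtain i where i: "i \<le> N" "p i \<noteq> 0" using p(1) by blast
    have "ieq_of z (p i) = [] \<longleftrightarrow> p i = 0" by (rule ieq_of(4)[OF z2[OF i(1)] z])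
    with i have "ieq_of z (p i) \<in> set E'" "ieq_of z (p i) \<noteq> []" 
      by (auto simp: E'_def less_Suc_eq_le simp del: upt_Suc)
    thus "\<not> list_all (\<lambda>P. P = []) E'" by (auto simp: list_all_iff)
  qed
  have length_E': "length E' = Suc N" by (simp add: E'_def)
  have ann: "(\<Sum>i<length E'. ieq_val E' i (int n) * Jsum T g (n + i)) = 0" if "solves ?d ?b g" for g n
  proof -
    have "(\<Sum>i<length E'. ieq_val E' i (int n) * Jsum T g (n + i)) = of_int z * (\<Sum>i\<le>N. bev (p i) n * Jsum T g (n + i))"
      unfolding sum_distrib_left length_E' lessThan_Suc_atMost by (rule sum.cong) (simp_all add: val)
    thus ?thesis using p(2)[OF that] by simp
  qed
  \<comment> \<open>By \<open>ann\<close> the functional vanishes on all solutions, hence is a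
    combination of rows; \<open>fval_surj\<close> writes its multipliers as fractions that a code
    can carry.\<close>
  have "\<exists>\<mu>. \<forall>k. gam T E' n k = fval (f_comb E \<mu> k)" for n
  proof -
    have "\<exists>\<mu> M. \<forall>k. gam T E' n k = (\<Sum>m<M. \<mu> m * row ?d ?b m k)"
    proof (rule functional_certificate)
      show "\<And>k. int (eq_size E + 1) \<le> k \<Longrightarrow> ?b ?d k \<noteq> 0" by (rule eq_order(4)[OF E])
      show "\<And>k. n + length E' \<le> k \<Longrightarrow> gam T E' n k = 0" by (rule gam_zero)
      show "\<And>g. solves ?d ?b g \<Longrightarrow> (\<Sum>k<n + length E'. gam T E' n k * g k) = 0"
        using ann by (simp add: gam_sum)
    qed
    then obtain \<mu> M where \<mu>: "\<And>k. gam T E' n k = (\<Sum>m<M. \<mu> m * row ?d ?b m k)" by blast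
    have "\<forall>m. \<exists>a. fval a = \<mu> m" using fval_surj by blast
    from choice[OF this] obtain \<nu> where \<nu>: "\<And>m. fval (\<nu> m) = \<mu> m" by blast
    show ?thesis
      by (intro exI[of _ "map \<nu> [0..<M]"]) (simp add: fval_comb[OF E] \<mu> \<nu>)
  qed
  hence "\<forall>n. \<exists>\<mu>. \<forall>k. gam T E' n k = fval (f_comb E \<mu> k)" by blast
  from choice[OF this] obtain \<mu> where \<mu>: "\<And>n k. gam T E' n k = fval (f_comb E (\<mu> n) k)" by blast
  have "certified T E E' (map \<mu> [0..<Suc (par_N (bnd T E E'))])"
    unfolding certified_def list_all_iff
    by (intro ballI) (simp add: fval_zero \<mu> nth_default_def del: upt_Suc)
  with can show ?thesis by blast
qed

section \<open>Codes of equations and of terms\<close>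

definition rp_of_poly :: "rat poly poly \<Rightarrow> rpoly" where
  "rp_of_poly P = map (\<lambda>p. map quotient_of (coeffs p)) (coeffs P)"

definition req_of :: "qdiff_pres \<Rightarrow> req" where
  "req_of E = map (\<lambda>(P, R). (rp_of_poly P, rp_of_poly R)) E"

lemma enc_rp_of_poly: "enc (rp_of_poly P) = code_poly2 P"
proof -
  have 1: "enc (quotient_of r) = code_rat r" for r
    by (cases "quotient_of r") (simp add: code_rat_def enc_int_def)
  show ?thesis
    unfolding rp_of_poly_def enc_list_def code_poly2_def code_poly_def[abs_def] by (simp add: o_def 1)
qed

lemma dec_code_qdiff: "dec (code_qdiff E) = req_of E"
proof -
  have "enc (req_of E) = code_qdiff E"
    unfolding req_of_def enc_list_def[where 'a = "rpoly \<times> rpoly"] code_qdiff_def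
    by (simp add: o_def case_prod_beta enc_rp_of_poly cong: map_cong)
  thus ?thesis by (metis dec_enc)
qed

lemma rp_val_of_poly: "rp_val (rp_of_poly P) (int n) = bev P n"
proof -
  have rc: "rc_val (map quotient_of cs) = foldr (\<lambda>r s. of_rat r + qvar * s) cs 0" for cs
  proof (induction cs)
    case (Cons r cs)
    have "of_int (fst (quotient_of r)) / of_int (snd (quotient_of r)) = (of_rat r :: ratq)"
      by (cases "quotient_of r") (metis fst_conv of_rat_divide of_rat_of_int_eq quotient_of_div snd_conv)
    thus ?case using Cons by (simp add: rc_val_def)
  qed (simp add: rc_val_def)
  have "rp_val (map (\<lambda>p. map quotient_of (coeffs p)) ps) (int n) = bev (Poly ps) n" for ps
    by (induction ps) (simp_all add: rp_val_def bev_pCons rc qp_nat flip: ratq_of_poly_coeffs)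
  from this[of "coeffs P"] show ?thesis by (simp add: rp_of_poly_def)
qed

lemma rp_nonzero_of_poly: "P \<noteq> 0 \<Longrightarrow> rp_nonzero (rp_of_poly P)"
proof -
  assume P: "P \<noteq> 0"
  define p where "p = last (coeffs P)"
  define r where "r = last (coeffs p)"
  have p: "p \<in> set (coeffs P)" "p \<noteq> 0" using P last_in_set[of "coeffs P"] by (auto simp: p_def last_coeffs_eq_coeff_degree simp del: last_in_set)
  hence r: "r \<in> set (coeffs p)" "r \<noteq> 0" using last_in_set[of "coeffs p"] by (auto simp: r_def last_coeffs_eq_coeff_degree simp del: last_in_set)
  obtain a b where ab: "quotient_of r = (a, b)" by force
  have "b > 0" using quotient_of_denom_pos[OF ab] .
  moreover have "a \<noteq> 0" using quotient_of_div[OF ab] r by auto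
  ultimately show ?thesis
    using p r ab unfolding rp_nonzero_def list_all_iff rp_of_poly_def by force
qed

lemma eq_good_req_of:
  assumes "valid_pres E" "nontrivial_qdiff (qdiff_of E)"
  shows "eq_good (req_of E)"
proof -
  have "rp_nonzero (snd p)" if "p \<in> set (req_of E)" for p
    using that assms(1) by (auto simp: req_of_def valid_pres_def intro!: rp_nonzero_of_poly)
  moreover obtain P R where PR: "(P, R) \<in> set E" "ratqx_of_pair (P, R) \<noteq> 0"
    using assms(2) by (auto simp: nontrivial_qdiff_def qdiff_of_def)
  have "P \<noteq> 0"
    using PR(2) by (auto simp: fract_collapse)
  hence "rp_nonzero (rp_of_poly P)" "(rp_of_poly P, rp_of_poly R) \<in> set (req_of E)"
    using PR by (auto simp: req_of_def intro: rp_nonzero_of_poly)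
  ultimately show ?thesis unfolding eq_good_def list_all_iff by fastforce
qed

text \<open>The given equation says nothing at a pole. If a chosen denominator vanishes at q^k, so
  do all cleared coefficients, thanks to the squares; elsewhere the cleared equation is
  \<open>Q\<close> times the given one.\<close>

lemma solves_req_of:
  assumes E: "eq_good (req_of E)" and sat: "satisfies_qdiff (qdiff_of E) g"
  shows "solves (eq_order (req_of E)) (eq_coeff (req_of E)) g"
  unfolding solves_def
proof
  fix k
  let ?E = "req_of E" and ?L = "length E"
  have L: "length ?E = ?L" by (simp add: req_of_def)
  have num: "rp_val (eq_num ?E i) (int k) = bev (fst (E ! i)) k"
    and den: "rp_val (eq_den ?E i) (int k) = bev (snd (E ! i)) k" if "i < ?L" for i
    using that by (simp_all add: req_of_def nth_default_def case_prod_beta rp_val_of_poly)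
  have "(\<Sum>i\<le>eq_order ?E. eq_coeff ?E i (int k) * g (k + i)) = (\<Sum>i<?L. eq_coeff ?E i (int k) * g (k + i))"
    using eq_order(1,3)[OF E] L by (intro sum.mono_neutral_left) auto
  also have "\<dots> = 0"
  proof (cases "\<exists>j<?L. bev (snd (E ! j)) k = 0")
    case True
    then obtain j where j: "j < ?L" "bev (snd (E ! j)) k = 0" by blast
    have "eq_coeff ?E i (int k) = 0" if "i < ?L" for i
    proof (cases "i = j")
      case True thus ?thesis using j den[OF j(1)] by (simp add: eq_coeff_def)
    next
      case False
      hence "(\<Prod>j'<length ?E. if j' = i then 1 else rp_val (eq_den ?E j') (int k) * rp_val (eq_den ?E j') (int k)) = 0"
        using j den[OF j(1)] L by (intro prod_zero) (auto intro!: bexI[of _ j])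
      thus ?thesis by (simp add: eq_coeff_def)
    qed
    thus ?thesis by simp
  next
    case False
    define Q where "Q = (\<Prod>j<?L. bev (snd (E ! j)) k * bev (snd (E ! j)) k)"
    define vs where "vs = map (\<lambda>(P, R). bev P k / bev R k) E"
    have "list_all2 (\<lambda>a v. has_value a (qvar ^ k) v) (qdiff_of E) vs"
      unfolding list_all2_conv_all_nth
    proof (intro conjI allI impI)
      fix i assume "i < length (qdiff_of E)"
      hence i: "i < ?L" by (simp add: qdiff_of_def)
      obtain P R where PR: "E ! i = (P, R)" by force
      have "bev R k \<noteq> 0" using False i PR by auto
      thus "has_value (qdiff_of E ! i) (qvar ^ k) (vs ! i)"
        using i PR unfolding has_value_def
        by (intro exI[of _ "map_poly ratq_of_poly P"] exI[of _ "map_poly ratq_of_poly R"])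
           (simp add: qdiff_of_def vs_def bev_map_poly)
    qed (simp add: qdiff_of_def vs_def)
    hence "(\<Sum>i<length vs. vs ! i * g (k + i)) = 0" using sat unfolding satisfies_qdiff_def by blast
    hence "0 = Q * (\<Sum>i<?L. vs ! i * g (k + i))" by (simp add: vs_def)
    also have "\<dots> = (\<Sum>i<?L. eq_coeff ?E i (int k) * g (k + i))"
      unfolding sum_distrib_left
    proof (rule sum.cong[OF refl])
      fix i assume i: "i \<in> {..<?L}"
      let ?R = "\<lambda>j. bev (snd (E ! j)) k"
      have "Q = ?R i * ?R i * (\<Prod>j\<in>{..<?L} - {i}. ?R j * ?R j)"
        unfolding Q_def using i by (subst prod.remove[of _ i]) auto
      moreover have "(\<Prod>j<?L. if j = i then 1 else ?R j * ?R j) = (\<Prod>j\<in>{..<?L} - {i}. ?R j * ?R j)"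
        using i by (subst prod.remove[of _ i]) (auto intro!: prod.cong)
      moreover have "(\<Prod>j<?L. if j = i then 1 else rp_val (eq_den ?E j) (int k) * rp_val (eq_den ?E j) (int k))
          = (\<Prod>j<?L. if j = i then 1 else ?R j * ?R j)"
        by (intro prod.cong refl) (auto simp: den)
      moreover have "?R i \<noteq> 0" using False i by auto
      ultimately show "Q * (vs ! i * g (k + i)) = eq_coeff ?E i (int k) * g (k + i)"
        using i by (simp add: eq_coeff_def L num den vs_def case_prod_beta)
    qed
    finally show ?thesis by simp
  qed
  finally show "(\<Sum>i\<le>eq_order ?E. eq_coeff ?E i (int k) * g (k + i)) = 0" .
qed

section \<open>From canonical integer equations to presentations and codes\<close>

definition pres_of :: "ieq \<Rightarrow> qdiff_pres" where
  "pres_of E' = map (\<lambda>P. (ieq_poly P, 1)) E'"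

text \<open>The code of \<open>pres_of E'\<close> for canonical \<open>E'\<close>, computed on lists
  alone: integers become the pairs \<open>(z, 1)\<close>, and \<open>[[(1, 1)]]\<close> is the
  denominator 1.\<close>

definition ieq_code :: "ieq \<Rightarrow> nat" where
  "ieq_code E' = enc (map (\<lambda>P. (rp_of_int P, [[(1::int, 1::int)]])) E')"

lemma cmp_ieq_code [cmp_intros]: "cmp f \<Longrightarrow> cmp (\<lambda>x. ieq_code (f x))"
  unfolding ieq_code_def by (intro cmp_intros)

lemma coeffs_Poly_last: "(xs \<noteq> [] \<Longrightarrow> last xs \<noteq> 0) \<Longrightarrow> coeffs (Poly xs) = xs"
  by (cases xs rule: rev_cases) auto

lemma code_ieq_poly:
  assumes "nth_default [0] (rev P) 0 \<noteq> []" "list_all (\<lambda>c. nth_default 1 (rev c) 0 \<noteq> 0) P"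
  shows "rp_of_poly (ieq_poly P) = rp_of_int P"
proof -
  have c: "coeffs (Poly (map rat_of_int c)) = map of_int c" if "c \<in> set P" for c
    using assms(2) that by (intro coeffs_Poly_last) (auto simp: list_all_iff nth_default_rev last_map)
  have "coeffs (ieq_poly P) = map (\<lambda>c. Poly (map of_int c)) P"
    unfolding ieq_poly_def
  proof (rule coeffs_Poly_last)
    assume "map (\<lambda>c. Poly (map rat_of_int c)) P \<noteq> []"
    hence P: "P \<noteq> []" by simp
    hence "last P \<noteq> []" using assms(1) by (simp add: nth_default_rev)
    moreover have "last P \<in> set P" using P by simp
    ultimately have "coeffs (Poly (map rat_of_int (last P))) \<noteq> []" using c by simp
    hence "Poly (map rat_of_int (last P)) \<noteq> 0" by (metis coeffs_0_eq_Nil)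
    thus "last (map (\<lambda>c. Poly (map rat_of_int c)) P) \<noteq> 0" using P by (simp add: last_map)
  qed
  moreover have "quotient_of (rat_of_int z) = (z, 1)" for z
    by (simp add: of_int_rat quotient_of_Fract)
  ultimately show ?thesis by (simp add: rp_of_poly_def rp_of_int_def c o_def del: coeffs_Poly)
qed

lemma code_pres_of:
  assumes "ieq_canonical E'"
  shows "code_qdiff (pres_of E') = ieq_code E'" "valid_pres (pres_of E')" "nontrivial_qdiff (qdiff_of (pres_of E'))"
proof -
  have can: "rp_of_poly (ieq_poly P) = rp_of_int P" if "P \<in> set E'" for P
    using assms that by (intro code_ieq_poly) (auto simp: ieq_canonical_def list_all_iff)
  have one: "rp_of_poly 1 = [[(1, 1)]]" by (simp add: rp_of_poly_def)
  have "req_of (pres_of E') = map (\<lambda>P. (rp_of_int P, [[(1::int, 1::int)]])) E'"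
    by (simp add: req_of_def pres_of_def can one)
  thus "code_qdiff (pres_of E') = ieq_code E'"
    unfolding ieq_code_def by (metis dec_code_qdiff enc_dec)
  show "valid_pres (pres_of E')" by (auto simp: valid_pres_def pres_of_def)
  obtain P where P: "P \<in> set E'" "P \<noteq> []" using assms by (auto simp: ieq_canonical_def list_all_iff)
  have "rp_of_int P \<noteq> []" using P by (simp add: rp_of_int_def)
  hence "ieq_poly P \<noteq> 0" using can[OF P(1)] by (auto simp: rp_of_poly_def)
  hence "map_poly ratq_of_poly (ieq_poly P) \<noteq> 0" by (simp add: map_poly_eq_0_iff)
  hence "ratqx_of_pair (ieq_poly P, 1) \<noteq> 0"
    by (simp add: Zero_fract_def eq_fract)
  thus "nontrivial_qdiff (qdiff_of (pres_of E'))"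
    unfolding nontrivial_qdiff_def qdiff_of_def using P(1) by (force simp: pres_of_def)
qed

text \<open>\<open>has_value\<close> admits any representation \<open>p / r\<close> of a
  coefficient. Since the presented denominator is 1, cross-multiplication shows that the value is
  that of the numerator.\<close>

lemma satisfies_pres_of:
  assumes "\<And>n. (\<Sum>i<length E'. ieq_val E' i (int n) * J (n + i)) = 0"
  shows "satisfies_qdiff (qdiff_of (pres_of E')) J"
  unfolding satisfies_qdiff_def
proof (intro allI impI)
  fix n vs assume v: "list_all2 (\<lambda>a v. has_value a (qvar ^ n) v) (qdiff_of (pres_of E')) vs"
  have len: "length vs = length E'" using list_all2_lengthD[OF v] by (simp add: qdiff_of_def pres_of_def)
  have "vs ! i = ieq_val E' i (int n)" if "i < length E'" for i
  proof -
    have "has_value (ratqx_of_pair (ieq_poly (E' ! i), 1)) (qvar ^ n) (vs ! i)"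
      using list_all2_nthD2[OF v, of i] that len by (simp add: qdiff_of_def pres_of_def)
    then obtain p r where pr: "Fraction_Field.Fract (map_poly ratq_of_poly (ieq_poly (E' ! i))) 1 = Fraction_Field.Fract p r"
      "poly r (qvar ^ n) \<noteq> 0" "vs ! i = poly p (qvar ^ n) / poly r (qvar ^ n)"
      by (auto simp: has_value_def)
    have "r \<noteq> 0" using pr(2) by auto
    hence "map_poly ratq_of_poly (ieq_poly (E' ! i)) * r = p" using pr(1) by (simp add: eq_fract)
    hence "poly p (qvar ^ n) = bev (ieq_poly (E' ! i)) n * poly r (qvar ^ n)"
      by (metis bev_map_poly poly_mult)
    thus ?thesis using pr(2,3) that by (simp add: ieq_val_def nth_default_def rp_val_of_int)
  qed
  hence "(\<Sum>i<length vs. vs ! i * J (n + i)) = (\<Sum>i<length E'. ieq_val E' i (int n) * J (n + i))"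
    using len by simp
  thus "(\<Sum>i<length vs. vs ! i * J (n + i)) = 0" using assms by simp
qed

section \<open>Reading the data of a proper term\<close>

definition rdata_of :: "proper_data \<Rightarrow> rdata" where
  "rdata_of T = ((map (\<lambda>(a, b, c). [a, b, c]) (numer T), map (\<lambda>(a, b, c). [a, b, c]) (denom T)),
     case qexp T of (a, b, c, d, e, f) \<Rightarrow> map quotient_of [a, b, c, d, e, f])"

text \<open>The three components have different types, so the outer list is decoded as a list of
  numbers and each entry separately.\<close>

definition parse_data :: "nat \<Rightarrow> rdata" where
  "parse_data t = ((dec (nth_default 0 (dec t :: nat list) 0), dec (nth_default 0 (dec t :: nat list) 1)),
     dec (nth_default 0 (dec t :: nat list) 2))"

lemma cmp_parse_data [cmp_intros]: "cmp f \<Longrightarrow> cmp (\<lambda>x. parse_data (f x))"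
  unfolding parse_data_def by (intro cmp_intros)

lemma parse_code_proper: "parse_data (code_proper T) = rdata_of T"
proof -
  have lin: "list_encode (map code_lin ls) = enc (map (\<lambda>(a, b, c). [a, b, c]) ls)" for ls
    by (simp add: enc_list_def[where 'a = "int list"] o_def enc_int_def case_prod_beta)
       (intro arg_cong[of _ _ list_encode] map_cong refl, auto simp: enc_int_def)
  have rat: "code_rat r = enc (quotient_of r)" for r
    by (cases "quotient_of r") (simp add: code_rat_def enc_int_def)
  obtain a b c d e f where q: "qexp T = (a, b, c, d, e, f)" by (cases "qexp T") auto
  have quad: "code_quad (qexp T) = enc (map quotient_of [a, b, c, d, e, f])"
    by (simp add: q rat enc_list_def[where 'a = "int \<times> int"])
  have dec: "dec (list_encode xs) = (xs :: nat list)" for xs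
    by (simp add: dec_list_def map_idI)
  show ?thesis
    unfolding parse_data_def code_proper_def dec lin quad rdata_of_def
    by (simp add: q nth_default_def numeral_2_eq_2 del: enc_Cons list.map)
qed

lemma idiv:
  assumes "0 < w" "of_int z / of_int w \<in> (\<int> :: rat set)"
  shows "of_int (idiv z w) = (of_int z / of_int w :: rat)"
proof -
  obtain m where m: "of_int z / of_int w = (of_int m :: rat)" using assms(2) by (auto elim: Ints_cases)
  hence "of_int z = (of_int (m * w) :: rat)" using assms(1) by (simp add: field_simps)
  hence z: "z = m * w" by (simp only: of_int_eq_iff)
  have "idiv z w = m"
  proof (cases "m \<ge> 0")
    case True
    hence "nat z = nat m * nat w" using assms(1) by (simp add: z nat_mult_distrib)
    thus ?thesis using True assms(1) by (simp add: idiv_def z)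
  next
    case False
    hence "z < 0" using assms(1) by (simp add: z mult_neg_pos)
    moreover have "nat (- z) = nat (- m) * nat w"
    proof -
      have "- z = - m * w" by (simp add: z)
      thus ?thesis using False by (simp only: nat_mult_distrib)
    qed
    ultimately show ?thesis using False assms(1) by (simp add: idiv_def)
  qed
  thus ?thesis using m by simp
qed

lemma of_int_tri: "of_int (tri n) = (of_int n * (of_int n - 1) / 2 :: rat)"
proof -
  have "2 * of_int (tri n) = (of_int (n * (n - 1)) :: rat)" by (simp only: two_tri[symmetric] of_int_mult of_int_numeral)
  thus ?thesis by simp
qed

text \<open>Integrality of the binomial coefficients follows from the values at
  \<open>(0,0)\<close>, \<open>(1,0)\<close>, \<open>(0,1)\<close>, \<open>(2,0)\<close>,
  \<open>(0,2)\<close> and \<open>(1,1)\<close>; it makes the divisions in \<open>d_q\<close>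
  exact.\<close>

lemma qf_quad_eval:
  assumes "valid_proper_data T"
  shows "qf (d_q (rdata_of T)) (int n) (int k) = \<lfloor>quad_eval (qexp T) n k\<rfloor>"
proof -
  obtain a b c d e f where q: "qexp T = (a, b, c, d, e, f)" by (cases "qexp T") auto
  have v: "quad_eval (a, b, c, d, e, f) n k \<in> \<int>" for n k
    using assms by (auto simp: valid_proper_data_def q)
  have f: "f \<in> \<int>" using v[of 0 0] by simp
  have diff: "x \<in> \<int> \<Longrightarrow> y \<in> \<int> \<Longrightarrow> z = x - y \<Longrightarrow> z \<in> \<int>" for x y z :: rat by simp
  have ad: "a + d \<in> \<int>" by (rule diff[OF v[of 1 0] f]) simp
  have ce: "c + e \<in> \<int>" by (rule diff[OF v[of 0 1] f]) simp
  have a2: "2 * a \<in> \<int>"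
  proof -
    have "4 * a + 2 * d \<in> \<int>" by (rule diff[OF v[of 2 0] f]) simp
    moreover have "2 * (a + d) \<in> \<int>" by (intro Ints_mult ad) simp
    ultimately show ?thesis by (rule diff) simp
  qed
  have c2: "2 * c \<in> \<int>"
  proof -
    have "4 * c + 2 * e \<in> \<int>" by (rule diff[OF v[of 0 2] f]) simp
    moreover have "2 * (c + e) \<in> \<int>" by (intro Ints_mult ce) simp
    ultimately show ?thesis by (rule diff) simp
  qed
  have b: "b \<in> \<int>"
  proof -
    have "a + b + c + d + e \<in> \<int>" by (rule diff[OF v[of 1 1] f]) simp
    moreover have "(a + d) + (c + e) \<in> \<int>" using ad ce by simp
    ultimately show ?thesis by (rule diff) simp
  qed
  have fr: "of_int (fst (quotient_of r)) / of_int (snd (quotient_of r)) = r" for r :: rat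
    by (metis prod.collapse quotient_of_div)
  have pos: "snd (quotient_of r) > 0" for r by (rule quotient_of_denom_pos')
  have nth: "d_num (rdata_of T) 0 = fst (quotient_of a)" "d_den (rdata_of T) 0 = snd (quotient_of a)"
    "d_num (rdata_of T) 1 = fst (quotient_of b)" "d_den (rdata_of T) 1 = snd (quotient_of b)"
    "d_num (rdata_of T) 2 = fst (quotient_of c)" "d_den (rdata_of T) 2 = snd (quotient_of c)"
    "d_num (rdata_of T) 3 = fst (quotient_of d)" "d_den (rdata_of T) 3 = snd (quotient_of d)"
    "d_num (rdata_of T) 4 = fst (quotient_of e)" "d_den (rdata_of T) 4 = snd (quotient_of e)"
    "d_num (rdata_of T) 5 = fst (quotient_of f)" "d_den (rdata_of T) 5 = snd (quotient_of f)"
    by (simp_all add: rdata_of_def q nth_default_def nth_Cons')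
  have one: "of_int (idiv (fst (quotient_of r)) (snd (quotient_of r))) = r" if "r \<in> \<int>" for r :: rat
    using idiv[OF pos[of r]] that by (simp add: fr)
  have two: "of_int (idiv (2 * fst (quotient_of r)) (snd (quotient_of r))) = 2 * r" if "2 * r \<in> \<int>" for r :: rat
  proof -
    have "of_int (2 * fst (quotient_of r)) / of_int (snd (quotient_of r)) = 2 * r"
      using fr[of r] by simp
    thus ?thesis using idiv[OF pos[of r], of "2 * fst (quotient_of r)"] that by simp
  qed
  have add: "of_int (idiv (fst (quotient_of r) * snd (quotient_of t) + fst (quotient_of t) * snd (quotient_of r))
     (snd (quotient_of r) * snd (quotient_of t))) = r + t" if "r + t \<in> \<int>" for r t :: rat
  proof -
    let ?z = "fst (quotient_of r) * snd (quotient_of t) + fst (quotient_of t) * snd (quotient_of r)"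
    let ?w = "snd (quotient_of r) * snd (quotient_of t)"
    have "of_int ?z / of_int ?w = of_int (fst (quotient_of r)) / of_int (snd (quotient_of r)) +
        (of_int (fst (quotient_of t)) / of_int (snd (quotient_of t)) :: rat)"
      using pos[of r] pos[of t] by (simp add: field_simps)
    hence "of_int ?z / of_int ?w = r + t" unfolding fr .
    moreover have "0 < ?w" using pos[of r] pos[of t] by simp
    ultimately show ?thesis using idiv[of ?w ?z] that by simp
  qed
  have "rat_of_int (qf (d_q (rdata_of T)) (int n) (int k)) = quad_eval (qexp T) n k"
    unfolding d_q_def nth qf.simps of_int_add of_int_mult of_int_tri one[OF b] one[OF f] two[OF a2] two[OF c2] add[OF ad] add[OF ce] q
    by (simp add: power2_eq_square field_simps)
  thus ?thesis by (metis floor_of_int)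
qed

lemma prod_list_inverse: "prod_list (map (\<lambda>x. inverse (h x)) xs) = inverse (prod_list (map h xs :: 'a::field list))"
  by (induction xs) simp_all

text \<open>For \<open>k <= n\<close> the added factors \<open>qfac k\<close> and
  \<open>qfac (n - k)\<close> are nonzero and cancel against their reciprocals.\<close>

lemma d_term_proper_term:
  assumes "valid_proper_data T" "k \<le> n"
  shows "d_term (rdata_of T) (int n) (int k) = proper_term T n k"
proof -
  have lin: "lin_of (case l of (a, b, c) \<Rightarrow> [a, b, c]) = l" for l
    by (cases l) (simp add: lin_of_def nth_default_def)
  have lf: "lf l (int n) (int k) = lin_eval l n k" for l by (cases l) simp
  have nz: "qfac (int k) \<noteq> 0" "qfac (int n - int k) \<noteq> 0" using assms(2) by (auto intro!: qfac_nonzero)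
  have ns: "(\<Prod>l\<leftarrow>d_ns (rdata_of T). qfac (lf l (int n) (int k)))
      = qfac (int k) * (qfac (int n - int k) * (\<Prod>l\<leftarrow>numer T. qfac (lin_eval l n k)))"
    by (simp add: d_ns_def rdata_of_def o_def lin lf)
  have ds: "(\<Prod>l\<leftarrow>d_ds (rdata_of T). inverse (qfac (lf l (int n) (int k))))
      = inverse (qfac (int k)) * (inverse (qfac (int n - int k)) * inverse (\<Prod>l\<leftarrow>denom T. qfac (lin_eval l n k)))"
    by (simp add: d_ds_def rdata_of_def o_def lin lf prod_list_inverse)
  have "x * (y * u) * (inverse x * (inverse y * inverse v)) = u / v" if "x \<noteq> 0" "y \<noteq> 0" for x y u v :: ratq
    using that by (simp add: field_simps)
  from this[OF nz] show ?thesis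
    unfolding hterm_def proper_term_def ns ds qf_quad_eval[OF assms(1)] qp_def by simp
qed

text \<open>The search for a certified equation; it ends at once on inputs that carry no equation.\<close>

definition search :: "nat \<times> nat \<Rightarrow> nat \<Rightarrow> nat" where
  "search x w = (if eq_good (dec (snd x)) then
     if ieq_canonical (fst (dec w :: ieq \<times> frac list list)) \<and>
        certified (parse_data (fst x)) (dec (snd x)) (fst (dec w :: ieq \<times> frac list list)) (snd (dec w :: ieq \<times> frac list list))
     then 0 else 1 else 0)"

lemma search_succeeds: "\<exists>w. search x w = 0"
proof (cases "eq_good (dec (snd x))")
  case True
  from exists_certified[OF this, of "parse_data (fst x)"] obtain E' \<Lambda> where
    "ieq_canonical E'" "certified (parse_data (fst x)) (dec (snd x)) E' \<Lambda>" by blast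
  thus ?thesis by (intro exI[of _ "enc (E', \<Lambda>)"]) (simp add: search_def del: enc_Pair)
qed (simp add: search_def)

lemma cmp_search: "cmp (\<lambda>p. search (fst p) (snd p))"
  unfolding search_def by (intro cmp_intros)

lemma algorithm_exists:
  "\<exists>A. recursive 2 A \<and> (\<forall>T E. valid_proper_data T \<longrightarrow> valid_pres E \<longrightarrow> nontrivial_qdiff (qdiff_of E) \<longrightarrow>
     (\<exists>E'. A [code_proper T, code_qdiff E] = code_qdiff E' \<and> valid_pres E' \<and> nontrivial_qdiff (qdiff_of E') \<and>
       (\<forall>g J. satisfies_qdiff (qdiff_of E) g \<longrightarrow> (\<forall>n. J n = (\<Sum>k=0..n. proper_term T n k * g k)) \<longrightarrow>
          satisfies_qdiff (qdiff_of E') J)))"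
proof -
  define out where "out x = ieq_code (fst (dec (LEAST w. search x w = 0) :: ieq \<times> frac list list))" for x
  have "cmp out"
    unfolding out_def by (intro cmp_ieq_code cmp_fst cmp_dec cmp_Least cmp_search search_succeeds)
  from cmp_recursive2[OF this] obtain A where A: "recursive 2 A" "\<And>t e. A [t, e] = out (t, e)" by blast
  have "\<exists>E'. A [code_proper T, code_qdiff E] = code_qdiff E' \<and> valid_pres E' \<and> nontrivial_qdiff (qdiff_of E') \<and>
       (\<forall>g J. satisfies_qdiff (qdiff_of E) g \<longrightarrow> (\<forall>n. J n = (\<Sum>k=0..n. proper_term T n k * g k)) \<longrightarrow>
          satisfies_qdiff (qdiff_of E') J)"
    if T: "valid_proper_data T" and E: "valid_pres E" "nontrivial_qdiff (qdiff_of E)" for T E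
  proof -
    let ?x = "(code_proper T, code_qdiff E)"
    have good: "eq_good (req_of E)" by (rule eq_good_req_of[OF E])
    define E' where "E' = fst (dec (LEAST w. search ?x w = 0) :: ieq \<times> frac list list)"
    have "search ?x (LEAST w. search ?x w = 0) = 0" by (rule LeastI_ex[OF search_succeeds])
    then obtain \<Lambda> where can: "ieq_canonical E'" and cert: "certified (rdata_of T) (req_of E) E' \<Lambda>"
      using good by (auto simp: search_def dec_code_qdiff parse_code_proper E'_def split: if_splits)
    show ?thesis
    proof (intro exI[of _ "pres_of E'"] conjI allI impI)
      show "A [code_proper T, code_qdiff E] = code_qdiff (pres_of E')"
        unfolding A(2) out_def E'_def[symmetric] by (simp only: code_pres_of(1)[OF can])
      show "valid_pres (pres_of E')" "nontrivial_qdiff (qdiff_of (pres_of E'))"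
        by (rule code_pres_of[OF can])+
      fix g J :: "nat \<Rightarrow> ratq"
      assume g: "satisfies_qdiff (qdiff_of E) g" and J: "\<forall>n. J n = (\<Sum>k=0..n. proper_term T n k * g k)"
      have "Jsum (rdata_of T) g = J"
        using J by (auto simp: Jsum_def d_term_proper_term[OF T] atLeast0AtMost fun_eq_iff intro!: sum.cong)
      thus "satisfies_qdiff (qdiff_of (pres_of E')) J"
        using certified_sound[OF good cert solves_req_of[OF good g]] by (intro satisfies_pres_of) simp
    qed
  qed
  thus ?thesis using A(1) by blast
qed

text \<open>Each coefficient contributes its own denominator to the common multiplier
  \<open>D\<close>.\<close>

lemma ratq_poly_clear:
  "\<exists>D P. D \<noteq> 0 \<and> smult (ratq_of_poly D) p = map_poly ratq_of_poly P"
proof (induction p)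
  case 0
  show ?case by (intro exI[of _ 1] exI[of _ 0]) simp
next
  case (pCons a p)
  then obtain D P where DP: "D \<noteq> 0" "smult (ratq_of_poly D) p = map_poly ratq_of_poly P" by blast
  obtain u v where a: "a = Fraction_Field.Fract u v" "v \<noteq> 0" by (cases a) auto
  have a': "ratq_of_poly v * a = ratq_of_poly u" using a by (simp add: ratq_of_poly_def eq_fract)
  have "smult (ratq_of_poly (D * v)) (pCons a p) = pCons (ratq_of_poly D * (ratq_of_poly v * a)) (smult (ratq_of_poly v) (smult (ratq_of_poly D) p))"
    by (simp add: ratq_of_poly_mult mult_ac)
  also have "\<dots> = pCons (ratq_of_poly (D * u)) (smult (ratq_of_poly v) (map_poly ratq_of_poly P))"
    by (simp only: a' DP(2) ratq_of_poly_mult)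
  also have "smult (ratq_of_poly v) (map_poly ratq_of_poly P) = map_poly ratq_of_poly (smult v P)"
    by (intro poly_eqI) (simp add: coeff_map_poly ratq_of_poly_mult)
  also have "pCons (ratq_of_poly (D * u)) \<dots> = map_poly ratq_of_poly (pCons (D * u) (smult v P))"
    by (simp add: map_poly_pCons)
  finally show ?case using DP a by (intro exI[of _ "D * v"] exI[of _ "pCons (D * u) (smult v P)"]) auto
qed

lemma ratqx_presentation: "\<exists>p. snd p \<noteq> 0 \<and> ratqx_of_pair p = x"
proof -
  obtain p r where x: "x = Fraction_Field.Fract p r" "r \<noteq> 0" by (cases x) auto
  obtain D P where P: "D \<noteq> 0" "smult (ratq_of_poly D) p = map_poly ratq_of_poly P" using ratq_poly_clear by blast
  obtain D' R where R: "D' \<noteq> 0" "smult (ratq_of_poly D') r = map_poly ratq_of_poly R" using ratq_poly_clear by blast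
  have sm: "map_poly ratq_of_poly (smult c Q) = smult (ratq_of_poly c) (map_poly ratq_of_poly Q)" for c Q
    by (intro poly_eqI) (simp add: coeff_map_poly ratq_of_poly_mult)
  have "map_poly ratq_of_poly R \<noteq> 0" unfolding R(2)[symmetric] using R(1) x(2) by simp
  hence R0: "R \<noteq> 0" by auto
  have "ratqx_of_pair (smult D' P, smult D R) = x"
    using P R x \<open>map_poly ratq_of_poly R \<noteq> 0\<close>
    by (simp add: sm eq_fract mult.commute flip: P(2) R(2))
  thus ?thesis using R0 P(1) by (intro exI[of _ "(smult D' P, smult D R)"]) simp
qed

theorem theorem4:
  shows "(\<forall>(c :: nat \<Rightarrow> nat \<Rightarrow> ratq) (Jhat :: nat \<Rightarrow> ratq) (J :: nat \<Rightarrow> ratq).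
            proper_q_hypergeometric c \<longrightarrow> q_holonomic Jhat \<longrightarrow>
            (\<forall>n. J n = (\<Sum>k=0..n. c n k * Jhat k)) \<longrightarrow> q_holonomic J) \<and>
         (\<exists>A. recursive 2 A \<and>
            (\<forall>T E. valid_proper_data T \<longrightarrow> valid_pres E \<longrightarrow> nontrivial_qdiff (qdiff_of E) \<longrightarrow>
               (\<exists>E'. A [code_proper T, code_qdiff E] = code_qdiff E' \<and>
                  valid_pres E' \<and> nontrivial_qdiff (qdiff_of E') \<and>
                  (\<forall>(Jhat :: nat \<Rightarrow> ratq) (J :: nat \<Rightarrow> ratq).
                     satisfies_qdiff (qdiff_of E) Jhat \<longrightarrow>
                     (\<forall>n. J n = (\<Sum>k=0..n. proper_term T n k * Jhat k)) \<longrightarrow>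
                     satisfies_qdiff (qdiff_of E') J))))"
proof (intro conjI allI impI)
  fix c :: "nat \<Rightarrow> nat \<Rightarrow> ratq" and Jhat J :: "nat \<Rightarrow> ratq"
  assume c: "proper_q_hypergeometric c" and "q_holonomic Jhat" and J: "\<forall>n. J n = (\<Sum>k=0..n. c n k * Jhat k)"
  from c obtain T where T: "valid_proper_data T" "\<And>n k. c n k = proper_term T n k"
    by (auto simp: proper_q_hypergeometric_def)
  from \<open>q_holonomic Jhat\<close> obtain as where as: "nontrivial_qdiff as" "satisfies_qdiff as Jhat"
    by (auto simp: q_holonomic_def)
  \<comment> \<open>Every coefficient has a presentation over the polynomials in q, so the given
    equation is an input of the algorithm, and its output proves that the sum is
    q-holonomic.\<close>
  have "\<forall>x. \<exists>p. snd p \<noteq> 0 \<and> ratqx_of_pair p = x" using ratqx_presentation by blast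
  from choice[OF this] obtain p where p: "\<And>x. snd (p x) \<noteq> 0" "\<And>x. ratqx_of_pair (p x) = x" by blast
  have E: "qdiff_of (map p as) = as" "valid_pres (map p as)"
    using p by (auto simp: qdiff_of_def o_def valid_pres_def) (metis snd_conv)
  from algorithm_exists T(1) E as obtain E' where E': "nontrivial_qdiff (qdiff_of E')"
    "\<And>g J. satisfies_qdiff as g \<Longrightarrow> (\<forall>n. J n = (\<Sum>k=0..n. proper_term T n k * g k)) \<Longrightarrow> satisfies_qdiff (qdiff_of E') J"
    by metis
  from E'(2)[OF as(2)] J T(2) have "satisfies_qdiff (qdiff_of E') J" by simp
  with E'(1) show "q_holonomic J" unfolding q_holonomic_def by blast
qed (rule algorithm_exists)

end
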